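(* Let $\beta>1$ be a non-integer such that the greedy expansion of $1$ in base $\beta$ is $1=b_1/\beta+b_2/\beta^2+\cdots+b_n/\beta^n$ with $n\ge2$ and $b_i\ge1$ for $i=1,\ldots,n$, and assume $\beta^2\ne b_1\beta+1$. Let $p\in(0,1)$. The map $K_\beta$ is exact with respect to $m_p\otimes\mu_{\beta,p}$. Moreover, $\mu=\mu_{\beta,p}$, where $\mu$ is the measure $$\mu(B)=\sum_{j=0}^L\frac{\lambda(B\cap C_j)}{\lambda(C_j)}\cdot\pi(j),\qquad B\subset J_\beta\text{ Borel}.$$
   Context: Note $b_1=\lfloor\beta\rfloor$. Let $J_\beta=[0,b_1/(\beta-1)]$ with Borel $\sigma$-algebra $\mathcal B$, $\lambda$ the normalized Lebesgue measure on $J_\beta$. The greedy map $T_\beta:J_\beta\to J_\beta$ is $T_\beta(x)=\beta x-d$ for $x\in C(d)$, where $C(j)=[j/\beta,(j+1)/\beta)$ for $0\le j\le b_1-1$ and $C(b_1)=[b_1/\beta,b_1/(\beta-1)]$. The greedy expansion of $x$ is $x=\sum_i d_i(x)\beta^{-i}$ with $d_i(x)=d$ iff $T_\beta^{i-1}(x)\in C(d)$ (trailing zeros omitted). With $\ell(x)=b_1/(\beta-1)-x$, the lazy map is $L_\beta(x)=\beta x-d$ for $x\in\ell(C(b_1-d))$, $0\le d\le b_1$. Switch regions: $S_k=\left[\frac{k}{\beta},\frac{b_1}{\beta(\beta-1)}+\frac{k-1}{\beta}\right]$, $1\le k\le b_1$. Equality regions: $E_0=[0,\frac1\beta)$, $E_k=\left(\frac{b_1}{\beta(\beta-1)}+\frac{k-1}{\beta},\frac{k+1}{\beta}\right)$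 for $1\le k\le b_1-1$, $E_{b_1}=\left(\frac{b_1}{\beta(\beta-1)}+\frac{b_1-1}{\beta},\frac{b_1}{\beta-1}\right]$. Let $\mathcal E=\{E_0,S_1,E_1,\ldots,S_{b_1},E_{b_1}\}$, a partition of $J_\beta$. $\Omega=\{0,1\}^{\mathbb N}$ with product $\sigma$-algebra $\mathcal A$ and left shift $\sigma$; $m_p$ is the Bernoulli measure on $\Omega$: $m_p(\{\omega_1=i_1,\ldots,\omega_m=i_m\})=p^{\sum_j i_j}(1-p)^{m-\sum_j i_j}$. The map $K_\beta$ on $\Omega\times J_\beta$: $K_\beta(\omega,x)=(\omega,\beta x-k)$ if $x\in E_k$; $(\sigma(\omega),\beta x-k)$ if $x\in S_k$ and $\omega_1=1$; $(\sigma(\omega),\beta x-k+1)$ if $x\in S_k$ and $\omega_1=0$. Exactness with respect to an invariant probability measure means that every set in $\bigcap_{m\ge0}K_\beta^{-m}(\mathcal A\otimes\mathcal B)$ has measure $0$ or $1$. $\mu_{\beta,p}$ is the unique probability measure on $J_\beta$, absolutely continuous with respect to $\lambda$, satisfying $\mu_{\beta,p}=p\cdot\mu_{\beta,p}\circ T_\beta^{-1}+(1-p)\cdot\mu_{\beta,p}\circ L_\beta^{-1}$ (then $m_p\otimes\mu_{\beta,p}$ is $K_\beta$-invariant). Partition $\mathcal C$: under the assumptions, the points $T_\beta^i1$ and $T_\beta^i(\frac{b_1}{\beta-1}-1)$, $0\le i\le n-2$, are all different and lie in equality regions. Cutting the intervals of $\mathcal E$ at these points gives a partition $\mathcal C=\{C_0,C_1,\ldots,C_L\}$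 of $J_\beta$ into intervals (listed in increasing order) refining $\mathcal E$, where each point $T_\beta^i1$ belongs to the interval of which it is the left endpoint, and each point $T_\beta^i(\frac{b_1}{\beta-1}-1)$ belongs to the interval of which it is the right endpoint. Each $E_i$ is a disjoint union $\bigcup_{j\in M_i}C_j$ with $M_0,\ldots,M_{b_1}$ disjoint subsets of $\{0,\ldots,L\}$, and each $S_i$ equals exactly one $C_j$, whose index is denoted $s_i$. $\pi$ is the stationary distribution of the irreducible stochastic matrix $P=(p_{i,j})_{0\le i,j\le L}$, where $p_{i,j}=\lambda(C_i\cap T_\beta^{-1}C_j)/\lambda(C_i)$ for $i\in\bigcup_kM_k$, and for $i\in\{s_1,\ldots,s_{b_1}\}$: $p_{i,0}=p$, $p_{i,L}=1-p$, $p_{i,j}=0$ for $j\ne0,L$. *)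

theory Defs
  imports "HOL-Probability.Probability"
begin

definition b1 :: "real \<Rightarrow> nat" where
  "b1 \<beta> = nat \<lfloor>\<beta>\<rfloor>"

definition J_beta :: "real \<Rightarrow> real set" where
  "J_beta \<beta> = {0 .. b1 \<beta> / (\<beta> - 1)}"

text \<open>Because of the restriction, the underlying space is \<open>J_beta \<beta>\<close> rather than the whole line, and
  the measurable sets are the Borel subsets of \<open>J_beta \<beta>\<close>.\<close>

definition leb :: "real \<Rightarrow> real measure" where
  "leb \<beta> = uniform_measure (restrict_space lborel (J_beta \<beta>)) (J_beta \<beta>)"

definition greedy_cyl :: "real \<Rightarrow> nat \<Rightarrow> real set" where
  "greedy_cyl \<beta> j =
     (if j < b1 \<beta> then {j / \<beta> ..< (j + 1) / \<beta>} else {b1 \<beta> / \<beta> .. b1 \<beta> / (\<beta> - 1)})"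

definition reflect :: "real \<Rightarrow> real \<Rightarrow> real" where
  "reflect \<beta> x = b1 \<beta> / (\<beta> - 1) - x"

text \<open>The maps below are only meaningful on \<open>J_beta \<beta>\<close>, where the defining \<open>d\<close> (or \<open>k\<close>) exists and
  is unique.\<close>

definition greedy_digit :: "real \<Rightarrow> real \<Rightarrow> nat" where
  "greedy_digit \<beta> x = (THE d. d \<le> b1 \<beta> \<and> x \<in> greedy_cyl \<beta> d)"

definition greedy_map :: "real \<Rightarrow> real \<Rightarrow> real" where
  "greedy_map \<beta> x = \<beta> * x - greedy_digit \<beta> x"

definition lazy_digit :: "real \<Rightarrow> real \<Rightarrow> nat" where
  "lazy_digit \<beta> x = (THE d. d \<le> b1 \<beta> \<and> x \<in> reflect \<beta> ` greedy_cyl \<beta> (b1 \<beta> - d))"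

definition lazy_map :: "real \<Rightarrow> real \<Rightarrow> real" where
  "lazy_map \<beta> x = \<beta> * x - lazy_digit \<beta> x"

text \<open>The greedy expansion of \<open>x\<close> is \<open>x = b 1 / \<beta> + \<dots> + b n / \<beta> ^ n\<close>: the \<open>i\<close>-th greedy digit is
  \<open>b i\<close> for \<open>1 \<le> i \<le> n\<close>, and the omitted digits with \<open>i > n\<close> are zero.\<close>

definition finite_greedy_expansion :: "real \<Rightarrow> real \<Rightarrow> nat \<Rightarrow> (nat \<Rightarrow> nat) \<Rightarrow> bool" where
  "finite_greedy_expansion \<beta> x n b \<longleftrightarrow>
     x = (\<Sum>i=1..n. b i / \<beta> ^ i) \<and>
     (\<forall>i\<ge>1. greedy_digit \<beta> ((greedy_map \<beta> ^^ (i - 1)) x) = (if i \<le> n then b i else 0))"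

definition switch_region :: "real \<Rightarrow> nat \<Rightarrow> real set" where
  "switch_region \<beta> k = {k / \<beta> .. b1 \<beta> / (\<beta> * (\<beta> - 1)) + (real k - 1) / \<beta>}"

definition equality_region :: "real \<Rightarrow> nat \<Rightarrow> real set" where
  "equality_region \<beta> k =
     (if k = 0 then {0 ..< 1 / \<beta>}
      else if k < b1 \<beta> then {b1 \<beta> / (\<beta> * (\<beta> - 1)) + (real k - 1) / \<beta> <..< (k + 1) / \<beta>}
      else {b1 \<beta> / (\<beta> * (\<beta> - 1)) + (real (b1 \<beta>) - 1) / \<beta> <.. b1 \<beta> / (\<beta> - 1)})"

definition regions :: "real \<Rightarrow> real set set" where
  "regions \<beta> = equality_region \<beta> ` {0..b1 \<beta>} \<union> switch_region \<beta> ` {1..b1 \<beta>}"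

text \<open>The space \<open>{0,1}\<^sup>\<nat>\<close> is represented by streams of booleans, with \<open>True\<close> for \<open>1\<close>; then \<open>\<omega>\<^sub>1\<close> is
  \<open>shd \<omega>\<close> and the left shift is \<open>stl\<close>.\<close>

definition bernoulli_measure :: "real \<Rightarrow> bool stream measure" where
  "bernoulli_measure p = stream_space (measure_pmf (bernoulli_pmf p))"

definition K_beta :: "real \<Rightarrow> bool stream \<times> real \<Rightarrow> bool stream \<times> real" where
  "K_beta \<beta> = (\<lambda>(\<omega>, x).
     if \<exists>k\<le>b1 \<beta>. x \<in> equality_region \<beta> k
     then (\<omega>, \<beta> * x - real (THE k. k \<le> b1 \<beta> \<and> x \<in> equality_region \<beta> k))
     else (let k = (THE k. 1 \<le> k \<and> k \<le> b1 \<beta> \<and> x \<in> switch_region \<beta> k) in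
       if shd \<omega> then (stl \<omega>, \<beta> * x - real k) else (stl \<omega>, \<beta> * x - real k + 1)))"

definition exact_map :: "'a measure \<Rightarrow> ('a \<Rightarrow> 'a) \<Rightarrow> bool" where
  "exact_map M f \<longleftrightarrow>
     prob_space M \<and> f \<in> measurable M M \<and> distr M M f = M \<and>
     (\<forall>A \<in> (\<Inter>m. (\<lambda>B. (f ^^ m) -` B \<inter> space M) ` sets M). measure M A = 0 \<or> measure M A = 1)"

definition invariant_ac_measure :: "real \<Rightarrow> real \<Rightarrow> real measure \<Rightarrow> bool" where
  "invariant_ac_measure \<beta> p \<nu> \<longleftrightarrow>
     prob_space \<nu> \<and> sets \<nu> = sets (leb \<beta>) \<and> absolutely_continuous (leb \<beta>) \<nu> \<and>
     (\<forall>B\<in>sets (leb \<beta>).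
        measure \<nu> B = p * measure \<nu> (greedy_map \<beta> -` B \<inter> J_beta \<beta>)
          + (1 - p) * measure \<nu> (lazy_map \<beta> -` B \<inter> J_beta \<beta>))"

text \<open>A description, not a choice: nothing can be derived about \<open>mu \<beta> p\<close> unless existence and
  uniqueness are proved, and likewise for \<open>stationary_dist\<close> below.\<close>

definition mu :: "real \<Rightarrow> real \<Rightarrow> real measure" where
  "mu \<beta> p = (THE \<nu>. invariant_ac_measure \<beta> p \<nu>)"

definition left_cuts :: "real \<Rightarrow> nat \<Rightarrow> real set" where
  "left_cuts \<beta> n = (\<lambda>i. (greedy_map \<beta> ^^ i) 1) ` {0..n - 2}"

definition right_cuts :: "real \<Rightarrow> nat \<Rightarrow> real set" where
  "right_cuts \<beta> n = (\<lambda>i. (greedy_map \<beta> ^^ i) (b1 \<beta> / (\<beta> - 1) - 1)) ` {0..n - 2}"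

text \<open>A cell consists of the points of one region that are not separated by any cut. A cut in
  \<open>left_cuts\<close> separates the points below it from itself and the points above it, so it is the left
  endpoint of its cell; a cut in \<open>right_cuts\<close> is the right endpoint of its cell.\<close>

definition cells :: "real \<Rightarrow> nat \<Rightarrow> real set set" where
  "cells \<beta> n =
     {{y \<in> I. (\<forall>t\<in>left_cuts \<beta> n. t \<le> y \<longleftrightarrow> t \<le> x) \<and> (\<forall>t\<in>right_cuts \<beta> n. y \<le> t \<longleftrightarrow> x \<le> t)}
       | I x. I \<in> regions \<beta> \<and> x \<in> I}"

text \<open>For the \<open>\<beta>\<close> under consideration the cells are pairwise disjoint nondegenerate intervals, so
  sorting them by their infima lists them in increasing order.\<close>

definition cell :: "real \<Rightarrow> nat \<Rightarrow> nat \<Rightarrow> real set" where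
  "cell \<beta> n j = sorted_key_list_of_set Inf (cells \<beta> n) ! j"

definition last_index :: "real \<Rightarrow> nat \<Rightarrow> nat" where
  "last_index \<beta> n = card (cells \<beta> n) - 1"

definition equality_indices :: "real \<Rightarrow> nat \<Rightarrow> nat \<Rightarrow> nat set" where
  "equality_indices \<beta> n i = {j. j \<le> last_index \<beta> n \<and> cell \<beta> n j \<subseteq> equality_region \<beta> i}"

definition switch_index :: "real \<Rightarrow> nat \<Rightarrow> nat \<Rightarrow> nat" where
  "switch_index \<beta> n i = (THE j. j \<le> last_index \<beta> n \<and> cell \<beta> n j = switch_region \<beta> i)"

definition trans_prob :: "real \<Rightarrow> real \<Rightarrow> nat \<Rightarrow> nat \<Rightarrow> nat \<Rightarrow> real" where
  "trans_prob \<beta> p n i j =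
     (if i \<in> (\<Union>k\<in>{0..b1 \<beta>}. equality_indices \<beta> n k) then
        measure (leb \<beta>) (cell \<beta> n i \<inter> (greedy_map \<beta> -` cell \<beta> n j \<inter> J_beta \<beta>))
          / measure (leb \<beta>) (cell \<beta> n i)
      else if i \<in> switch_index \<beta> n ` {1..b1 \<beta>} then
        (if j = 0 then p else if j = last_index \<beta> n then 1 - p else 0)
      else 0)"

definition stationary_dist :: "real \<Rightarrow> real \<Rightarrow> nat \<Rightarrow> nat pmf" where
  "stationary_dist \<beta> p n =
     (THE q. set_pmf q \<subseteq> {0..last_index \<beta> n} \<and>
        (\<forall>j\<in>{0..last_index \<beta> n}. pmf q j = (\<Sum>i=0..last_index \<beta> n. pmf q i * trans_prob \<beta> p n i j)))"

end

theory Submission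
  imports Defs
begin

text \<open>The map \<open>x \<mapsto> \<beta> x - k\<close> sends cuts to cuts and endpoints of switch regions, so it maps each cell
  inside an equality region onto a union of cells, while \<open>K_beta\<close> sends the two halves of a switch
  region onto the first and the last cell. Hence the normalised measures on \<open>\<Omega> \<times> C j\<close> evolve under
  \<open>K_beta\<close> by the matrix \<open>P\<close>. Expansion forces every cell to reach a switch region, hence the first
  cell, which reaches itself in one step; so Doeblin's contraction argument gives a unique stationary
  distribution and \<open>P ^ k \<rightarrow> \<pi>\<close>.

  Let \<open>\<mu>\<close> be the measure built from \<open>\<pi>\<close>, \<open>M = m\<^sub>p \<otimes> \<mu>\<close> and \<open>\<Lambda> = m\<^sub>p \<otimes> \<lambda>\<close>. The crux is uniform mixing:
  \<open>\<Lambda> (A \<inter> K\<^sup>-\<^sup>k B) - \<Lambda> A * M B\<close> tends to 0 uniformly in \<open>B\<close>, for every \<open>A\<close>. Its limit superior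
  (the defect of \<open>A\<close>) is subadditive and contracts along \<open>K_beta\<close>. It vanishes on \<open>\<Omega> \<times> C j\<close> by the
  convergence of \<open>P ^ k\<close>, on \<open>G \<times> C j\<close> for a cylinder \<open>G\<close> by a maximum principle, on \<open>G \<times> [0, a]\<close>
  because an image of a partial cell again has one partial cell and its weight shrinks by \<open>\<beta>\<close>, and
  then on all measurable sets by Dynkin's theorem. A tail set \<open>A = K\<^sup>-\<^sup>k A\<^sub>k\<close> then satisfies
  \<open>\<Lambda> A = \<Lambda> A * M A\<close>, which is exactness; and an absolutely continuous invariant measure, being
  constant along \<open>K_beta\<close> and mixed into \<open>M\<close>, coincides with \<open>\<mu>\<close>.\<close>

section \<open>Stochastic matrices with a reachable loop\<close>

text \<open>The random map shifts \<open>\<omega>\<close> only when \<open>x\<close> is in a switch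
  region, so what is known about \<open>\<omega>\<close> is used up letter by letter at the visits
  there. Uniformity in \<open>B\<close> is essential because a tail set is a preimage of a set that
  changes with the number of steps. Starting sets are measured by \<Lambda>, since every affine
  branch scales Lebesgue measure by exactly the same factor and every absolutely continuous measure
  has a density with respect to it.

  The Markov partition rests on \<open>r = D / (\<beta> - 1) - 1\<close>, the reflection of 1; a
  switch region is \<open>k \<le> \<beta> * x \<le> k + r\<close>. Digits at least 1 keep the orbit
  of 1 at or above \<open>1 / \<beta>\<close> before it reaches 0, and
  \<open>\<beta>\<^sup>2 \<noteq> b 1 * \<beta> + 1\<close> gives \<open>r < 1 / \<beta>\<close>
  (equality there would mean \<open>r = 1 / \<beta>\<close>). Hence the orbit avoids switch regions
  until its last nonzero point \<open>b n / \<beta>\<close>, the left end of one. The same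
  inequality puts the first cell \<open>{0..r}\<close> inside the first equality region, whose
  branch fixes 0: this is the loop of the chain.\<close>

locale stochastic_matrix =
  fixes P :: "nat \<Rightarrow> nat \<Rightarrow> real" and N :: nat
  assumes P_nonneg: "\<And>i j. i \<le> N \<Longrightarrow> j \<le> N \<Longrightarrow> 0 \<le> P i j"
    and P_sum: "\<And>i. i \<le> N \<Longrightarrow> (\<Sum>j\<le>N. P i j) = 1"
    and loop: "0 < P 0 0"
    and reach: "\<And>i. i \<le> N \<Longrightarrow> (i, 0) \<in> {(i, j). i \<le> N \<and> j \<le> N \<and> 0 < P i j}\<^sup>*"
begin

text \<open>The matrix acts on observables, not on distributions: conditional measures of preimages
  under the random map evolve in this direction.\<close>

definition step :: "(nat \<Rightarrow> real) \<Rightarrow> nat \<Rightarrow> real" where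
  "step v i = (\<Sum>j\<le>N. P i j * v j)"

lemma step_mono:
  "i \<le> N \<Longrightarrow> (\<And>j. j \<le> N \<Longrightarrow> v j \<le> w j) \<Longrightarrow> step v i \<le> step w i"
  unfolding step_def by (intro sum_mono mult_left_mono P_nonneg) auto

lemma step_const: "i \<le> N \<Longrightarrow> step (\<lambda>_. c) i = c"
  by (simp add: step_def P_sum flip: sum_distrib_right)

lemma step_affine: "i \<le> N \<Longrightarrow> step (\<lambda>j. a * v j + c) i = a * step v i + c"
  by (simp add: step_def algebra_simps sum.distrib P_sum flip: sum_distrib_left)

lemma step_sum: "step (\<lambda>j. \<Sum>l\<in>A. c l * f l j) i = (\<Sum>l\<in>A. c l * step (f l) i)"
proof -
  have "step (\<lambda>j. \<Sum>l\<in>A. c l * f l j) i = (\<Sum>j\<le>N. \<Sum>l\<in>A. c l * (P i j * f l j))"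
    by (simp add: step_def sum_distrib_left mult_ac)
  also have "\<dots> = (\<Sum>l\<in>A. \<Sum>j\<le>N. c l * (P i j * f l j))" by (rule sum.swap)
  finally show ?thesis by (simp add: step_def sum_distrib_left)
qed

lemma step_cong: "(\<And>j. j \<le> N \<Longrightarrow> v j = w j) \<Longrightarrow> step v i = step w i"
  by (simp add: step_def)

lemma iter_affine: "i \<le> N \<Longrightarrow> (step ^^ k) (\<lambda>j. a * v j + c) i = a * (step ^^ k) v i + c"
proof (induction k arbitrary: i)
  case (Suc k)
  have "(step ^^ Suc k) (\<lambda>j. a * v j + c) i = step (\<lambda>j. a * (step ^^ k) v j + c) i"
    unfolding funpow.simps comp_apply using Suc.IH by (intro step_cong) auto
  then show ?case using Suc.prems by (simp add: step_affine)
qed simp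

lemma iter_sum: "(step ^^ k) (\<lambda>j. \<Sum>l\<in>A. c l * f l j) i = (\<Sum>l\<in>A. c l * (step ^^ k) (f l) i)"
proof (induction k arbitrary: i)
  case (Suc k)
  then have "(step ^^ k) (\<lambda>j. \<Sum>l\<in>A. c l * f l j) = (\<lambda>i. \<Sum>l\<in>A. c l * (step ^^ k) (f l) i)" by blast
  then show ?case by (simp add: step_sum)
qed simp

lemma iter_bounds:
  "i \<le> N \<Longrightarrow> (\<And>j. j \<le> N \<Longrightarrow> a \<le> v j \<and> v j \<le> c) \<Longrightarrow> a \<le> (step ^^ k) v i \<and> (step ^^ k) v i \<le> c"
proof (induction k arbitrary: i)
  case (Suc k)
  show ?case using step_mono[of i "\<lambda>_. a" "(step ^^ k) v"] step_mono[of i "(step ^^ k) v" "\<lambda>_. c"] Suc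
    by (simp add: step_const)
qed simp

lemma step_ge_single:
  assumes "i \<le> N" "l \<le> N" "\<And>j. j \<le> N \<Longrightarrow> 0 \<le> v j"
  shows "P i l * v l \<le> step v i"
  unfolding step_def using assms by (intro member_le_sum) (auto intro!: mult_nonneg_nonneg P_nonneg)

lemma iter_pos:
  assumes "i \<le> N" "\<And>j. j \<le> N \<Longrightarrow> 0 \<le> v j"
  shows "0 \<le> (step ^^ k) v i"
  using assms
proof (induction k arbitrary: i)
  case (Suc k)
  show ?case using step_mono[of i "\<lambda>_. 0" "(step ^^ k) v"] Suc by (simp add: step_const)
qed simp

section \<open>Uniform positivity and contraction of the oscillation\<close>

lemma iter_loop:
  assumes "\<And>j. j \<le> N \<Longrightarrow> 0 \<le> v j"
  shows "P 0 0 ^ k * v 0 \<le> (step ^^ k) v 0"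
proof (induction k)
  case (Suc k)
  have "P 0 0 * (P 0 0 ^ k * v 0) \<le> P 0 0 * (step ^^ k) v 0"
    using Suc loop by (intro mult_left_mono) auto
  also have "\<dots> \<le> (step ^^ Suc k) v 0"
    using step_ge_single[of 0 0 "(step ^^ k) v"] iter_pos[OF _ assms] by simp
  finally show ?case by (simp add: mult_ac)
qed simp


text \<open>The length of a path from \<open>i\<close> to \<open>0\<close> serves as
  \<open>k\<close>, and the product of its edge weights as \<open>\<delta>\<close>; both still
  depend on \<open>i\<close>.\<close>

lemma reach_positive:
  assumes "i \<le> N"
  shows "\<exists>k. \<exists>\<delta>>0. \<forall>v. (\<forall>j\<le>N. 0 \<le> v j) \<longrightarrow> \<delta> * v 0 \<le> (step ^^ k) v i"
  using reach[OF assms]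
proof (induction rule: converse_rtrancl_induct)
  case base
  then show ?case by (intro exI[of _ 0] exI[of _ 1]) auto
next
  case (step i j)
  then obtain k \<delta> where k: "0 < \<delta>" "\<And>v. (\<forall>j\<le>N. 0 \<le> v j) \<Longrightarrow> \<delta> * v 0 \<le> (step ^^ k) v j" by auto
  have ij: "i \<le> N" "j \<le> N" "0 < P i j" using step by auto
  have "P i j * \<delta> * v 0 \<le> (step ^^ Suc k) v i" if v: "\<forall>j\<le>N. 0 \<le> v j" for v
  proof -
    have "P i j * (\<delta> * v 0) \<le> P i j * (step ^^ k) v j" using k(2)[OF v] ij by (intro mult_left_mono) auto
    also have "\<dots> \<le> (step ^^ Suc k) v i"
      using step_ge_single[of i j "(step ^^ k) v"] ij iter_pos[of _ v k] v by simp
    finally show ?thesis by (simp add: mult_ac)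
  qed
  then show ?case using ij k by (intro exI[of _ "Suc k"] exI[of _ "P i j * \<delta>"]) auto
qed

text \<open>The loop at \<open>0\<close> makes the number of steps uniform in the starting state.\<close>

lemma doeblin:
  "\<exists>k. \<exists>\<delta>>0. \<forall>v. (\<forall>j\<le>N. 0 \<le> v j) \<longrightarrow> (\<forall>i\<le>N. \<delta> * v 0 \<le> (step ^^ k) v i)"
proof -
  obtain k \<delta> where k: "\<And>i. i \<le> N \<Longrightarrow> 0 < \<delta> i"
    "\<And>i v. i \<le> N \<Longrightarrow> (\<forall>j\<le>N. 0 \<le> v j) \<Longrightarrow> \<delta> i * v 0 \<le> (step ^^ k i) v i"
    using reach_positive by metis
  define m where "m = Max (k ` {..N})"
  \<comment> \<open>Each path to \<open>0\<close> is prolonged to the common length \<open>m\<close>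
    by turning round the loop, at the cost of one factor \<open>P 0 0\<close> per extra
    step.\<close>
  define d where "d = Min ((\<lambda>i. \<delta> i * P 0 0 ^ (m - k i)) ` {..N})"
  have "0 < d" unfolding d_def using k loop by (subst Min_gr_iff) auto
  moreover have "d * v 0 \<le> (step ^^ m) v i" if v: "\<forall>j\<le>N. 0 \<le> v j" and i: "i \<le> N" for v i
  proof -
    have "k i \<le> m" using i by (auto simp: m_def)
    then have m: "(step ^^ m) v = (step ^^ k i) ((step ^^ (m - k i)) v)"
      by (metis comp_apply funpow_add le_add_diff_inverse)
    have "d \<le> \<delta> i * P 0 0 ^ (m - k i)" using i by (auto simp: d_def)
    then have "d * v 0 \<le> \<delta> i * P 0 0 ^ (m - k i) * v 0" using v by (intro mult_right_mono) auto
    also have "\<dots> \<le> \<delta> i * (step ^^ (m - k i)) v 0"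
      using iter_loop[of v "m - k i"] v k(1)[OF i] by (simp add: mult_ac)
    also have "\<dots> \<le> (step ^^ m) v i"
      unfolding m using k(2)[OF i] iter_pos[of _ v] v by blast
    finally show ?thesis .
  qed
  ultimately show ?thesis by blast
qed

text \<open>The lower bound of \<open>doeblin\<close>, applied to \<open>v - a\<close> and to
  \<open>a + d - v\<close>, moves both ends of the range towards \<open>v 0\<close>. The two gains
  add up to \<open>\<delta> * d\<close> whatever the value of \<open>v 0\<close> is.\<close>

lemma contraction:
  "\<exists>k. \<exists>\<theta>\<ge>0. \<theta> < 1 \<and> (\<forall>v a d. (\<forall>j\<le>N. a \<le> v j \<and> v j \<le> a + d) \<longrightarrow>
     (\<exists>a'. \<forall>j\<le>N. a' \<le> (step ^^ k) v j \<and> (step ^^ k) v j \<le> a' + \<theta> * d))"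
proof -
  obtain k \<delta> where \<delta>: "0 < \<delta>"
    and k: "\<And>v i. (\<forall>j\<le>N. 0 \<le> v j) \<Longrightarrow> i \<le> N \<Longrightarrow> \<delta> * v 0 \<le> (step ^^ k) v i"
    using doeblin by metis
  have one: "(step ^^ k) (\<lambda>_. 1) i = 1" if "i \<le> N" for i
    using iter_bounds[OF that, of 1 "\<lambda>_. 1" 1 k] by auto
  have "\<delta> \<le> 1" using k[of "\<lambda>_. 1" 0] one[of 0] by simp
  moreover have "\<exists>a'. \<forall>j\<le>N. a' \<le> (step ^^ k) v j \<and> (step ^^ k) v j \<le> a' + (1 - \<delta>) * d"
    if v: "\<forall>j\<le>N. a \<le> v j \<and> v j \<le> a + d" for v a d
  proof (intro exI[of _ "a + \<delta> * (v 0 - a)"] allI impI)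
    fix j assume j: "j \<le> N"
    have "\<delta> * (1 * v 0 + (- a)) \<le> (step ^^ k) (\<lambda>j. 1 * v j + (- a)) j"
      using v j by (intro k) auto
    then have 1: "\<delta> * (v 0 - a) \<le> (step ^^ k) v j - a"
      by (subst (asm) iter_affine[OF j]) simp
    have "\<delta> * ((-1) * v 0 + (a + d)) \<le> (step ^^ k) (\<lambda>j. (-1) * v j + (a + d)) j"
      using v j by (intro k) auto
    then have 2: "\<delta> * (a + d - v 0) \<le> a + d - (step ^^ k) v j"
      by (subst (asm) iter_affine[OF j]) simp
    show "a + \<delta> * (v 0 - a) \<le> (step ^^ k) v j \<and>
      (step ^^ k) v j \<le> a + \<delta> * (v 0 - a) + (1 - \<delta>) * d"
      using 1 2 by (simp add: algebra_simps)
  qed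
  ultimately show ?thesis using \<delta> by (intro exI[of _ k] exI[of _ "1 - \<delta>"]) auto
qed

text \<open>Repeated contraction shrinks the range to \<open>\<theta> ^ q\<close>, and further steps
  are averages, which cannot widen it. One \<open>k0\<close> serves all \<open>v\<close>; this later
  becomes uniformity over all measurable sets.\<close>

lemma oscillation:
  assumes "0 < \<epsilon>"
  shows "\<exists>k0. \<forall>k\<ge>k0. \<forall>v. (\<forall>j\<le>N. 0 \<le> v j \<and> v j \<le> 1) \<longrightarrow>
    (\<exists>a. \<forall>j\<le>N. a \<le> (step ^^ k) v j \<and> (step ^^ k) v j \<le> a + \<epsilon>)"
proof -
  obtain k \<theta> where \<theta>: "0 \<le> \<theta>" "\<theta> < 1"
    and k: "\<And>v a d. (\<forall>j\<le>N. a \<le> v j \<and> v j \<le> a + d) \<Longrightarrow>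
     (\<exists>a'. \<forall>j\<le>N. a' \<le> (step ^^ k) v j \<and> (step ^^ k) v j \<le> a' + \<theta> * d)"
    using contraction by metis
  have it: "\<exists>a. \<forall>j\<le>N. a \<le> (step ^^ (k * q)) v j \<and> (step ^^ (k * q)) v j \<le> a + \<theta> ^ q"
    if v: "\<forall>j\<le>N. 0 \<le> v j \<and> v j \<le> 1" for v q
  proof (induction q)
    case 0
    then show ?case using v by (intro exI[of _ 0]) auto
  next
    case (Suc q)
    have "step ^^ (k * Suc q) = (step ^^ k) \<circ> (step ^^ (k * q))" by (simp add: funpow_add)
    then show ?case using Suc k by fastforce
  qed
  obtain q where q: "\<theta> ^ q < \<epsilon>" using real_arch_pow_inv assms \<theta> by blast
  show ?thesis
  proof (intro exI[of _ "k * q"] allI impI)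
    fix l v assume l: "k * q \<le> l" and v: "\<forall>j\<le>N. 0 \<le> v j \<and> v j \<le> (1::real)"
    obtain a where a: "\<forall>j\<le>N. a \<le> (step ^^ (k * q)) v j \<and> (step ^^ (k * q)) v j \<le> a + \<theta> ^ q"
      using it[OF v] by blast
    have "(step ^^ l) v = (step ^^ (l - k * q)) ((step ^^ (k * q)) v)"
      using l by (metis comp_apply funpow_add le_add_diff_inverse2)
    then have "\<forall>j\<le>N. a \<le> (step ^^ l) v j \<and> (step ^^ l) v j \<le> a + \<theta> ^ q"
      using iter_bounds[of _ a "(step ^^ (k * q)) v" "a + \<theta> ^ q"] a by auto
    then show "\<exists>a. \<forall>j\<le>N. a \<le> (step ^^ l) v j \<and> (step ^^ l) v j \<le> a + \<epsilon>"
      using q by (intro exI[of _ a]) force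
  qed
qed

section \<open>Stationary vectors: convergence, existence, uniqueness\<close>

definition stationary :: "(nat \<Rightarrow> real) \<Rightarrow> bool" where
  "stationary \<pi> \<longleftrightarrow> (\<forall>j\<le>N. 0 \<le> \<pi> j) \<and> (\<Sum>j\<le>N. \<pi> j) = 1 \<and> (\<forall>j\<le>N. \<pi> j = (\<Sum>i\<le>N. \<pi> i * P i j))"

lemma stationary_iter:
  assumes "stationary \<pi>"
  shows "(\<Sum>i\<le>N. \<pi> i * (step ^^ k) v i) = (\<Sum>i\<le>N. \<pi> i * v i)"
proof (induction k)
  case (Suc k)
  have "(\<Sum>i\<le>N. \<pi> i * step w i) = (\<Sum>i\<le>N. \<pi> i * w i)" for w
  proof -
    have "(\<Sum>i\<le>N. \<pi> i * step w i) = (\<Sum>i\<le>N. \<Sum>j\<le>N. \<pi> i * P i j * w j)"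
      by (simp add: step_def sum_distrib_left mult_ac)
    also have "\<dots> = (\<Sum>j\<le>N. (\<Sum>i\<le>N. \<pi> i * P i j) * w j)"
      by (subst sum.swap) (simp add: sum_distrib_right)
    also have "\<dots> = (\<Sum>j\<le>N. \<pi> j * w j)"
      using assms by (intro sum.cong) (auto simp: stationary_def)
    finally show ?thesis .
  qed
  then show ?case using Suc by simp
qed simp

text \<open>The \<open>\<pi>\<close>-average of \<open>step ^^ k\<close> applied to \<open>v\<close>
  is the \<open>\<pi>\<close>-average of \<open>v\<close>, so this number lies in the narrow range
  provided by \<open>oscillation\<close>.\<close>

lemma stationary_converges:
  assumes "stationary \<pi>" "0 < \<epsilon>"
  shows "\<exists>k0. \<forall>k\<ge>k0. \<forall>v. (\<forall>j\<le>N. 0 \<le> v j \<and> v j \<le> 1) \<longrightarrow>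
    (\<forall>i\<le>N. \<bar>(step ^^ k) v i - (\<Sum>j\<le>N. \<pi> j * v j)\<bar> \<le> \<epsilon>)"
proof -
  obtain k0 where k0: "\<And>k v. k0 \<le> k \<Longrightarrow> (\<forall>j\<le>N. 0 \<le> v j \<and> v j \<le> 1) \<Longrightarrow>
    (\<exists>a. \<forall>j\<le>N. a \<le> (step ^^ k) v j \<and> (step ^^ k) v j \<le> a + \<epsilon>)"
    using oscillation[OF assms(2)] by metis
  show ?thesis
  proof (intro exI[of _ k0] allI impI)
    fix k v i assume k: "k0 \<le> k" and v: "\<forall>j\<le>N. 0 \<le> v j \<and> v j \<le> (1::real)" and i: "i \<le> N"
    obtain a where a: "\<And>j. j \<le> N \<Longrightarrow> a \<le> (step ^^ k) v j \<and> (step ^^ k) v j \<le> a + \<epsilon>"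
      using k0[OF k v] by blast
    have \<pi>: "\<And>j. j \<le> N \<Longrightarrow> 0 \<le> \<pi> j" "(\<Sum>j\<le>N. \<pi> j) = 1" using assms by (auto simp: stationary_def)
    have "a = (\<Sum>j\<le>N. \<pi> j * a)" by (simp add: \<pi> flip: sum_distrib_right)
    also have "\<dots> \<le> (\<Sum>j\<le>N. \<pi> j * (step ^^ k) v j)" using a \<pi> by (intro sum_mono mult_left_mono) auto
    finally have 1: "a \<le> (\<Sum>j\<le>N. \<pi> j * v j)" by (simp add: stationary_iter[OF assms(1)])
    have "(\<Sum>j\<le>N. \<pi> j * (step ^^ k) v j) \<le> (\<Sum>j\<le>N. \<pi> j * (a + \<epsilon>))"
      using a \<pi> by (intro sum_mono mult_left_mono) auto
    also have "\<dots> = a + \<epsilon>" by (simp add: \<pi> flip: sum_distrib_right)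
    finally have 2: "(\<Sum>j\<le>N. \<pi> j * v j) \<le> a + \<epsilon>" by (simp add: stationary_iter[OF assms(1)])
    show "\<bar>(step ^^ k) v i - (\<Sum>j\<le>N. \<pi> j * v j)\<bar> \<le> \<epsilon>" using 1 2 a[OF i] by linarith
  qed
qed

abbreviation unit_vec :: "nat \<Rightarrow> nat \<Rightarrow> real" where
  "unit_vec l j \<equiv> of_bool (j = l)"

lemma unit_vec_expand: "j \<le> N \<Longrightarrow> (\<Sum>l\<le>N. v l * unit_vec l j) = v j"
  by (simp add: of_bool_def if_distrib[of "(*) _"] cong: if_cong)

text \<open>The limit of the rows of the powers of \<open>P\<close> is stationary. A column of a
  later power consists of averages of the same column of an earlier power, so it stays in a range
  that shrinks and its entries are Cauchy.\<close>

lemma stationary_exists: "\<exists>\<pi>. stationary \<pi>"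
proof -
  \<comment> \<open>\<open>f l k\<close> is the entry in row \<open>0\<close> and column
    \<open>l\<close> of the \<open>k\<close>-th power of \<open>P\<close>.\<close>
  define f where "f l k = (step ^^ k) (unit_vec l) 0" for l k
  have u: "\<forall>j\<le>N. 0 \<le> unit_vec l j \<and> unit_vec l j \<le> 1" for l by simp
  have shift: "\<exists>k0. \<forall>k\<ge>k0. \<forall>m\<ge>k. \<forall>i\<le>N. \<bar>(step ^^ m) (unit_vec l) i - f l k\<bar> \<le> \<epsilon>" if "0 < \<epsilon>" for \<epsilon> l
  proof -
    obtain k0 where k0: "\<And>k. k0 \<le> k \<Longrightarrow> \<exists>a. \<forall>j\<le>N. a \<le> (step ^^ k) (unit_vec l) j \<and> (step ^^ k) (unit_vec l) j \<le> a + \<epsilon>"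
      using oscillation[OF \<open>0 < \<epsilon>\<close>] u by meson
    show ?thesis
    proof (intro exI[of _ k0] allI impI)
      fix k m i assume k: "k0 \<le> k" "k \<le> m" "i \<le> N"
      obtain a where a: "\<And>j. j \<le> N \<Longrightarrow> a \<le> (step ^^ k) (unit_vec l) j \<and> (step ^^ k) (unit_vec l) j \<le> a + \<epsilon>"
        using k0 k by blast
      have "(step ^^ m) (unit_vec l) = (step ^^ (m - k)) ((step ^^ k) (unit_vec l))"
        using k by (metis comp_apply funpow_add le_add_diff_inverse2)
      then have "a \<le> (step ^^ m) (unit_vec l) i \<and> (step ^^ m) (unit_vec l) i \<le> a + \<epsilon>"
        using iter_bounds[OF k(3) a] by simp
      then show "\<bar>(step ^^ m) (unit_vec l) i - f l k\<bar> \<le> \<epsilon>" using a[of 0] by (auto simp: f_def)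
    qed
  qed
  have "Cauchy (f l)" for l
  proof (rule CauchyI)
    fix e :: real assume "0 < e"
    then obtain k0 where k0: "\<And>k m i. k0 \<le> k \<Longrightarrow> k \<le> m \<Longrightarrow> i \<le> N \<Longrightarrow> \<bar>(step ^^ m) (unit_vec l) i - f l k\<bar> \<le> e / 2"
      using shift[of "e / 2" l] by auto
    show "\<exists>M. \<forall>m\<ge>M. \<forall>n\<ge>M. norm (f l m - f l n) < e"
    proof (intro exI[of _ k0] allI impI)
      fix m n assume mn: "k0 \<le> m" "k0 \<le> n"
      consider "m \<le> n" | "n \<le> m" by linarith
      then have "\<bar>f l m - f l n\<bar> \<le> e / 2"
        using k0[of m n 0] k0[of n m 0] mn unfolding f_def by cases (auto simp: abs_minus_commute)
      then show "norm (f l m - f l n) < e" using \<open>0 < e\<close> by simp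
    qed
  qed
  then have "\<forall>l. \<exists>x. f l \<longlonglongrightarrow> x" by (simp add: Cauchy_convergent_iff flip: convergent_def)
  then have "\<exists>\<pi>. \<forall>l. f l \<longlonglongrightarrow> \<pi> l" by (rule choice)
  then obtain \<pi> where f_lim: "\<And>l. f l \<longlonglongrightarrow> \<pi> l" by blast
  have nonneg: "0 \<le> \<pi> l" for l
    using LIMSEQ_le_const[OF f_lim] iter_pos[of 0 "unit_vec l"] by (fastforce simp: f_def)
  have "(\<Sum>l\<le>N. f l k) = 1" for k
  proof -
    have "(\<Sum>l\<le>N. f l k) = (step ^^ k) (\<lambda>j. \<Sum>l\<le>N. 1 * unit_vec l j) 0"
      unfolding f_def iter_sum by simp
    also have "\<dots> = 1"
      using iter_bounds[of 0 1 "\<lambda>j. \<Sum>l\<le>N. 1 * unit_vec l j" 1 k] unit_vec_expand[of _ "\<lambda>_. 1"] by force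
    finally show ?thesis .
  qed
  moreover have "(\<lambda>k. \<Sum>l\<le>N. f l k) \<longlonglongrightarrow> (\<Sum>l\<le>N. \<pi> l)" by (intro tendsto_sum f_lim)
  ultimately have sum1: "(\<Sum>l\<le>N. \<pi> l) = 1" by (simp add: LIMSEQ_const_iff)
  have "\<pi> l = (\<Sum>j\<le>N. \<pi> j * P j l)" if l: "l \<le> N" for l
  proof -
    have col: "step (unit_vec l) i = P i l" for i
      using l by (simp add: step_def of_bool_def if_distrib[of "(*) _"] cong: if_cong)
    \<comment> \<open>The extra step is split off at the end of the path, not at its start, so that
      the limit is an equation for a left eigenvector.\<close>
    have expand: "f l (Suc k) = (\<Sum>j\<le>N. P j l * f j k)" for k
    proof -
      have "f l (Suc k) = (step ^^ k) (step (unit_vec l)) 0" by (simp add: f_def funpow_swap1)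
      also have "\<dots> = (step ^^ k) (\<lambda>i. \<Sum>j\<le>N. P j l * unit_vec j i) 0"
      proof -
        have ext: "(step ^^ k) v i = (step ^^ k) w i" if "\<And>j. j \<le> N \<Longrightarrow> v j = w j" "i \<le> N" for v w k i
          using that by (induction k arbitrary: i) (auto intro: step_cong)
        show ?thesis by (rule ext) (simp_all add: col unit_vec_expand[of _ "\<lambda>j. P j l"])
      qed
      also have "\<dots> = (\<Sum>j\<le>N. P j l * (step ^^ k) (unit_vec j) 0)" by (rule iter_sum)
      finally show ?thesis unfolding f_def .
    qed
    have "(\<lambda>k. f l (Suc k)) \<longlonglongrightarrow> (\<Sum>j\<le>N. P j l * \<pi> j)"
      unfolding expand by (intro tendsto_intros f_lim)
    moreover have "(\<lambda>k. f l (Suc k)) \<longlonglongrightarrow> \<pi> l" using f_lim[of l] by (rule LIMSEQ_Suc)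
    ultimately have "\<pi> l = (\<Sum>j\<le>N. P j l * \<pi> j)" by (rule LIMSEQ_unique[rotated])
    then show ?thesis by (simp add: mult.commute)
  qed
  then show ?thesis using nonneg sum1 unfolding stationary_def by blast
qed

text \<open>Tested on a unit vector, both candidates approximate the same entry of a high power of
  \<open>P\<close>.\<close>

lemma stationary_unique:
  assumes "stationary \<pi>" "stationary \<rho>" "l \<le> N"
  shows "\<pi> l = \<rho> l"
proof (rule ccontr)
  assume "\<pi> l \<noteq> \<rho> l"
  define \<epsilon> where "\<epsilon> = \<bar>\<pi> l - \<rho> l\<bar> / 3"
  have \<epsilon>: "0 < \<epsilon>" using \<open>\<pi> l \<noteq> \<rho> l\<close> by (simp add: \<epsilon>_def)
  have s: "(\<Sum>j\<le>N. \<pi> j * unit_vec l j) = \<pi> l" for \<pi>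
    using assms(3) by (simp add: of_bool_def if_distrib[of "(*) _"] cong: if_cong)
  have u: "\<forall>j\<le>N. 0 \<le> unit_vec l j \<and> unit_vec l j \<le> 1" by simp
  obtain k where k: "\<And>m v i. k \<le> m \<Longrightarrow> (\<forall>j\<le>N. 0 \<le> v j \<and> v j \<le> 1) \<Longrightarrow> i \<le> N \<Longrightarrow>
      \<bar>(step ^^ m) v i - (\<Sum>j\<le>N. \<pi> j * v j)\<bar> \<le> \<epsilon>"
    using stationary_converges[OF assms(1) \<epsilon>] by blast
  obtain k' where k': "\<And>m v i. k' \<le> m \<Longrightarrow> (\<forall>j\<le>N. 0 \<le> v j \<and> v j \<le> 1) \<Longrightarrow> i \<le> N \<Longrightarrow>
      \<bar>(step ^^ m) v i - (\<Sum>j\<le>N. \<rho> j * v j)\<bar> \<le> \<epsilon>"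
    using stationary_converges[OF assms(2) \<epsilon>] by blast
  have "\<bar>(step ^^ max k k') (unit_vec l) 0 - \<pi> l\<bar> \<le> \<epsilon>"
    "\<bar>(step ^^ max k k') (unit_vec l) 0 - \<rho> l\<bar> \<le> \<epsilon>"
    using k[OF _ u, of "max k k'" 0] k'[OF _ u, of "max k k'" 0] unfolding s by auto
  then have "\<bar>\<pi> l - \<rho> l\<bar> \<le> 2 * \<epsilon>" by linarith
  then show False using \<epsilon> by (simp add: \<epsilon>_def)
qed

text \<open>The maximum of \<open>f\<close> propagates along the edges until it meets \<open>A\<close>.\<close>

lemma subharmonic_zero:
  assumes A: "\<And>i. i \<le> N \<Longrightarrow> \<exists>a\<in>A. (i, a) \<in> {(i, j). i \<le> N \<and> j \<le> N \<and> 0 < P i j}\<^sup>*"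
    and zero: "\<And>a. a \<in> A \<Longrightarrow> a \<le> N \<Longrightarrow> f a = 0"
    and nonneg: "\<And>i. i \<le> N \<Longrightarrow> 0 \<le> f i"
    and sub: "\<And>i. i \<le> N \<Longrightarrow> i \<notin> A \<Longrightarrow> f i \<le> (\<Sum>j\<le>N. P i j * f j)"
    and i: "i \<le> N"
  shows "f i = 0"
proof -
  define m where "m = Max (f ` {..N})"
  have le: "f j \<le> m" if "j \<le> N" for j using that by (simp add: m_def)
  have "m \<in> f ` {..N}" unfolding m_def by (intro Max_in) auto
  then obtain i0 where i0: "i0 \<le> N" "f i0 = m" by auto
  obtain a where a: "a \<in> A" "(i0, a) \<in> {(i, j). i \<le> N \<and> j \<le> N \<and> 0 < P i j}\<^sup>*" using A i0 by blast
  have "m = 0"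
    using a(2,1) i0
  proof (induction rule: converse_rtrancl_induct)
    case base
    then show ?case using zero by simp
  next
    case (step i j)
    show ?case
    proof (cases "i \<in> A")
      case True
      then show ?thesis using step zero by auto
    next
      case False
      have ij: "i \<le> N" "j \<le> N" "0 < P i j" using step by auto
      have "(\<Sum>l\<le>N. P i l * (m - f l)) = m - (\<Sum>l\<le>N. P i l * f l)"
        using ij P_sum by (simp add: right_diff_distrib sum_subtractf flip: sum_distrib_right)
      also have "\<dots> \<le> 0" using sub[OF ij(1) False] step by simp
      finally have "(\<Sum>l\<le>N. P i l * (m - f l)) \<le> 0" .
      moreover have "P i j * (m - f j) \<le> (\<Sum>l\<le>N. P i l * (m - f l))"
        using ij le by (intro member_le_sum) (auto intro!: mult_nonneg_nonneg P_nonneg)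
      ultimately have "P i j * (m - f j) \<le> 0" by linarith
      then have "f j = m" using ij le[of j] by (simp add: mult_le_0_iff)
      then show ?thesis using step ij by auto
    qed
  qed
  then show ?thesis using le[OF i] nonneg[OF i] by simp
qed

end

section \<open>Regions and digits\<close>

text \<open>The inequality \<open>overlap\<close> is equivalent to \<open>\<beta> * r < 1\<close>.
  The locale collects what regions, digits and maps need; the expansion of \<open>1\<close> enters
  again only with the cuts.\<close>

locale small_overlap =
  fixes \<beta> :: real
  assumes beta_gt1: "1 < \<beta>"
    and beta_nonint: "\<beta> \<notin> \<int>"
    and overlap: "b1 \<beta> * \<beta> + 1 < \<beta>\<^sup>2"
begin

abbreviation "D \<equiv> b1 \<beta>"
text \<open>The right end of \<open>J\<close> and the fixed point of the last branch
  \<open>\<beta> * x - D\<close>. A switch region has length \<open>r / \<beta>\<close>, and its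
  greedy and lazy images are \<open>{0..r}\<close> and \<open>{1..\<tau>}\<close>.\<close>

definition "\<tau> = D / (\<beta> - 1)"
abbreviation "r \<equiv> \<tau> - 1"
abbreviation "J \<equiv> J_beta \<beta>"
abbreviation "E \<equiv> equality_region \<beta>"
abbreviation "S \<equiv> switch_region \<beta>"
abbreviation "T \<equiv> greedy_map \<beta>"
abbreviation "L \<equiv> lazy_map \<beta>"
abbreviation "K \<equiv> K_beta \<beta>"

lemma D_less: "real D < \<beta>" and D_gt: "\<beta> < real D + 1" and D_pos: "0 < D"
proof -
  have fl: "real D = of_int \<lfloor>\<beta>\<rfloor>" using beta_gt1 by (simp add: b1_def)
  have "of_int \<lfloor>\<beta>\<rfloor> \<noteq> \<beta>" using beta_nonint by (metis Ints_of_int)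
  then show "real D < \<beta>" using fl by linarith
  show "\<beta> < real D + 1" using fl by linarith
  then show "0 < D" using beta_gt1 by (cases D) auto
qed

lemma beta_pos: "0 < \<beta>" using beta_gt1 by simp

lemma beta_tau: "\<beta> * \<tau> = \<tau> + D"
  using beta_gt1 by (simp add: \<tau>_def field_simps)

lemma r_pos: "0 < r"
  using beta_gt1 D_gt by (simp add: \<tau>_def field_simps)

lemma beta_r: "\<beta> * r < 1"
proof -
  have "real D < (\<beta> - 1) * (1 + \<beta> - real D)"
    using overlap by (simp add: algebra_simps power2_eq_square)
  then have "\<tau> < 1 + \<beta> - real D"
    using beta_gt1 by (simp add: \<tau>_def field_simps)
  then show ?thesis using beta_tau by (simp add: algebra_simps)
qed

lemma r_less1: "r < 1"
  using beta_r r_pos beta_gt1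
  by (smt (verit) mult_le_cancel_right1)

lemma J_eq: "J = {0..\<tau>}" by (simp add: J_beta_def \<tau>_def)

lemma tau_gt1: "1 < \<tau>" using r_pos by simp

lemma beta_le_tau: "x \<le> \<tau> \<longleftrightarrow> \<beta> * x \<le> \<tau> + D"
  using beta_tau beta_pos by (metis mult_le_cancel_left_pos)

section \<open>Regions in the scaled coordinate \<beta> x\<close>

lemma switch_end: "D / (\<beta> * (\<beta> - 1)) + (real k - 1) / \<beta> = (r + k) / \<beta>"
  using beta_gt1 by (simp add: \<tau>_def divide_simps) (simp add: algebra_simps)

lemma mem_S: "x \<in> S k \<longleftrightarrow> k \<le> \<beta> * x \<and> \<beta> * x \<le> r + k"
  unfolding switch_region_def switch_end using beta_pos
  by (auto simp: field_simps)

text \<open>The bounds \<open>0 \<le> x\<close> and \<open>x \<le> \<tau>\<close> cut only the two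
  extreme regions; the others satisfy them anyway, which allows one formula for all
  \<open>k\<close>.\<close>

lemma mem_E:
  assumes "k \<le> D"
  shows "x \<in> E k \<longleftrightarrow>
    0 \<le> x \<and> x \<le> \<tau> \<and> (0 < k \<longrightarrow> r + k < \<beta> * x) \<and> (k < D \<longrightarrow> \<beta> * x < k + 1)"
proof -
  have pos: "0 \<le> x" if "r + k < \<beta> * x"
    using that r_pos beta_pos by (smt (verit) of_nat_0_le_iff mult_nonneg_nonpos)
  have up: "x \<le> \<tau>" if "k < D" "\<beta> * x < k + 1"
    using that tau_gt1 unfolding beta_le_tau by linarith
  have e: "(real D / (\<beta> * (\<beta> - 1)) + (real D - 1) / \<beta>) = (r + D) / \<beta>"
    using switch_end by simp
  consider "k = 0" | "0 < k" "k < D" | "0 < k" "k = D" using assms by linarith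
  then show ?thesis
  proof cases
    case 1
    then show ?thesis using D_pos up beta_pos by (auto simp: equality_region_def field_simps)
  next
    case 2
    then show ?thesis unfolding equality_region_def switch_end using pos up beta_pos
      by (auto simp: field_simps)
  next
    case 3
    then show ?thesis unfolding equality_region_def e \<tau>_def[symmetric]
      using pos beta_pos by (auto simp: field_simps)
  qed
qed

lemma S_sub_J: "1 \<le> k \<Longrightarrow> k \<le> D \<Longrightarrow> S k \<subseteq> J"
proof
  fix x assume k: "1 \<le> k" "k \<le> D" and "x \<in> S k"
  then have x: "k \<le> \<beta> * x" "\<beta> * x \<le> r + k" by (auto simp: mem_S)
  then have "0 < \<beta> * x" using k by linarith
  then have "0 \<le> x" using beta_pos by (simp add: zero_less_mult_iff)
  moreover have "x \<le> \<tau>" unfolding beta_le_tau using x k by linarith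
  ultimately show "x \<in> J" by (simp add: J_eq)
qed

lemma E_sub_J: "k \<le> D \<Longrightarrow> E k \<subseteq> J"
  by (auto simp: mem_E J_eq)

definition Eq :: "real set" where "Eq = (\<Union>k\<in>{..D}. E k)"

text \<open>Take the greedy digit \<open>k\<close> of \<open>x\<close>: the point lies in
  \<open>S k\<close> if \<open>0 < k\<close> and \<open>\<beta> * x\<close> exceeds \<open>k\<close>
  by at most \<open>r\<close>, and in \<open>E k\<close> otherwise.\<close>

lemma J_cases:
  assumes "x \<in> J"
  obtains k where "k \<le> D" "x \<in> E k" | k where "1 \<le> k" "k \<le> D" "x \<in> S k"
proof -
  define k where "k = min (nat \<lfloor>\<beta> * x\<rfloor>) D"
  have x: "0 \<le> x" "x \<le> \<tau>" using assms by (auto simp: J_eq)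
  have bx: "0 \<le> \<beta> * x" using x beta_pos by simp
  have k: "k \<le> D" "k \<le> \<beta> * x" "k < D \<Longrightarrow> \<beta> * x < k + 1"
    unfolding k_def using bx by (auto simp: min_def) linarith+
  show thesis
  proof (cases "0 < k \<and> \<beta> * x \<le> r + k")
    case True
    then show ?thesis using k that(2)[of k] by (simp add: mem_S)
  next
    case False
    then show ?thesis using k x that(1)[of k] by (auto simp: mem_E)
  qed
qed

lemma EE_unique:
  assumes "x \<in> E k" "x \<in> E l" "k \<le> D" "l \<le> D"
  shows "k = l"
proof -
  have aux: False if "x \<in> E k" "x \<in> E l" "k < l" "l \<le> D" for k l
  proof -
    have "\<beta> * x < k + 1" "r + l < \<beta> * x" using that by (auto simp: mem_E)
    moreover have "real k + 1 \<le> l" using that by linarith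
    ultimately show False using r_pos by linarith
  qed
  show ?thesis using aux[of k l] aux[of l k] assms by (metis linorder_neqE_nat)
qed

lemma SS_unique:
  assumes "x \<in> S k" "x \<in> S l"
  shows "k = l"
proof -
  have aux: False if "x \<in> S k" "x \<in> S l" "k < l" for k l
  proof -
    have "\<beta> * x \<le> r + k" "l \<le> \<beta> * x" using that by (auto simp: mem_S)
    moreover have "real k + 1 \<le> l" using that by linarith
    ultimately show False using r_less1 by linarith
  qed
  show ?thesis using aux[of k l] aux[of l k] assms by (metis linorder_neqE_nat)
qed

lemma ES_disjoint:
  assumes "x \<in> E k" "k \<le> D" "x \<in> S l" "1 \<le> l" "l \<le> D"
  shows False
proof -
  have l: "l \<le> \<beta> * x" "\<beta> * x \<le> r + l" using assms by (auto simp: mem_S)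
  consider "k < l" | "l \<le> k" by linarith
  then show ?thesis
  proof cases
    case 1
    then have "\<beta> * x < k + 1" "real k + 1 \<le> l" using assms by (auto simp: mem_E)
    then show ?thesis using l by linarith
  next
    case 2
    then have "r + k < \<beta> * x" "real l \<le> k" using assms by (auto simp: mem_E)
    then show ?thesis using l by linarith
  qed
qed

lemma S_not_Eq: "x \<in> S k \<Longrightarrow> 1 \<le> k \<Longrightarrow> k \<le> D \<Longrightarrow> x \<notin> Eq"
  using ES_disjoint by (auto simp: Eq_def)

lemma Eq_sub_J: "Eq \<subseteq> J" using E_sub_J by (auto simp: Eq_def)

section \<open>Greedy and lazy digits, and the branches of the maps\<close>

lemma mem_greedy_cyl:
  assumes "d \<le> D" "x \<in> J"
  shows "x \<in> greedy_cyl \<beta> d \<longleftrightarrow> d \<le> \<beta> * x \<and> (d < D \<longrightarrow> \<beta> * x < d + 1)"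
  using assms beta_pos unfolding greedy_cyl_def \<tau>_def[symmetric]
  by (auto simp: J_eq field_simps)

lemma greedy_digit_eqI:
  assumes "x \<in> J" "d \<le> D" "d \<le> \<beta> * x" "d < D \<Longrightarrow> \<beta> * x < d + 1"
  shows "greedy_digit \<beta> x = d"
  unfolding greedy_digit_def
proof (rule the_equality)
  show "d \<le> D \<and> x \<in> greedy_cyl \<beta> d" using assms by (simp add: mem_greedy_cyl)
  fix l assume "l \<le> D \<and> x \<in> greedy_cyl \<beta> l"
  then have "l \<le> D" "l \<le> \<beta> * x" "l < D \<Longrightarrow> \<beta> * x < l + 1"
    using assms by (auto simp: mem_greedy_cyl)
  then have "\<not> l < d" "\<not> d < l" using assms by auto
  then show "l = d" by simp
qed

lemma mem_lazy_cyl: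
  assumes "d \<le> D" "x \<in> J"
  shows "x \<in> reflect \<beta> ` greedy_cyl \<beta> (D - d) \<longleftrightarrow>
    \<beta> * x \<le> r + d + 1 \<and> (0 < d \<longrightarrow> r + d < \<beta> * x)"
proof -
  have refl: "reflect \<beta> y = \<tau> - y" for y by (simp add: reflect_def \<tau>_def)
  have "x \<in> reflect \<beta> ` greedy_cyl \<beta> (D - d) \<longleftrightarrow> \<tau> - x \<in> greedy_cyl \<beta> (D - d)"
    by (auto simp: refl image_iff) (metis diff_diff_eq2 add_diff_cancel_left')
  also have "\<dots> \<longleftrightarrow> real (D - d) \<le> \<beta> * (\<tau> - x) \<and> (D - d < D \<longrightarrow> \<beta> * (\<tau> - x) < real (D - d) + 1)"
    using assms by (subst mem_greedy_cyl) (auto simp: J_eq)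
  also have "\<dots> \<longleftrightarrow> \<beta> * x \<le> r + d + 1 \<and> (0 < d \<longrightarrow> r + d < \<beta> * x)"
    using assms D_pos by (auto simp: of_nat_diff right_diff_distrib beta_tau)
  finally show ?thesis .
qed

lemma lazy_digit_eqI:
  assumes "x \<in> J" "d \<le> D" "\<beta> * x \<le> r + d + 1" "0 < d \<Longrightarrow> r + d < \<beta> * x"
  shows "lazy_digit \<beta> x = d"
  unfolding lazy_digit_def
proof (rule the_equality)
  show "d \<le> D \<and> x \<in> reflect \<beta> ` greedy_cyl \<beta> (D - d)" using assms by (simp add: mem_lazy_cyl)
  fix l assume "l \<le> D \<and> x \<in> reflect \<beta> ` greedy_cyl \<beta> (D - l)"
  then have "l \<le> D" "\<beta> * x \<le> r + l + 1" "0 < l \<Longrightarrow> r + l < \<beta> * x"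
    using assms mem_lazy_cyl by blast+
  then have "\<not> l < d" "\<not> d < l" using assms by auto
  then show "l = d" by simp
qed

text \<open>A closed form in place of a description; measurability of \<open>T\<close> and the
  bounds on the orbit of \<open>1\<close> are read off from it.\<close>

lemma greedy_digit_floor: "x \<in> J \<Longrightarrow> greedy_digit \<beta> x = min (nat \<lfloor>\<beta> * x\<rfloor>) D"
proof -
  assume x: "x \<in> J"
  then have "0 \<le> \<beta> * x" using beta_pos by (simp add: J_eq)
  then show ?thesis using x
    by (intro greedy_digit_eqI) (auto simp: min_def, linarith+)
qed

text \<open>For \<open>\<beta> * x \<le> \<tau>\<close> the ceiling is nonpositive, and
  \<open>nat\<close> turns it into the digit \<open>0\<close>.\<close>

lemma lazy_digit_ceiling: "x \<in> J \<Longrightarrow> lazy_digit \<beta> x = nat \<lceil>\<beta> * x - \<tau>\<rceil>"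
proof -
  assume x: "x \<in> J"
  then have "\<beta> * x \<le> \<tau> + D" by (simp add: J_eq flip: beta_le_tau)
  then show ?thesis using x
    by (intro lazy_digit_eqI) (auto, linarith+)
qed

lemma T_E: "k \<le> D \<Longrightarrow> x \<in> E k \<Longrightarrow> T x = \<beta> * x - k"
  unfolding greedy_map_def using r_pos beta_pos
  by (subst greedy_digit_eqI[of x k]) (auto simp: mem_E J_eq)

lemma T_S: "1 \<le> k \<Longrightarrow> k \<le> D \<Longrightarrow> x \<in> S k \<Longrightarrow> T x = \<beta> * x - k"
  unfolding greedy_map_def using r_less1 S_sub_J[of k]
  by (subst greedy_digit_eqI[of x k]) (auto simp: mem_S)

lemma L_E: "k \<le> D \<Longrightarrow> x \<in> E k \<Longrightarrow> L x = \<beta> * x - k"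
proof -
  assume k: "k \<le> D" "x \<in> E k"
  then have "\<beta> * x \<le> r + real k + 1"
    using r_pos beta_le_tau[of x] by (cases "k = D") (auto simp: mem_E)
  then show ?thesis
  unfolding lazy_map_def using k
  by (subst lazy_digit_eqI[of x k]) (auto simp: mem_E J_eq)
qed

lemma L_S: "1 \<le> k \<Longrightarrow> k \<le> D \<Longrightarrow> x \<in> S k \<Longrightarrow> L x = \<beta> * x - k + 1"
  unfolding lazy_map_def using r_less1 S_sub_J[of k]
  by (subst lazy_digit_eqI[of x "k - 1"]) (auto simp: mem_S of_nat_diff)

lemma E_image: "k \<le> D \<Longrightarrow> x \<in> E k \<Longrightarrow> \<beta> * x - k \<in> J"
  using r_pos r_less1 beta_le_tau[of x] beta_pos
  by (cases "k = D"; cases "k = 0") (auto simp: mem_E J_eq)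

lemma S_image0: "x \<in> S k \<Longrightarrow> \<beta> * x - k \<in> {0..r}"
  by (auto simp: mem_S)

lemma S_image1: "x \<in> S k \<Longrightarrow> \<beta> * x - k + 1 \<in> {1..\<tau>}"
  by (auto simp: mem_S)

lemma T_J: "x \<in> J \<Longrightarrow> T x \<in> J"
  using T_E T_S E_image S_image0 by (elim J_cases) (fastforce simp: J_eq)+

lemma L_J: "x \<in> J \<Longrightarrow> L x \<in> J"
  using L_E L_S E_image S_image1 by (elim J_cases) (fastforce simp: J_eq)+

lemma K_E: "k \<le> D \<Longrightarrow> x \<in> E k \<Longrightarrow> K (\<omega>, x) = (\<omega>, \<beta> * x - k)"
proof -
  assume k: "k \<le> D" "x \<in> E k"
  then have "(THE k. k \<le> D \<and> x \<in> E k) = k" using EE_unique by blast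
  then show ?thesis using k by (auto simp: K_beta_def)
qed

lemma K_S:
  assumes k: "1 \<le> k" "k \<le> D" "x \<in> S k"
  shows "K (\<omega>, x) = (stl \<omega>, \<beta> * x - k + (if shd \<omega> then 0 else 1))"
proof -
  have "(THE k. 1 \<le> k \<and> k \<le> D \<and> x \<in> S k) = k" using k SS_unique by blast
  moreover have "\<not> (\<exists>k\<le>D. x \<in> E k)" using k ES_disjoint by blast
  ultimately show ?thesis by (auto simp: K_beta_def Let_def)
qed

text \<open>Replaces the descriptions in the definition of the random map by \<open>T\<close>,
  \<open>L\<close> and \<open>Eq\<close>, all of which are measurable.\<close>

lemma K_J:
  assumes "x \<in> J"
  shows "K (\<omega>, x) = (if x \<in> Eq then (\<omega>, T x) else (stl \<omega>, if shd \<omega> then T x else L x))"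
  using assms
proof (cases rule: J_cases)
  case (1 k)
  then show ?thesis using K_E T_E by (auto simp: Eq_def)
next
  case (2 k)
  then show ?thesis using K_S T_S L_S S_not_Eq by auto
qed

lemma L_Eq: "x \<in> Eq \<Longrightarrow> L x = T x"
  using L_E T_E by (auto simp: Eq_def)

end

section \<open>Cuts and cells\<close>

text \<open>The locale is interpreted with \<open>A\<close> itself as carrier, so injectivity of the
  key on \<open>A\<close> is enough.\<close>

lemma (in linorder) sorted_key_list_of_set_properties:
  assumes "inj_on f A" "finite A"
  shows "set (sorted_key_list_of_set f A) = A" "sorted (map f (sorted_key_list_of_set f A))"
    "distinct (sorted_key_list_of_set f A)" "length (sorted_key_list_of_set f A) = card A"
proof -
  interpret folding_insort_key "(\<le>)" "(<)" A f
    by unfold_locales fact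
  show "set (sorted_key_list_of_set f A) = A" "sorted (map f (sorted_key_list_of_set f A))"
    "distinct (sorted_key_list_of_set f A)" "length (sorted_key_list_of_set f A) = card A"
    using assms(2) distinct_sorted_key_list_of_set[of A] by (auto simp: distinct_map)
qed

locale finite_greedy =
  fixes \<beta> :: real and n :: nat and b :: "nat \<Rightarrow> nat"
  assumes base: "1 < \<beta>" "\<beta> \<notin> \<int>"
    and n_ge2: "2 \<le> n"
    and b_ge1: "\<And>i. 1 \<le> i \<Longrightarrow> i \<le> n \<Longrightarrow> 1 \<le> b i"
    and expansion: "finite_greedy_expansion \<beta> 1 n b"
    and not_quadratic: "\<beta>\<^sup>2 \<noteq> b 1 * \<beta> + 1"

text \<open>The greedy digit \<open>b 1\<close> is \<open>\<lfloor>\<beta>\<rfloor>\<close>. The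
  first two terms of the expansion of \<open>1\<close>, with \<open>b 2 \<ge> 1\<close>, give
  \<open>b 1 * \<beta> + 1 \<le> \<beta>\<^sup>2\<close>, and \<open>not_quadratic\<close> excludes
  equality.\<close>

sublocale finite_greedy \<subseteq> small_overlap
proof
  show "1 < \<beta>" "\<beta> \<notin> \<int>" using base by auto
  have fl: "real (b1 \<beta>) = of_int \<lfloor>\<beta>\<rfloor>" using base by (simp add: b1_def)
  have "of_int \<lfloor>\<beta>\<rfloor> \<noteq> \<beta>" using base by (metis Ints_of_int)
  then have lt: "real (b1 \<beta>) < \<beta>" "\<beta> < real (b1 \<beta>) + 1" using fl by linarith+
  have "greedy_digit \<beta> 1 = b1 \<beta>"
    unfolding greedy_digit_def
  proof (rule the_equality)
    show "b1 \<beta> \<le> b1 \<beta> \<and> 1 \<in> greedy_cyl \<beta> (b1 \<beta>)"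
      using base lt by (auto simp: greedy_cyl_def field_simps)
    fix d assume d: "d \<le> b1 \<beta> \<and> 1 \<in> greedy_cyl \<beta> d"
    show "d = b1 \<beta>"
    proof (rule ccontr)
      assume "d \<noteq> b1 \<beta>"
      then have "\<beta> < real d + 1" "real d + 1 \<le> b1 \<beta>"
        using d base by (auto simp: greedy_cyl_def field_simps)
      then show False using lt by linarith
    qed
  qed
  moreover have "greedy_digit \<beta> 1 = b 1"
    using expansion n_ge2 unfolding finite_greedy_expansion_def
    by (auto dest!: conjunct2 spec[of _ 1])
  ultimately have b1: "b 1 = b1 \<beta>" by simp
  have "(\<Sum>i\<in>{1,2}. b i / \<beta> ^ i) \<le> (\<Sum>i=1..n. b i / \<beta> ^ i)"
    by (rule sum_mono2) (use n_ge2 base in auto)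
  then have "b 1 / \<beta> + b 2 / \<beta>\<^sup>2 \<le> 1"
    using expansion by (simp add: finite_greedy_expansion_def)
  then have "b 1 * \<beta> + b 2 \<le> \<beta>\<^sup>2"
    using base by (simp add: field_simps power2_eq_square)
  moreover have "1 \<le> real (b 2)" using b_ge1[of 2] n_ge2 by simp
  ultimately show "b1 \<beta> * \<beta> + 1 < \<beta>\<^sup>2" using not_quadratic b1 by simp
qed

context finite_greedy
begin

section \<open>The orbit of 1 and its reflection\<close>

definition "orb i = (T ^^ i) 1"

lemma orb_0: "orb 0 = 1" and orb_Suc: "orb (Suc i) = T (orb i)"
  by (simp_all add: orb_def)

lemma orb_J: "orb i \<in> J"
proof (induction i)
  case 0
  show ?case using tau_gt1 by (simp add: orb_0 J_eq)
qed (simp add: orb_Suc T_J)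

lemma orb_digit: "i < n \<Longrightarrow> greedy_digit \<beta> (orb i) = b (Suc i)"
  using expansion unfolding finite_greedy_expansion_def orb_def
  by (auto dest!: conjunct2 spec[of _ "Suc i"])

lemma orb_step: "i < n \<Longrightarrow> orb (Suc i) = \<beta> * orb i - b (Suc i)"
  by (simp add: orb_Suc greedy_map_def orb_digit)

lemma b_le: "i < n \<Longrightarrow> b (Suc i) \<le> D"
  using orb_digit[of i] greedy_digit_floor[OF orb_J, of i] by simp

lemma b_le_orb: "i < n \<Longrightarrow> b (Suc i) \<le> \<beta> * orb i"
proof -
  assume "i < n"
  have "0 \<le> \<beta> * orb i" using orb_J[of i] beta_pos by (simp add: J_eq)
  then have "real (min (nat \<lfloor>\<beta> * orb i\<rfloor>) D) \<le> \<beta> * orb i" by (simp add: min_def) linarith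
  then show ?thesis using orb_digit[OF \<open>i < n\<close>] greedy_digit_floor[OF orb_J, of i] by simp
qed

text \<open>Because no digit is zero, the orbit avoids the first equality region
  \<open>[0, 1 / \<beta>)\<close> before time \<open>n\<close>.\<close>

lemma orb_ge: "i < n \<Longrightarrow> 1 \<le> \<beta> * orb i"
  using b_le_orb[of i] b_ge1[of "Suc i"] by simp

lemma orb_le1: "i \<le> n \<Longrightarrow> orb i \<le> 1"
proof (induction i)
  case (Suc i)
  then have i: "i < n" "orb i \<le> 1" by auto
  have d: "b (Suc i) = min (nat \<lfloor>\<beta> * orb i\<rfloor>) D"
    using orb_digit[OF i(1)] greedy_digit_floor[OF orb_J, of i] by simp
  have "\<beta> * orb i - b (Suc i) \<le> 1"
  proof (cases "nat \<lfloor>\<beta> * orb i\<rfloor> \<le> D")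
    case True
    then show ?thesis using d by simp linarith
  next
    case False
    have "\<beta> * orb i \<le> \<beta>" using i beta_pos by simp
    then show ?thesis using d False D_gt by simp
  qed
  then show ?case using orb_step i by simp
qed (simp add: orb_0)

text \<open>Unwinding the recursion writes \<open>1\<close> as the sum over the first
  \<open>m\<close> digits plus the remainder \<open>orb m / \<beta> ^ m\<close>; at
  \<open>m = n\<close> the sum alone is \<open>1\<close>.\<close>

lemma orb_n: "orb n = 0"
proof -
  have "m \<le> n \<Longrightarrow> (\<Sum>i=1..m. b i / \<beta> ^ i) + orb m / \<beta> ^ m = 1" for m
  proof (induction m)
    case (Suc m)
    then have "orb (Suc m) = \<beta> * orb m - b (Suc m)" by (simp add: orb_step)
    then have "b (Suc m) / \<beta> ^ Suc m + orb (Suc m) / \<beta> ^ Suc m = orb m / \<beta> ^ m"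
      using beta_pos by (simp add: field_simps)
    then show ?case using Suc by (simp add: add_ac)
  qed (simp add: orb_0)
  from this[of n] have "orb n / \<beta> ^ n = 0"
    using expansion by (simp add: finite_greedy_expansion_def)
  then show ?thesis using beta_pos by simp
qed

lemma orb_last: "\<beta> * orb (n - 1) = b n"
  using orb_step[of "n - 1"] n_ge2 by (simp add: orb_n)

lemma b_n: "1 \<le> b n" "b n \<le> D"
  using b_ge1[of n] b_le[of "n - 1"] n_ge2 by auto

text \<open>The next orbit point is at least \<open>1 / \<beta>\<close>, hence larger than
  \<open>r\<close>, so the current one lies beyond the switch region of its digit. The bound
  \<open>i < n - 1\<close> matters: the point after \<open>orb (n - 1)\<close> is
  \<open>0\<close>.\<close>

lemma orb_E: "i < n - 1 \<Longrightarrow> orb i \<in> E (b (Suc i))"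
proof -
  assume i: "i < n - 1"
  then have "1 \<le> \<beta> * orb (Suc i)" by (intro orb_ge) simp
  then have "r < orb (Suc i)"
    using beta_r beta_pos by (smt (verit) mult_left_mono)
  then have 1: "r + b (Suc i) < \<beta> * orb i" using orb_step[of i] i by simp
  have "0 \<le> \<beta> * orb i" using orb_J[of i] beta_pos by (simp add: J_eq)
  then have 2: "b (Suc i) < D \<Longrightarrow> \<beta> * orb i < b (Suc i) + 1"
  proof -
    have "b (Suc i) = min (nat \<lfloor>\<beta> * orb i\<rfloor>) D"
      using orb_digit[of i] greedy_digit_floor[OF orb_J, of i] i by simp
    then show "b (Suc i) < D \<Longrightarrow> \<beta> * orb i < b (Suc i) + 1"
      by (simp add: min_def split: if_splits) linarith
  qed
  show ?thesis using 1 2 orb_J[of i] b_le[of i] i by (auto simp: mem_E J_eq)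
qed

lemma E_reflect: "k \<le> D \<Longrightarrow> x \<in> E k \<Longrightarrow> \<tau> - x \<in> E (D - k)"
  by (auto simp: mem_E right_diff_distrib beta_tau of_nat_diff)

text \<open>On equality regions the greedy map commutes with \<open>x \<mapsto> \<tau> - x\<close>,
  which exchanges \<open>E k\<close> and \<open>E (D - k)\<close>; by \<open>orb_E\<close> the orbit
  stays there for as long as needed.\<close>

lemma orb_reflect: "i < n \<Longrightarrow> (T ^^ i) r = \<tau> - orb i"
proof (induction i)
  case (Suc i)
  define k where "k = b (Suc i)"
  have k: "orb i \<in> E k" "k \<le> D" using Suc orb_E[of i] b_le[of i] by (auto simp: k_def)
  have "(T ^^ Suc i) r = T (\<tau> - orb i)" using Suc by simp
  also have "\<dots> = \<beta> * (\<tau> - orb i) - real (D - k)"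
    using T_E[OF _ E_reflect[OF k(2,1)]] by simp
  also have "\<dots> = \<tau> - orb (Suc i)"
    using k Suc by (simp add: orb_step k_def right_diff_distrib beta_tau of_nat_diff)
  finally show ?case .
qed (simp add: orb_0)

section \<open>Cuts, including the ends of the switch regions, and their images\<close>

definition "lcuts = left_cuts \<beta> n \<union> {k / \<beta> | k. k \<in> {1..D}}"
definition "rcuts = right_cuts \<beta> n \<union> {(r + k) / \<beta> | k. k \<in> {1..D}}"

lemma lcuts_eq: "lcuts = orb ` {..<n-1} \<union> {k / \<beta> | k. k \<in> {1..D}}"
proof -
  have "{0..n-2} = {..<n-1}" using n_ge2 by auto
  then show ?thesis by (simp add: lcuts_def left_cuts_def orb_def)
qed

lemma lcuts_cases:
  assumes "t \<in> lcuts"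
  obtains i where "i < n - 1" "t = orb i" | k where "1 \<le> k" "k \<le> D" "\<beta> * t = k"
  using assms beta_pos by (auto simp: lcuts_eq)

text \<open>The point at time \<open>n - 1\<close> is no longer among \<open>left_cuts\<close>, but
  it equals \<open>b n / \<beta>\<close>, the left end of a switch region.\<close>

lemma orb_lcuts: "i < n \<Longrightarrow> orb i \<in> lcuts"
proof (cases "i = n - 1")
  case True
  then have "orb i = b n / \<beta>" using orb_last beta_pos by (simp add: field_simps)
  then show ?thesis using b_n by (auto simp: lcuts_eq)
qed (auto simp: lcuts_eq)

lemma rcuts_eq: "rcuts = (\<lambda>t. \<tau> - t) ` lcuts"
proof -
  have "{0..n-2} = {..<n-1}" using n_ge2 by auto
  then have "right_cuts \<beta> n = (\<lambda>i. \<tau> - orb i) ` {..<n-1}"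
    unfolding right_cuts_def \<tau>_def[symmetric] by (auto simp: orb_reflect intro!: image_cong)
  moreover have "{(r + k) / \<beta> | k. k \<in> {1..D}} = (\<lambda>t. \<tau> - t) ` {k / \<beta> | k. k \<in> {1..D}}"
    (is "?A = ?B")
  proof -
    \<comment> \<open>Reflection sends the left end of \<open>S (D + 1 - k)\<close> to the right end
      of \<open>S k\<close>.\<close>
    have *: "(r + k) / \<beta> = \<tau> - real (D + 1 - k) / \<beta>" if "k \<in> {1..D}" for k
      using that beta_pos beta_tau by (simp add: field_simps of_nat_diff)
    have "?A = (\<lambda>k. (r + k) / \<beta>) ` {1..D}" by auto
    also have "\<dots> = (\<lambda>k. \<tau> - real (D + 1 - k) / \<beta>) ` {1..D}"
      using * by (intro image_cong) auto
    also have "\<dots> = (\<lambda>k. \<tau> - real k / \<beta>) ` ((\<lambda>k. D + 1 - k) ` {1..D})"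
      by (simp add: image_image)
    also have "(\<lambda>k. D + 1 - k) ` {1..D} = {1..D}"
    proof -
      have "k \<in> (\<lambda>k. D + 1 - k) ` {1..D}" if "k \<in> {1..D}" for k
        using that by (intro image_eqI[of _ _ "D + 1 - k"]) auto
      then show ?thesis by auto
    qed
    also have "(\<lambda>k. \<tau> - real k / \<beta>) ` {1..D} = ?B" by (auto simp: image_iff)
    finally show ?thesis .
  qed
  ultimately show ?thesis by (simp add: rcuts_def lcuts_eq image_Un image_image)
qed

lemma mem_rcuts: "t \<in> rcuts \<longleftrightarrow> \<tau> - t \<in> lcuts"
  by (auto simp: rcuts_eq image_iff) (metis add_diff_cancel_left' diff_diff_eq2)

lemma finite_lcuts: "finite lcuts" and finite_rcuts: "finite rcuts"
proof -
  have "{k / \<beta> | k. k \<in> {1..D}} = (\<lambda>k. real k / \<beta>) ` {1..D}" by auto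
  then show "finite lcuts" by (simp add: lcuts_eq)
  then show "finite rcuts" by (simp add: rcuts_eq)
qed

lemma lcuts_bounds: "t \<in> lcuts \<Longrightarrow> 1 \<le> \<beta> * t \<and> t \<le> 1"
proof (erule lcuts_cases)
  fix i assume "i < n - 1" "t = orb i"
  then show "1 \<le> \<beta> * t \<and> t \<le> 1" using orb_ge[of i] orb_le1[of i] by simp
next
  fix k assume "1 \<le> k" "k \<le> D" "\<beta> * t = real k"
  moreover from this have "\<beta> * t \<le> \<beta> * 1" using D_less by simp
  then have "t \<le> 1" using mult_le_cancel_left_pos[OF beta_pos, of t 1] by blast
  then show "1 \<le> \<beta> * t \<and> t \<le> 1" using calculation by simp
qed

text \<open>Since \<open>r < 1 / \<beta>\<close>. This keeps all left cuts out of the first cell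
  and, by reflection, all right cuts out of the last.\<close>

lemma lcuts_gt_r: "t \<in> lcuts \<Longrightarrow> r < t"
  using lcuts_bounds[of t] beta_r beta_pos by (smt (verit) mult_left_mono)

lemma rcuts_bounds: "t \<in> rcuts \<Longrightarrow> r \<le> t \<and> t < 1"
  using lcuts_bounds[of "\<tau> - t"] lcuts_gt_r[of "\<tau> - t"] by (simp add: mem_rcuts)

lemma lcuts_1: "1 \<in> lcuts" using orb_lcuts[of 0] n_ge2 by (simp add: orb_0)

lemma rcuts_r: "r \<in> rcuts" using lcuts_1 by (simp add: mem_rcuts)

text \<open>A left cut inside an equality region is an orbit point, because the ends of switch
  regions belong to switch regions; its image is the next orbit point.\<close>

lemma lcuts_step:
  assumes "t \<in> lcuts" "t \<in> E k" "k \<le> D"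
  shows "\<beta> * t - k \<in> lcuts"
  using assms(1)
proof (cases rule: lcuts_cases)
  case (1 i)
  then have "orb i \<in> E (b (Suc i))" "b (Suc i) \<le> D" "orb i \<in> E k" using orb_E b_le assms by auto
  then have "b (Suc i) = k" using assms(3) EE_unique by blast
  then show ?thesis using 1 orb_step[of i] orb_lcuts[of "Suc i"] by simp
next
  case (2 l)
  then have "t \<in> S l" using r_pos by (simp add: mem_S)
  then show ?thesis using ES_disjoint assms 2 by blast
qed

lemma rcuts_step:
  assumes "t \<in> rcuts" "t \<in> E k" "k \<le> D"
  shows "\<beta> * t - k \<in> rcuts"
proof -
  have "\<beta> * (\<tau> - t) - real (D - k) \<in> lcuts"
    using assms by (intro lcuts_step E_reflect) (auto simp: mem_rcuts)
  then show ?thesis using assms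
    by (simp add: mem_rcuts right_diff_distrib beta_tau of_nat_diff algebra_simps)
qed

text \<open>The induction follows the time left. If both points are in equality regions, applying
  \<open>T\<close> moves the equation one step on. At the final time the orbit is at the left end of
  a switch region and its reflection at the right end of one: neither is in an equality region, and
  if the two coincided, \<open>r\<close> would be \<open>0\<close>.\<close>

lemma orb_disjoint: "i < n \<Longrightarrow> j < n \<Longrightarrow> orb i \<noteq> \<tau> - orb j"
proof (induction "n - i" arbitrary: i j rule: less_induct)
  case less
  have lastS: "orb (n - 1) \<in> S (b n)" "\<tau> - orb (n - 1) \<in> S (D + 1 - b n)"
    using orb_last r_pos b_n
    by (auto simp: mem_S right_diff_distrib beta_tau of_nat_diff)
  have last: "1 \<le> D + 1 - b n" "D + 1 - b n \<le> D" using b_n by auto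
  consider "i = n - 1" "j = n - 1" | "i = n - 1" "j < n - 1" | "i < n - 1" "j = n - 1"
    | "i < n - 1" "j < n - 1" using less.prems by linarith
  then show ?case
  proof cases
    case 1
    show ?thesis
    proof
      assume eq: "orb i = \<tau> - orb j"
      then have "D + 1 - b n = b n" using SS_unique lastS 1 by metis
      then have "real D + 1 - b n = b n" using b_n by linarith
      moreover have "\<beta> * orb (n - 1) = \<beta> * (\<tau> - orb (n - 1))" using eq 1 by simp
      ultimately have "r = 0"
        using orb_last by (simp add: right_diff_distrib beta_tau)
      then show False using r_pos by simp
    qed
  next
    case 2
    then have "\<tau> - orb j \<in> E (D - b (Suc j))" by (intro E_reflect orb_E b_le) auto
    then show ?thesis using ES_disjoint lastS b_n 2 by (metis diff_le_self)
  next
    case 3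
    then have "orb i \<in> E (b (Suc i))" "b (Suc i) \<le> D" using orb_E b_le less by auto
    then show ?thesis using ES_disjoint lastS last 3 by metis
  next
    case 4
    show ?thesis
    proof
      assume eq: "orb i = \<tau> - orb j"
      have "orb (Suc i) = T (\<tau> - orb j)" using eq by (simp add: orb_Suc)
      also have "\<dots> = T ((T ^^ j) r)" using 4 by (simp add: orb_reflect)
      also have "\<dots> = \<tau> - orb (Suc j)" using orb_reflect[of "Suc j"] 4 by simp
      finally show False using less.hyps[of "Suc i" "Suc j"] 4 less.prems by auto
    qed
  qed
qed

text \<open>A point that is a left and a right cut at once would form a cell of length zero.\<close>

lemma cuts_disjoint: "lcuts \<inter> rcuts = {}"
proof (rule ccontr)
  assume "lcuts \<inter> rcuts \<noteq> {}"
  then obtain t where t: "t \<in> lcuts" "\<tau> - t \<in> lcuts" by (auto simp: mem_rcuts)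
  have S1: "t \<in> S k" if "\<beta> * t = k" for k :: nat and t using that r_pos by (simp add: mem_S)
  have S2: "\<tau> - t \<in> S (D + 1 - k)" "1 \<le> D + 1 - k" "D + 1 - k \<le> D"
    if "\<beta> * t = k" "1 \<le> k" "k \<le> D" for k :: nat and t
    using that r_pos by (auto simp: mem_S right_diff_distrib beta_tau of_nat_diff)
  have ES: False if "i < n - 1" "t = orb i" "\<beta> * (\<tau> - t) = k" "1 \<le> k" "k \<le> D" for t i and k :: nat
    using that orb_E[of i] b_le[of i] S2[of "\<tau> - t" k] ES_disjoint by fastforce
  from t(1) show False
  proof (cases rule: lcuts_cases)
    case (1 i)
    from t(2) show False
    proof (cases rule: lcuts_cases)
      case (1 j)
      then show ?thesis using orb_disjoint[of i j] \<open>t = orb i\<close> \<open>i < n - 1\<close> by force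
    next
      case (2 k)
      then show ?thesis using ES 1 by blast
    qed
  next
    case k: (2 k)
    from t(2) show False
    proof (cases rule: lcuts_cases)
      case (1 j)
      then show ?thesis using ES[of j "\<tau> - t" k] k by (metis cancel_ab_semigroup_add_class.add_diff_cancel_left' diff_diff_eq2 add_diff_cancel_right')
    next
      case (2 l)
      then have "t \<in> S (D + 1 - l)" "t \<in> S k" using S2(1)[of "\<tau> - t" l] S1[of t k] k by auto
      then have "D + 1 - l = k" using SS_unique by blast
      then have "real k + real l = D + 1" using 2 k by linarith
      then have "r = 0" using 2 k by (simp add: right_diff_distrib beta_tau)
      then show False using r_pos by simp
    qed
  qed
qed

section \<open>Cells as classes of points that no cut separates\<close>

definition cl :: "real \<Rightarrow> real set" where
  "cl x = {y \<in> J. (\<forall>t\<in>lcuts. t \<le> y \<longleftrightarrow> t \<le> x) \<and> (\<forall>t\<in>rcuts. y \<le> t \<longleftrightarrow> x \<le> t)}"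

lemma cl_self: "x \<in> J \<Longrightarrow> x \<in> cl x" by (simp add: cl_def)

lemma cl_eq: "y \<in> cl x \<Longrightarrow> cl y = cl x" by (auto simp: cl_def)

lemma cl_J: "cl x \<subseteq> J" by (auto simp: cl_def)

lemma cl_E:
  assumes "x \<in> E k" "k \<le> D" "y \<in> J"
    and l: "\<And>l. 1 \<le> l \<Longrightarrow> l \<le> D \<Longrightarrow> l \<le> \<beta> * y \<longleftrightarrow> l \<le> \<beta> * x"
    and u: "\<And>l. 1 \<le> l \<Longrightarrow> l \<le> D \<Longrightarrow> \<beta> * y \<le> r + l \<longleftrightarrow> \<beta> * x \<le> r + l"
  shows "y \<in> E k"
proof -
  have "r + k < \<beta> * y" if "0 < k"
    using u[of k] that assms(1,2) mem_E[of k x] by fastforce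
  moreover have "\<beta> * y < real k + 1" if "k < D"
    using l[of "k + 1"] that assms(1,2) mem_E[of k x] by fastforce
  ultimately show ?thesis using assms(2,3) by (auto simp: mem_E J_eq)
qed

lemma cl_S:
  assumes "x \<in> S k" "1 \<le> k" "k \<le> D"
    and l: "\<And>l. 1 \<le> l \<Longrightarrow> l \<le> D \<Longrightarrow> l \<le> \<beta> * y \<longleftrightarrow> l \<le> \<beta> * x"
    and u: "\<And>l. 1 \<le> l \<Longrightarrow> l \<le> D \<Longrightarrow> \<beta> * y \<le> r + l \<longleftrightarrow> \<beta> * x \<le> r + l"
  shows "y \<in> S k"
  using assms l[of k] u[of k] by (simp add: mem_S)

lemma cl_thresholds:
  assumes "y \<in> cl x" "1 \<le> l" "l \<le> D"
  shows "l \<le> \<beta> * y \<longleftrightarrow> l \<le> \<beta> * x" "\<beta> * y \<le> r + l \<longleftrightarrow> \<beta> * x \<le> r + l"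
proof -
  have "real l / \<beta> \<in> lcuts" "(r + l) / \<beta> \<in> rcuts" using assms unfolding lcuts_def rcuts_def by auto
  then have *: "real l / \<beta> \<le> y \<longleftrightarrow> real l / \<beta> \<le> x" "y \<le> (r + l) / \<beta> \<longleftrightarrow> x \<le> (r + l) / \<beta>"
    using assms(1) unfolding cl_def by blast+
  show "l \<le> \<beta> * y \<longleftrightarrow> l \<le> \<beta> * x" "\<beta> * y \<le> r + l \<longleftrightarrow> \<beta> * x \<le> r + l"
    using * beta_pos by (simp_all add: field_simps)
qed

lemma cl_sub_E: "x \<in> E k \<Longrightarrow> k \<le> D \<Longrightarrow> cl x \<subseteq> E k"
  using cl_E cl_thresholds cl_J by blast

lemma cl_sub_S: "x \<in> S k \<Longrightarrow> 1 \<le> k \<Longrightarrow> k \<le> D \<Longrightarrow> cl x \<subseteq> S k"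
  using cl_S cl_thresholds by blast

lemma E_thresholds:
  assumes "x \<in> E k" "y \<in> E k" "k \<le> D" "1 \<le> l" "l \<le> D"
  shows "(l \<le> \<beta> * y \<longleftrightarrow> l \<le> \<beta> * x) \<and> (\<beta> * y \<le> r + l \<longleftrightarrow> \<beta> * x \<le> r + l)"
proof (cases "l \<le> k")
  case True
  then have "r + k < \<beta> * x" "r + k < \<beta> * y" using assms by (auto simp: mem_E)
  moreover have "real l \<le> k" using True by simp
  ultimately show ?thesis using r_pos by auto
next
  case False
  then have "\<beta> * x < k + 1" "\<beta> * y < k + 1" using assms by (auto simp: mem_E)
  moreover have "real k + 1 \<le> l" using False by linarith
  ultimately show ?thesis using r_pos by auto
qed

lemma S_thresholds:
  assumes "x \<in> S k" "y \<in> S k" "k \<le> D" "1 \<le> l" "l \<le> D"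
  shows "(l \<le> \<beta> * y \<longleftrightarrow> l \<le> \<beta> * x) \<and> (\<beta> * y \<le> r + l \<longleftrightarrow> \<beta> * x \<le> r + l)"
proof -
  have *: "k \<le> \<beta> * x" "k \<le> \<beta> * y" "\<beta> * x \<le> r + k" "\<beta> * y \<le> r + k"
    using assms by (auto simp: mem_S)
  consider "l = k" | "l < k" | "k < l" by linarith
  then show ?thesis
  proof cases
    case 2
    then have "real l + 1 \<le> k" by linarith
    then show ?thesis using * r_less1 by auto
  next
    case 3
    then have "real k + 1 \<le> l" by linarith
    then show ?thesis using * r_less1 by auto
  qed (use * in auto)
qed

text \<open>The ends of the switch regions count as cuts. They separate different regions but never
  two points of the same region, so the classes in \<open>J\<close> are the cells formed region by
  region.\<close>

lemma cells_eq: "cells \<beta> n = cl ` J"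
proof -
  have *: "{y \<in> I. (\<forall>t\<in>left_cuts \<beta> n. t \<le> y \<longleftrightarrow> t \<le> x) \<and> (\<forall>t\<in>right_cuts \<beta> n. y \<le> t \<longleftrightarrow> x \<le> t)} = cl x"
    (is "?C = _")
    if I: "I \<in> regions \<beta>" and x: "x \<in> I" for I x
  proof -
    have I_cases: "(\<exists>k\<le>D. I = E k) \<or> (\<exists>k. 1 \<le> k \<and> k \<le> D \<and> I = S k)"
      using I by (auto simp: regions_def)
    have th: "(l \<le> \<beta> * y \<longleftrightarrow> l \<le> \<beta> * x) \<and> (\<beta> * y \<le> r + l \<longleftrightarrow> \<beta> * x \<le> r + l)"
      if "y \<in> I" "1 \<le> l" "l \<le> D" for y l
      using E_thresholds S_thresholds x that I_cases by blast
    have clI: "cl x \<subseteq> I" using x I_cases cl_sub_E cl_sub_S by blast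
    have IJ: "I \<subseteq> J" using I_cases E_sub_J S_sub_J by blast
    show ?thesis
    proof
      show "cl x \<subseteq> ?C" using clI by (auto simp: cl_def lcuts_def rcuts_def)
      show "?C \<subseteq> cl x"
      proof
        fix y assume y: "y \<in> ?C"
        have "k / \<beta> \<le> y \<longleftrightarrow> k / \<beta> \<le> x" "y \<le> (r + k) / \<beta> \<longleftrightarrow> x \<le> (r + k) / \<beta>"
          if "k \<in> {1..D}" for k :: nat
          using th[of y k] y that beta_pos by (auto simp: field_simps)
        then show "y \<in> cl x" using y IJ unfolding cl_def lcuts_def rcuts_def by blast
      qed
    qed
  qed
  show ?thesis
  proof (intro equalityI subsetI)
    fix Z assume "Z \<in> cells \<beta> n"
    then obtain I x where I: "I \<in> regions \<beta>" "x \<in> I"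
      and "Z = {y \<in> I. (\<forall>t\<in>left_cuts \<beta> n. t \<le> y \<longleftrightarrow> t \<le> x) \<and> (\<forall>t\<in>right_cuts \<beta> n. y \<le> t \<longleftrightarrow> x \<le> t)}"
      unfolding cells_def by blast
    then have "Z = cl x" using * by simp
    moreover have "x \<in> J"
      using I E_sub_J S_sub_J unfolding regions_def by fastforce
    ultimately show "Z \<in> cl ` J" by blast
  next
    fix Z assume "Z \<in> cl ` J"
    then obtain x where x: "x \<in> J" "Z = cl x" by blast
    from x(1) obtain I where I: "I \<in> regions \<beta>" "x \<in> I"
    proof (cases rule: J_cases)
      case (1 k)
      then show ?thesis using that[of "E k"] by (auto simp: regions_def)
    next
      case (2 k)
      then show ?thesis using that[of "S k"] by (auto simp: regions_def)
    qed
    show "Z \<in> cells \<beta> n" unfolding x(2) *[OF I, symmetric] cells_def using I by blast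
  qed
qed

lemma cl_between:
  assumes "u \<in> cl x" "v \<in> cl x" "u \<le> y" "y \<le> v"
  shows "y \<in> cl x"
proof -
  have "y \<in> J" using assms cl_J[of x] by (force simp: J_eq)
  moreover have "t \<le> y \<longleftrightarrow> t \<le> x" if "t \<in> lcuts" for t
    using assms that unfolding cl_def by fastforce
  moreover have "y \<le> t \<longleftrightarrow> x \<le> t" if "t \<in> rcuts" for t
    using assms that unfolding cl_def by fastforce
  ultimately show ?thesis by (simp add: cl_def)
qed

text \<open>If \<open>x\<close> is neither \<open>0\<close> nor a left cut, its class contains the
  points slightly below \<open>x\<close>; otherwise \<open>x\<close> is not a right cut, and the
  class contains the points slightly above. Finiteness of the cuts leaves room for a
  midpoint.\<close>

lemma cl_nondegenerate:
  assumes x: "x \<in> J"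
  shows "\<exists>u v. u < v \<and> u \<in> cl x \<and> v \<in> cl x"
proof (cases "x \<in> insert 0 lcuts")
  case False
  define A where "A = insert 0 {t \<in> lcuts \<union> rcuts. t < x}"
  have A: "finite A" "A \<noteq> {}" using finite_lcuts finite_rcuts by (auto simp: A_def)
  define u where "u = (Max A + x) / 2"
  have "Max A < x" using A False x by (subst Max_less_iff) (auto simp: A_def J_eq)
  then have u: "Max A < u" "u < x" by (auto simp: u_def)
  have ge: "t < u" if "t \<in> A" for t using Max_ge[OF A(1) that] u by simp
  have "u \<in> cl x" unfolding cl_def
  proof (intro CollectI conjI ballI)
    have "0 < u" using ge by (simp add: A_def)
    then show "u \<in> J" using u x by (auto simp: J_eq)
    show "t \<le> u \<longleftrightarrow> t \<le> x" if "t \<in> lcuts" for t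
    proof
      assume "t \<le> x"
      then have "t < x" using False that by (metis insertCI order_le_less)
      then show "t \<le> u" using ge[of t] that by (simp add: A_def)
    qed (use u in simp)
    show "u \<le> t \<longleftrightarrow> x \<le> t" if "t \<in> rcuts" for t
      using u ge[of t] that by (fastforce simp: A_def)
  qed
  then show ?thesis using u cl_self[OF x] by blast
next
  case True
  define A where "A = insert \<tau> {t \<in> lcuts \<union> rcuts. x < t}"
  have A: "finite A" "A \<noteq> {}" using finite_lcuts finite_rcuts by (auto simp: A_def)
  define v where "v = (Min A + x) / 2"
  have "x < \<tau>" using True lcuts_bounds[of x] tau_gt1 by auto
  then have "x < Min A" using A by (subst Min_gr_iff) (auto simp: A_def)
  then have v: "v < Min A" "x < v" by (auto simp: v_def)
  have le: "v < t" if "t \<in> A" for t using Min_le[OF A(1) that] v by simp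
  have xr: "x \<notin> rcuts"
    using True cuts_disjoint rcuts_bounds[of x] r_pos by auto
  have "v \<in> cl x" unfolding cl_def
  proof (intro CollectI conjI ballI)
    have "v < \<tau>" using le by (simp add: A_def)
    then show "v \<in> J" using v x by (auto simp: J_eq)
    show "t \<le> v \<longleftrightarrow> t \<le> x" if "t \<in> lcuts" for t
      using v le[of t] that by (fastforce simp: A_def)
    show "v \<le> t \<longleftrightarrow> x \<le> t" if "t \<in> rcuts" for t
    proof
      assume "x \<le> t"
      then have "x < t" using xr that by (metis order_le_less)
      then show "v \<le> t" using le[of t] that by (simp add: A_def)
    qed (use v in simp)
  qed
  then show ?thesis using v cl_self[OF x] by blast
qed

text \<open>The Markov property: \<open>\<beta> x - k\<close> maps every cell inside \<open>E k\<close> onto a union of cells, because it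
  maps cuts to cuts.\<close>

lemma cl_markov:
  assumes x: "x \<in> E k" "k \<le> D" and z: "z \<in> cl (\<beta> * x - k)"
  shows "(z + k) / \<beta> \<in> cl x"
proof -
  define y where "y = (z + k) / \<beta>"
  have byz: "\<beta> * y = z + k" using beta_pos by (simp add: y_def)
  have zJ: "0 \<le> z" "z \<le> \<tau>" using z cl_J by (auto simp: J_eq subset_iff)
  \<comment> \<open>Both \<open>1\<close> and \<open>r\<close> are cuts, so \<open>z\<close> and the
    image of \<open>x\<close> are on the same sides of them; this puts the preimage \<open>y\<close>
    in the same equality region as \<open>x\<close>.\<close>
  have z1: "1 \<le> z \<longleftrightarrow> 1 \<le> \<beta> * x - k" "z \<le> r \<longleftrightarrow> \<beta> * x - k \<le> r"
    using z lcuts_1 rcuts_r by (auto simp: cl_def)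
  have "0 \<le> \<beta> * y" using zJ by (simp add: byz)
  then have y0: "0 \<le> y" using beta_pos by (simp add: zero_le_mult_iff)
  have "z + k \<le> \<tau> + D" using zJ x by simp
  then have y1: "y \<le> \<tau>" unfolding beta_le_tau by (simp add: byz)
  have yE: "y \<in> E k" using y0 y1 x z1 by (auto simp: mem_E byz)
  \<comment> \<open>Regions are intervals, so a cut outside \<open>E k\<close> cannot lie between
    \<open>x\<close> and \<open>y\<close>; only cuts inside \<open>E k\<close>, whose images are
    cuts, have to be compared.\<close>
  have sep: "t \<in> E k" if "y \<le> t \<and> t \<le> x \<or> x \<le> t \<and> t \<le> y" for t
  proof -
    have "\<beta> * y \<le> \<beta> * t \<and> \<beta> * t \<le> \<beta> * x \<or> \<beta> * x \<le> \<beta> * t \<and> \<beta> * t \<le> \<beta> * y"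
      using that beta_pos by auto
    then show ?thesis using that x yE by (auto simp: mem_E)
  qed
  have "t \<le> y \<longleftrightarrow> t \<le> x" if "t \<in> lcuts" for t
  proof (cases "t \<in> E k")
    case True
    then have "\<beta> * t - k \<le> z \<longleftrightarrow> \<beta> * t - k \<le> \<beta> * x - k"
      using lcuts_step[OF that] x z by (auto simp: cl_def)
    moreover have "t \<le> y \<longleftrightarrow> \<beta> * t \<le> \<beta> * y" "t \<le> x \<longleftrightarrow> \<beta> * t \<le> \<beta> * x" using beta_pos by auto
    ultimately show ?thesis using byz by auto
  next
    case False
    then show ?thesis using sep[of t] by linarith
  qed
  moreover have "y \<le> t \<longleftrightarrow> x \<le> t" if "t \<in> rcuts" for t
  proof (cases "t \<in> E k")
    case True
    then have "z \<le> \<beta> * t - k \<longleftrightarrow> \<beta> * x - k \<le> \<beta> * t - k"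
      using rcuts_step[OF that] x z by (auto simp: cl_def)
    moreover have "y \<le> t \<longleftrightarrow> \<beta> * y \<le> \<beta> * t" "x \<le> t \<longleftrightarrow> \<beta> * x \<le> \<beta> * t" using beta_pos by auto
    ultimately show ?thesis using byz by auto
  next
    case False
    then show ?thesis using sep[of t] by linarith
  qed
  ultimately show ?thesis using y0 y1 by (auto simp: cl_def J_eq y_def[symmetric])
qed

text \<open>All left cuts exceed \<open>r\<close>, and \<open>r\<close> is the smallest right cut;
  \<open>cl_tau\<close> is the mirror image.\<close>

lemma cl_0: "cl 0 = {0..r}"
proof -
  have "\<not> t \<le> y" if "t \<in> lcuts" "y \<le> r" for t y using lcuts_gt_r that by force
  moreover have "y \<le> t" if "t \<in> rcuts" "y \<le> r" for t y using rcuts_bounds that by force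
  ultimately show ?thesis
    using rcuts_r r_pos unfolding cl_def J_eq by (intro set_eqI) (smt (verit) atLeastAtMost_iff mem_Collect_eq)
qed

lemma cl_tau: "cl \<tau> = {1..\<tau>}"
proof -
  have "t \<le> y" if "t \<in> lcuts" "1 \<le> y" for t y using lcuts_bounds that by force
  moreover have "\<not> y \<le> t" if "t \<in> rcuts" "1 \<le> y" for t y using rcuts_bounds that by force
  ultimately show ?thesis
    using lcuts_1 tau_gt1 unfolding cl_def J_eq by (intro set_eqI) (smt (verit) atLeastAtMost_iff mem_Collect_eq)
qed

text \<open>Orbit points before the last and their reflections lie in equality regions, and the
  remaining cuts are ends of switch regions, so nothing cuts a switch region.\<close>

lemma cl_switch: 
  assumes "x \<in> S k" "1 \<le> k" "k \<le> D"
  shows "cl x = S k"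
proof
  show "cl x \<subseteq> S k" using cl_sub_S assms by blast
  show "S k \<subseteq> cl x"
  proof
    fix y assume y: "y \<in> S k"
    have conv: "t \<in> S k" if "y \<le> t \<and> t \<le> x \<or> x \<le> t \<and> t \<le> y" for t
    proof -
      have "\<beta> * y \<le> \<beta> * t \<and> \<beta> * t \<le> \<beta> * x \<or> \<beta> * x \<le> \<beta> * t \<and> \<beta> * t \<le> \<beta> * y"
        using that beta_pos by auto
      then show ?thesis using assms(1) y by (auto simp: mem_S)
    qed
    have left: "t \<le> y \<longleftrightarrow> t \<le> x" if "t \<in> lcuts" "x \<in> S k" "y \<in> S k"
      "\<And>t. y \<le> t \<and> t \<le> x \<or> x \<le> t \<and> t \<le> y \<Longrightarrow> t \<in> S k" for t x y
      using that(1)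
    proof (cases rule: lcuts_cases)
      case (1 i)
      then have "t \<notin> S k" using orb_E[of i] b_le[of i] ES_disjoint assms by fastforce
      then show ?thesis using that(4)[of t] by linarith
    next
      case (2 l)
      then show ?thesis using S_thresholds[of x k y l] that assms beta_pos
        by (metis mult_le_cancel_left_pos)
    qed
    moreover have "y \<le> t \<longleftrightarrow> x \<le> t" if "t \<in> rcuts" for t
    proof (rule ccontr)
      assume neg: "(y \<le> t) \<noteq> (x \<le> t)"
      then have tS: "t \<in> S k" using conv[of t] by linarith
      have "\<tau> - t \<in> lcuts" using that by (simp add: mem_rcuts)
      then show False
      proof (cases rule: lcuts_cases)
        case (1 i)
        then have "\<tau> - (\<tau> - t) \<in> E (D - b (Suc i))" "D - b (Suc i) \<le> D" using orb_E[of i] b_le[of i]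
          by (intro E_reflect) auto
        then show ?thesis using ES_disjoint[of t "D - b (Suc i)" k] tS assms by simp
      next
        case (2 l)
        define m where "m = D + 1 - l"
        have m: "1 \<le> m" "m \<le> D" "\<beta> * t = r + m"
          using 2 by (auto simp: m_def of_nat_diff right_diff_distrib beta_tau)
        then show ?thesis using S_thresholds[of x k y m] assms y neg beta_pos
          by (metis mult_le_cancel_left_pos)
      qed
    qed
    ultimately show "y \<in> cl x"
      using assms y S_sub_J[of k] conv unfolding cl_def by blast
  qed
qed

section \<open>Enumeration of the cells in increasing order\<close>

lemma finite_cells: "finite (cells \<beta> n)"
proof -
  have "cl ` J \<subseteq> (\<lambda>(A, B). {y \<in> J. (\<forall>t\<in>lcuts. t \<le> y \<longleftrightarrow> t \<in> A) \<and> (\<forall>t\<in>rcuts. y \<le> t \<longleftrightarrow> t \<in> B)})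
      ` (Pow lcuts \<times> Pow rcuts)"
  proof
    fix Z assume "Z \<in> cl ` J"
    then obtain x where "Z = cl x" by blast
    then show "Z \<in> (\<lambda>(A, B). {y \<in> J. (\<forall>t\<in>lcuts. t \<le> y \<longleftrightarrow> t \<in> A) \<and> (\<forall>t\<in>rcuts. y \<le> t \<longleftrightarrow> t \<in> B)})
      ` (Pow lcuts \<times> Pow rcuts)"
      by (intro image_eqI[of _ _ "({t\<in>lcuts. t \<le> x}, {t\<in>rcuts. x \<le> t})"]) (auto simp: cl_def)
  qed
  then show ?thesis unfolding cells_eq using finite_lcuts finite_rcuts
    by (meson finite_SigmaI finite_Pow_iff finite_imageI finite_subset)
qed

lemma cells_sub_J: "A \<in> cells \<beta> n \<Longrightarrow> A \<subseteq> J"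
  using cl_J by (auto simp: cells_eq)

lemma cells_bdd_below: "A \<in> cells \<beta> n \<Longrightarrow> bdd_below A"
  using cells_sub_J[of A] by (intro bdd_belowI[of _ 0]) (auto simp: J_eq)

text \<open>A nondegenerate interval contains all points slightly above its infimum, so two cells
  with the same infimum meet and are equal.\<close>

lemma inj_Inf_cells: "inj_on Inf (cells \<beta> n)"
proof (rule inj_onI)
  fix A B assume A: "A \<in> cells \<beta> n" and B: "B \<in> cells \<beta> n" and eq: "Inf A = Inf B"
  have *: "\<exists>v>Inf A. \<forall>y. Inf A < y \<and> y < v \<longrightarrow> y \<in> A" if A: "A \<in> cells \<beta> n" for A
  proof -
    obtain x where x: "x \<in> J" "A = cl x" using A by (auto simp: cells_eq)
    obtain u v where uv: "u < v" "u \<in> A" "v \<in> A" using cl_nondegenerate[OF x(1)] x(2) by blast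
    have "Inf A \<le> u" using uv cells_bdd_below[OF A] by (simp add: cInf_lower)
    moreover have "y \<in> A" if "Inf A < y" "y < v" for y
    proof -
      obtain w where "w \<in> A" "w < y" using cInf_lessD[OF _ \<open>Inf A < y\<close>] uv by blast
      then show ?thesis using cl_between[of w x v y] uv that x by auto
    qed
    ultimately show ?thesis using uv by (intro exI[of _ v]) auto
  qed
  obtain v w where v: "v > Inf A" "\<And>y. Inf A < y \<Longrightarrow> y < v \<Longrightarrow> y \<in> A"
    and w: "w > Inf A" "\<And>y. Inf A < y \<Longrightarrow> y < w \<Longrightarrow> y \<in> B"
    using *[OF A] *[OF B] eq by auto
  obtain y where "Inf A < y" "y < min v w" using v w dense[of "Inf A" "min v w"] by auto
  then have "y \<in> A" "y \<in> B" using v w by auto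
  then show "A = B" using A B cl_eq unfolding cells_eq by blast
qed

abbreviation "C \<equiv> cell \<beta> n"
abbreviation "N \<equiv> last_index \<beta> n"

lemma cells_nonempty: "cells \<beta> n \<noteq> {}"
  using tau_gt1 by (auto simp: cells_eq J_eq)

lemma card_cells: "card (cells \<beta> n) = Suc N"
  using cells_nonempty finite_cells by (simp add: last_index_def card_gt_0_iff)

lemma sorted_cells:
  defines "xs \<equiv> sorted_key_list_of_set Inf (cells \<beta> n)"
  shows "set xs = cells \<beta> n" "sorted (map Inf xs)" "distinct xs" "length xs = Suc N"
  unfolding xs_def using sorted_key_list_of_set_properties[OF inj_Inf_cells finite_cells] card_cells
  by auto

lemma C_cells: "j \<le> N \<Longrightarrow> C j \<in> cells \<beta> n"
  using sorted_cells by (metis cell_def le_imp_less_Suc nth_mem)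

lemma C_surj: "A \<in> cells \<beta> n \<Longrightarrow> \<exists>j\<le>N. C j = A"
  using sorted_cells by (metis cell_def in_set_conv_nth less_Suc_eq_le)

lemma C_inj: "i \<le> N \<Longrightarrow> j \<le> N \<Longrightarrow> C i = C j \<Longrightarrow> i = j"
  using nth_eq_iff_index_eq[OF sorted_cells(3)] sorted_cells(4) by (simp add: cell_def)

lemma Inf_C_mono: "i \<le> j \<Longrightarrow> j \<le> N \<Longrightarrow> Inf (C i) \<le> Inf (C j)"
  using sorted_nth_mono[OF sorted_cells(2), of i j] sorted_cells(4) by (simp add: cell_def)

lemma C_obtain:
  assumes "j \<le> N"
  obtains x where "x \<in> J" "C j = cl x"
  using C_cells[OF assms] by (auto simp: cells_eq)

lemma C_cl: "j \<le> N \<Longrightarrow> x \<in> C j \<Longrightarrow> C j = cl x"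
  using C_obtain cl_eq by metis

lemma C_J: "j \<le> N \<Longrightarrow> C j \<subseteq> J"
  using C_cells cells_sub_J by blast

lemma C_disjoint: "i \<le> N \<Longrightarrow> j \<le> N \<Longrightarrow> x \<in> C i \<Longrightarrow> x \<in> C j \<Longrightarrow> i = j"
  using C_cl C_inj by metis

lemma C_cover: "x \<in> J \<Longrightarrow> \<exists>j\<le>N. x \<in> C j"
  using C_surj[of "cl x"] cl_self by (auto simp: cells_eq)

lemma C_nondegenerate: "j \<le> N \<Longrightarrow> \<exists>u v. u < v \<and> u \<in> C j \<and> v \<in> C j"
  using C_obtain cl_nondegenerate by metis

lemma C_ivl: "j \<le> N \<Longrightarrow> u \<in> C j \<Longrightarrow> v \<in> C j \<Longrightarrow> {u..v} \<subseteq> C j"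
  using C_cl[of j u] cl_between[of u u v] by auto

lemma C_first: "C 0 = {0..r}"
proof -
  have c: "cl 0 \<in> cells \<beta> n" using tau_gt1 by (auto simp: cells_eq J_eq)
  then obtain j where j: "j \<le> N" "C j = cl 0" using C_surj by blast
  have "Inf (C 0) \<le> Inf (C j)" using Inf_C_mono[of 0 j] j(1) by simp
  also have "\<dots> = 0" using r_pos by (simp add: j cl_0)
  finally have "Inf (C 0) \<le> 0" .
  moreover have "0 \<le> Inf (C 0)"
    using C_nondegenerate[of 0] C_J[of 0] by (intro cInf_greatest) (auto simp: J_eq)
  ultimately have "Inf (C 0) = Inf (cl 0)" using r_pos by (simp add: cl_0)
  then have "C 0 = cl 0" using inj_onD[OF inj_Inf_cells] c C_cells[of 0] by blast
  then show ?thesis by (simp add: cl_0)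
qed

lemma C_last: "C N = {1..\<tau>}"
proof -
  have c: "cl \<tau> \<in> cells \<beta> n" using tau_gt1 by (auto simp: cells_eq J_eq)
  then obtain j where j: "j \<le> N" "C j = cl \<tau>" using C_surj by blast
  have "Inf (C j) = 1" using tau_gt1 by (simp add: j cl_tau)
  then have 1: "1 \<le> Inf (C N)" using j Inf_C_mono[of j N] by simp
  obtain x where x: "x \<in> C N" using C_nondegenerate[of N] by auto
  have "Inf (C N) \<le> x" using x cells_bdd_below[OF C_cells] by (simp add: cInf_lower)
  then have "x \<in> cl \<tau>" using x C_J[of N] 1 by (auto simp: cl_tau J_eq)
  then have "cl x = cl \<tau>" by (rule cl_eq)
  then show ?thesis using C_cl[of N x] x cl_tau by simp
qed

lemma C_cases:
  assumes "j \<le> N"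
  obtains k where "k \<le> D" "C j \<subseteq> E k" | k where "1 \<le> k" "k \<le> D" "C j = S k"
proof -
  obtain x where x: "C j = cl x" "x \<in> J" using C_obtain[OF assms] by blast
  from x(2) show thesis
  proof (cases rule: J_cases)
    case (1 k)
    then show thesis using that(1)[of k] cl_sub_E x(1) by simp
  next
    case (2 k)
    then show thesis using that(2)[of k] cl_switch x(1) by simp
  qed
qed

lemma C_S: "1 \<le> k \<Longrightarrow> k \<le> D \<Longrightarrow> \<exists>j\<le>N. C j = S k"
proof -
  assume k: "1 \<le> k" "k \<le> D"
  have "k / \<beta> \<in> S k" using r_pos beta_pos by (simp add: mem_S)
  then have "cl (k / \<beta>) = S k" "k / \<beta> \<in> J" using cl_switch S_sub_J k by blast+
  then show ?thesis using C_surj[of "S k"] by (auto simp: cells_eq)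
qed

lemma eq_index_iff: "j \<in> (\<Union>k\<in>{0..D}. equality_indices \<beta> n k) \<longleftrightarrow> j \<le> N \<and> (\<exists>k\<le>D. C j \<subseteq> E k)"
  by (auto simp: equality_indices_def)

lemma switch_index:
  assumes "1 \<le> k" "k \<le> D"
  shows "switch_index \<beta> n k \<le> N" "C (switch_index \<beta> n k) = S k"
proof -
  obtain j where "j \<le> N" "C j = S k" using C_S assms by blast
  then have "switch_index \<beta> n k = j" unfolding switch_index_def
    by (intro the_equality) (auto intro: C_inj)
  then show "switch_index \<beta> n k \<le> N" "C (switch_index \<beta> n k) = S k"
    using \<open>j \<le> N\<close> \<open>C j = S k\<close> by auto
qed

lemma switch_not_eq: "C j = S k \<Longrightarrow> 1 \<le> k \<Longrightarrow> k \<le> D \<Longrightarrow> l \<le> D \<Longrightarrow> \<not> C j \<subseteq> E l"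
proof
  assume *: "C j = S k" "1 \<le> k" "k \<le> D" "l \<le> D" "C j \<subseteq> E l"
  have "k / \<beta> \<in> S k" using r_pos beta_pos by (simp add: mem_S)
  then show False using ES_disjoint * by blast
qed

lemma N_pos: "0 < N"
proof (rule ccontr)
  assume "\<not> 0 < N"
  then have "{0..r} = {1..\<tau>}" using C_first C_last by simp
  moreover have "0 \<in> {0..r}" using r_pos by simp
  ultimately have "0 \<in> {1..\<tau>}" by (rule subst)
  then show False by simp
qed

end

section \<open>One step of the random map\<close>

locale coin =
  fixes p :: real
  assumes p: "0 < p" "p < 1"
begin

abbreviation "m \<equiv> bernoulli_measure p"
definition q :: "bool \<Rightarrow> real" where "q i = (if i then p else 1 - p)"

lemma q_pos: "0 < q i" and q_le1: "q i \<le> 1"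
  using p by (auto simp: q_def)

sublocale m: prob_space m
  unfolding bernoulli_measure_def by (rule prob_space.prob_space_stream_space) (rule prob_space_measure_pmf)

lemma space_m [simp]: "space m = UNIV"
  by (simp add: bernoulli_measure_def space_stream_space)

lemma sets_m [measurable_cong]: "sets m = sets (stream_space (count_space UNIV))"
  unfolding bernoulli_measure_def by (intro sets_stream_space_cong) simp

lemma coin_split:
  assumes G: "G \<in> sets m"
  shows "emeasure m {\<omega>. shd \<omega> = i \<and> stl \<omega> \<in> G} = q i * emeasure m G"
proof -
  have [measurable]: "G \<in> sets (stream_space (count_space UNIV))" using G sets_m by simp
  have "emeasure m {\<omega> \<in> space m. shd \<omega> = i \<and> stl \<omega> \<in> G} =
    (\<integral>\<^sup>+x. emeasure m {X \<in> space m. x ## X \<in> {\<omega> \<in> space m. shd \<omega> = i \<and> stl \<omega> \<in> G}} \<partial>measure_pmf (bernoulli_pmf p))"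
    unfolding bernoulli_measure_def
    by (subst prob_space.emeasure_stream_space[OF prob_space_measure_pmf]) (auto intro!: nn_integral_cong)
  also have "\<dots> = (\<integral>\<^sup>+x. emeasure m G * indicator {i} x \<partial>measure_pmf (bernoulli_pmf p))"
    by (intro nn_integral_cong) (auto split: split_indicator)
  also have "\<dots> = emeasure m G * pmf (bernoulli_pmf p) i"
    by (simp add: nn_integral_cmult emeasure_pmf_single)
  also have "pmf (bernoulli_pmf p) i = q i"
    using p by (cases i) (auto simp: q_def)
  finally show ?thesis by (simp add: mult.commute)
qed

lemma measurable_split: "G \<in> sets m \<Longrightarrow> {\<omega>. shd \<omega> = i \<and> stl \<omega> \<in> G} \<in> sets m"
proof -
  assume "G \<in> sets m"
  then have [measurable]: "G \<in> sets (stream_space (count_space UNIV))" using sets_m by simp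
  have "{\<omega> \<in> space m. shd \<omega> = i \<and> stl \<omega> \<in> G} \<in> sets m" by measurable
  then show ?thesis by simp
qed

lemma coin_split_measure:
  "G \<in> sets m \<Longrightarrow> measure m {\<omega>. shd \<omega> = i \<and> stl \<omega> \<in> G} = q i * measure m G"
  using coin_split[of G i] q_pos[of i] by (simp add: measure_def enn2real_mult)

end

context small_overlap
begin

section \<open>Normalised Lebesgue measure under the affine branches\<close>

abbreviation "lam \<equiv> leb \<beta>"

lemma tau_pos: "0 < \<tau>" using tau_gt1 by simp

lemma J_borel [measurable]: "J \<in> sets borel" by (simp add: J_eq)

lemma sets_lam_restrict [measurable_cong]: "sets lam = sets (restrict_space borel J)"
  by (simp add: leb_def sets_restrict_space)

lemma space_lam [simp]: "space lam = J"
  by (simp add: leb_def space_restrict_space)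

lemma sets_lam: "A \<in> sets lam \<longleftrightarrow> A \<in> sets borel \<and> A \<subseteq> J"
  unfolding sets_lam_restrict by (subst sets_restrict_space_iff) (auto simp: J_eq)

lemma measurable_lam: "f \<in> borel_measurable borel \<Longrightarrow> f \<in> borel_measurable lam"
  unfolding measurable_cong_sets[OF sets_lam_restrict refl] by (rule measurable_restrict_space1)

lemma emeasure_lborel_J: "emeasure lborel J = \<tau>"
  using tau_pos by (simp add: J_eq)

lemma emeasure_restrict_J: "emeasure (restrict_space lborel J) J = \<tau>"
  using emeasure_lborel_J by (subst emeasure_restrict_space) auto

sublocale lam: prob_space lam
  unfolding leb_def by (rule prob_space_uniform_measure) (use emeasure_restrict_J tau_pos in auto)

lemma nn_integral_lam:
  assumes "f \<in> borel_measurable lam"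
  shows "(\<integral>\<^sup>+x. f x \<partial>lam) = (\<integral>\<^sup>+x. f x * indicator J x \<partial>lborel) / \<tau>"
proof -
  have f: "f \<in> borel_measurable (restrict_space lborel J)"
    using assms by (simp add: leb_def cong: measurable_cong_sets)
  have "(\<integral>\<^sup>+x. f x \<partial>lam) = (\<integral>\<^sup>+x. f x * indicator J x \<partial>restrict_space lborel J) / \<tau>"
    unfolding leb_def using f by (subst nn_integral_uniform_measure) (auto simp: emeasure_restrict_J sets_restrict_space)
  also have "\<dots> = (\<integral>\<^sup>+x. f x * indicator J x * indicator J x \<partial>lborel) / \<tau>"
    by (subst nn_integral_restrict_space) auto
  finally show ?thesis by (simp add: mult.assoc indicator_inter_arith[symmetric])
qed

lemma affine_vimage_sets:
  assumes "I \<in> sets lam"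
  shows "{z\<in>J. (z + c) / \<beta> \<in> I} \<in> sets lam"
proof -
  have [measurable]: "I \<in> sets borel" using assms by (simp add: sets_lam)
  have "{z \<in> space borel. z \<in> J \<and> (z + c) / \<beta> \<in> I} \<in> sets borel" by measurable
  then show ?thesis by (simp add: sets_lam)
qed

text \<open>Change of variables for a single branch. The image of \<open>I\<close> is written as the
  preimage of \<open>I\<close> under the inverse branch, which makes its measurability
  immediate.\<close>

lemma affine_push:
  assumes I: "I \<in> sets lam" and f: "f \<in> borel_measurable lam"
    and IJ: "\<And>x. x \<in> I \<Longrightarrow> \<beta> * x - c \<in> J"
  shows "(\<integral>\<^sup>+x. f (\<beta> * x - c) * indicator I x \<partial>lam) =
    ennreal (1 / \<beta>) * (\<integral>\<^sup>+z. f z * indicator {z\<in>J. (z + c) / \<beta> \<in> I} z \<partial>lam)"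
proof -
  have I_b [measurable]: "I \<in> sets borel" and "I \<subseteq> J" using I by (auto simp: sets_lam)
  \<comment> \<open>\<open>f\<close> is measurable only on \<open>J\<close>; it is extended by
    \<open>0\<close> to the line before the substitution.\<close>
  define g where "g z = f z * indicator J z" for z
  have g [measurable]: "g \<in> borel_measurable borel"
    using f unfolding g_def
    by (subst borel_measurable_restrict_space_iff_ennreal[symmetric])
      (auto cong: measurable_cong_sets simp: sets_lam_restrict)
  have inv: "(\<beta> * x - c + c) / \<beta> = x" for x using beta_pos by simp
  have f_g: "f (\<beta> * x - c) * indicator I x = g (\<beta> * x - c) * indicator I x" for x
    using IJ[of x] by (auto simp: g_def split: split_indicator)
  have "(\<integral>\<^sup>+x. f (\<beta> * x - c) * indicator I x \<partial>lam) = (\<integral>\<^sup>+x. g (\<beta> * x - c) * indicator I x * indicator J x \<partial>lborel) / \<tau>"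
    unfolding f_g by (intro nn_integral_lam measurable_lam) measurable
  also have "(\<integral>\<^sup>+x. g (\<beta> * x - c) * indicator I x * indicator J x \<partial>lborel) =
    (\<integral>\<^sup>+x. g (- c + \<beta> * x) * indicator I ((- c + \<beta> * x + c) / \<beta>) \<partial>lborel)"
    using \<open>I \<subseteq> J\<close> beta_pos by (intro nn_integral_cong) (auto split: split_indicator)
  also have "\<dots> = ennreal (1 / \<beta>) * (\<integral>\<^sup>+z. g z * indicator I ((z + c) / \<beta>) \<partial>lborel)"
    using beta_pos
    by (subst (2) nn_integral_real_affine[where c=\<beta> and t="- c"])
      (auto simp: mult.assoc[symmetric] ennreal_mult[symmetric])
  also have "(\<integral>\<^sup>+z. g z * indicator I ((z + c) / \<beta>) \<partial>lborel) =
    (\<integral>\<^sup>+z. f z * indicator {z\<in>J. (z + c) / \<beta> \<in> I} z * indicator J z \<partial>lborel)"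
    by (intro nn_integral_cong) (auto simp: g_def split: split_indicator)
  also have "ennreal (1 / \<beta>) * \<dots> / \<tau> = ennreal (1 / \<beta>) * (\<dots> / \<tau>)"
    by (simp add: ennreal_times_divide)
  also have "(\<integral>\<^sup>+z. f z * indicator {z\<in>J. (z + c) / \<beta> \<in> I} z * indicator J z \<partial>lborel) / \<tau> =
    (\<integral>\<^sup>+z. f z * indicator {z\<in>J. (z + c) / \<beta> \<in> I} z \<partial>lam)"
    using f affine_vimage_sets[OF I, of c]
    by (intro nn_integral_lam[symmetric] borel_measurable_times_ennreal borel_measurable_indicator)
  finally show ?thesis .
qed

lemma E_sets: "k \<le> D \<Longrightarrow> E k \<in> sets lam"
  using E_sub_J by (auto simp: sets_lam equality_region_def)

lemma Eq_sets: "Eq \<in> sets lam"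
  unfolding Eq_def using E_sets by auto

lemma T_measurable: "T \<in> measurable lam lam"
proof -
  have "(\<lambda>x. \<beta> * x - real (min (nat \<lfloor>\<beta> * x\<rfloor>) D)) \<in> borel_measurable lam"
    by (rule measurable_lam) measurable
  then have "T \<in> borel_measurable lam"
    by (rule measurable_cong[THEN iffD1, rotated]) (simp add: greedy_map_def greedy_digit_floor)
  then show ?thesis
    unfolding measurable_cong_sets[OF refl sets_lam_restrict] using T_J
    by (auto intro!: measurable_restrict_space2)
qed

lemma L_measurable: "L \<in> measurable lam lam"
proof -
  have "(\<lambda>x. \<beta> * x - real (nat \<lceil>\<beta> * x - \<tau>\<rceil>)) \<in> borel_measurable lam"
    by (rule measurable_lam) measurable
  then have "L \<in> borel_measurable lam"
    by (rule measurable_cong[THEN iffD1, rotated]) (simp add: lazy_map_def lazy_digit_ceiling)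
  then show ?thesis
    unfolding measurable_cong_sets[OF refl sets_lam_restrict] using L_J
    by (auto intro!: measurable_restrict_space2)
qed

end

locale small_overlap_coin = small_overlap + coin
begin

section \<open>Product sets under one step\<close>

abbreviation "Lam \<equiv> m \<Otimes>\<^sub>M lam"

sublocale Lam: pair_prob_space m lam ..

lemma space_Lam [simp]: "space Lam = UNIV \<times> J"
  by (simp add: space_pair_measure)

lemma K_measurable: "K \<in> measurable Lam Lam"
proof -
  note [measurable] = T_measurable L_measurable Eq_sets
  have "(\<lambda>(\<omega>, x). if x \<in> Eq then (\<omega>, T x) else (stl \<omega>, if shd \<omega> then T x else L x)) \<in> measurable Lam Lam"
    by measurable
  then show ?thesis
    by (rule measurable_cong[THEN iffD1, rotated]) (auto simp: K_J)
qed

lemma Kpow_measurable: "K ^^ k \<in> measurable Lam Lam"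
proof (induction k)
  case (Suc k)
  then show ?case unfolding funpow.simps using K_measurable by (rule measurable_comp)
qed (simp add: id_def)

text \<open>Fubini over \<open>x\<close>, then \<open>affine_push\<close>. The factor
  \<open>\<kappa>\<close> is the probability of the letter that the branch requires:
  \<open>1\<close> on equality regions, \<open>q i\<close> on a switch region with first letter
  \<open>i\<close>.\<close>

lemma push_aux:
  assumes I: "I \<in> sets lam" and G: "G \<in> sets m" and G': "G' \<in> sets m" and A: "A \<in> sets Lam"
    and IJ: "\<And>x. x \<in> I \<Longrightarrow> \<beta> * x - c \<in> J" and \<kappa>: "0 \<le> \<kappa>"
    and eq: "\<And>x. x \<in> I \<Longrightarrow> emeasure m {\<omega>\<in>G. K (\<omega>, x) \<in> A} = ennreal \<kappa> * emeasure m {\<omega>\<in>G'. (\<omega>, \<beta> * x - c) \<in> A}"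
  shows "measure Lam ((G \<times> I) \<inter> K -` A) = \<kappa> / \<beta> * measure Lam ((G' \<times> {z\<in>J. (z + c) / \<beta> \<in> I}) \<inter> A)"
proof -
  let ?I = "{z\<in>J. (z + c) / \<beta> \<in> I}"
  have IJ': "I \<subseteq> J" using I by (simp add: sets_lam)
  have s1: "(G \<times> I) \<inter> K -` A \<in> sets Lam"
  proof -
    have "(G \<times> I) \<inter> (K -` A \<inter> space Lam) \<in> sets Lam"
      using G I A K_measurable by (intro sets.Int measurable_sets) auto
    moreover have "(G \<times> I) \<inter> (K -` A \<inter> space Lam) = (G \<times> I) \<inter> K -` A" using IJ' by auto
    ultimately show ?thesis by simp
  qed
  have s2: "(G' \<times> ?I) \<inter> A \<in> sets Lam"
    using affine_vimage_sets[OF I, of c] G' A by (intro sets.Int pair_measureI)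
  have s3: "(G' \<times> J) \<inter> A \<in> sets Lam"
    using sets.top[of lam] G' A by (intro sets.Int pair_measureI) auto
  define f where "f z = emeasure m {\<omega>\<in>G'. (\<omega>, z) \<in> A}" for z
  have "f \<in> borel_measurable lam \<longleftrightarrow> (\<lambda>y. emeasure m ((\<lambda>x. (x, y)) -` ((G' \<times> J) \<inter> A))) \<in> borel_measurable lam"
    unfolding f_def by (intro measurable_cong arg_cong[of _ _ "emeasure m"]) auto
  then have f: "f \<in> borel_measurable lam"
    using Lam.measurable_emeasure_Pair2[OF s3] by simp
  have "emeasure Lam ((G \<times> I) \<inter> K -` A) = (\<integral>\<^sup>+y. emeasure m ((\<lambda>x. (x, y)) -` ((G \<times> I) \<inter> K -` A)) \<partial>lam)"
    by (rule Lam.emeasure_pair_measure_alt2[OF s1])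
  also have "\<dots> = (\<integral>\<^sup>+y. ennreal \<kappa> * (f (\<beta> * y - c) * indicator I y) \<partial>lam)"
  proof (intro nn_integral_cong)
    fix y
    show "emeasure m ((\<lambda>x. (x, y)) -` ((G \<times> I) \<inter> K -` A)) = ennreal \<kappa> * (f (\<beta> * y - c) * indicator I y)"
    proof (cases "y \<in> I")
      case True
      then have "(\<lambda>x. (x, y)) -` ((G \<times> I) \<inter> K -` A) = {\<omega>\<in>G. K (\<omega>, y) \<in> A}" by auto
      then show ?thesis using True eq by (simp add: f_def)
    next
      case False
      then have "(\<lambda>x. (x, y)) -` ((G \<times> I) \<inter> K -` A) = {}" by auto
      then show ?thesis using False by simp
    qed
  qed
  also have "\<dots> = ennreal \<kappa> * (\<integral>\<^sup>+y. f (\<beta> * y - c) * indicator I y \<partial>lam)"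
  proof (rule nn_integral_cmult)
    have "(\<lambda>y. f (\<beta> * y - c) * indicator I y) \<in> borel_measurable lam \<longleftrightarrow>
       (\<lambda>y. if y \<in> I then f (\<beta> * y - c) else 0) \<in> borel_measurable lam"
      by (intro measurable_cong) (auto split: split_indicator)
    \<comment> \<open>Outside \<open>I\<close> the branch may leave \<open>J\<close>; sending those
      points to \<open>0\<close> gives a map into \<open>J\<close> and does not change the
      integrand.\<close>
    moreover have "(\<lambda>y. if y \<in> I then f (if y \<in> I then \<beta> * y - c else 0) else 0) \<in> borel_measurable lam"
    proof (rule measurable_If_set)
      have [measurable]: "I \<in> sets lam" by fact
      have m: "(\<lambda>y. if y \<in> I then \<beta> * y - c else 0) \<in> borel_measurable lam"
        by (rule measurable_If_set) (auto intro!: measurable_lam simp: I Int_absorb2[OF IJ'])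
      have "(\<lambda>y. if y \<in> I then \<beta> * y - c else 0) \<in> measurable lam lam"
        unfolding measurable_cong_sets[OF refl sets_lam_restrict]
        using m IJ tau_pos by (intro measurable_restrict_space2) (auto simp: J_eq)
      then show "(\<lambda>y. f (if y \<in> I then \<beta> * y - c else 0)) \<in> borel_measurable lam"
        using f by (rule measurable_compose)
    qed (use I in \<open>auto simp: Int_absorb2[OF IJ']\<close>)
    moreover have "(\<lambda>y. if y \<in> I then f (if y \<in> I then \<beta> * y - c else 0) else 0) =
      (\<lambda>y. if y \<in> I then f (\<beta> * y - c) else 0)" by auto
    ultimately show "(\<lambda>y. f (\<beta> * y - c) * indicator I y) \<in> borel_measurable lam" by simp
  qed
  also have "\<dots> = ennreal \<kappa> * (ennreal (1 / \<beta>) * (\<integral>\<^sup>+z. f z * indicator ?I z \<partial>lam))"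
    by (subst affine_push[OF I f IJ]) auto
  also have "(\<integral>\<^sup>+z. f z * indicator ?I z \<partial>lam) = (\<integral>\<^sup>+y. emeasure m ((\<lambda>x. (x, y)) -` ((G' \<times> ?I) \<inter> A)) \<partial>lam)"
  proof (intro nn_integral_cong)
    fix y
    show "f y * indicator ?I y = emeasure m ((\<lambda>x. (x, y)) -` ((G' \<times> ?I) \<inter> A))"
    proof (cases "y \<in> ?I")
      case True
      then have "(\<lambda>x. (x, y)) -` ((G' \<times> ?I) \<inter> A) = {\<omega>\<in>G'. (\<omega>, y) \<in> A}" by auto
      then show ?thesis using True by (simp add: f_def)
    next
      case False
      then have "(\<lambda>x. (x, y)) -` ((G' \<times> ?I) \<inter> A) = {}" by auto
      then show ?thesis using False by simp
    qed
  qed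
  also have "\<dots> = emeasure Lam ((G' \<times> ?I) \<inter> A)"
    by (rule Lam.emeasure_pair_measure_alt2[OF s2, symmetric])
  finally have "emeasure Lam ((G \<times> I) \<inter> K -` A) = ennreal (\<kappa> / \<beta>) * emeasure Lam ((G' \<times> ?I) \<inter> A)"
    using \<kappa> beta_pos by (simp add: mult.assoc[symmetric] ennreal_mult[symmetric])
  then show ?thesis using \<kappa> beta_pos by (simp add: measure_def enn2real_mult)
qed

lemma push_E:
  assumes "k \<le> D" "I \<subseteq> E k" "I \<in> sets lam" "G \<in> sets m" "A \<in> sets Lam"
  shows "measure Lam ((G \<times> I) \<inter> K -` A) = 1 / \<beta> * measure Lam ((G \<times> {z\<in>J. (z + k) / \<beta> \<in> I}) \<inter> A)"
  using assms by (intro push_aux) (auto simp: E_image K_E subset_iff)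

lemma push_S:
  assumes k: "1 \<le> k" "k \<le> D" "I \<subseteq> S k" and I: "I \<in> sets lam" and G: "G \<in> sets m" and A: "A \<in> sets Lam"
  shows "measure Lam (({\<omega>. shd \<omega> = i \<and> stl \<omega> \<in> G} \<times> I) \<inter> K -` A) =
    q i / \<beta> * measure Lam ((G \<times> {z\<in>J. (z + (real k - of_bool (\<not> i))) / \<beta> \<in> I}) \<inter> A)"
proof (rule push_aux[OF I measurable_split[OF G] G A])
  fix x assume "x \<in> I"
  then have x: "x \<in> S k" using k by auto
  show "\<beta> * x - (real k - of_bool (\<not> i)) \<in> J"
    using S_image0[OF x] S_image1[OF x] r_pos by (auto simp: J_eq)
  have s: "{\<omega>\<in>G. (\<omega>, y) \<in> A} \<in> sets m" for y
  proof -
    have "{\<omega>\<in>G. (\<omega>, y) \<in> A} = G \<inter> ((\<lambda>\<omega>. (\<omega>, y)) -` A)" by auto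
    then show ?thesis using G sets_Pair2[OF A] by auto
  qed
  have "{\<omega> \<in> {\<omega>. shd \<omega> = i \<and> stl \<omega> \<in> G}. K (\<omega>, x) \<in> A} =
    {\<omega>. shd \<omega> = i \<and> stl \<omega> \<in> {\<omega>\<in>G. (\<omega>, \<beta> * x - (real k - of_bool (\<not> i))) \<in> A}}"
    using K_S[OF k(1,2) x] by (auto simp: algebra_simps)
  then show "emeasure m {\<omega> \<in> {\<omega>. shd \<omega> = i \<and> stl \<omega> \<in> G}. K (\<omega>, x) \<in> A} =
    ennreal (q i) * emeasure m {\<omega>\<in>G. (\<omega>, \<beta> * x - (real k - of_bool (\<not> i))) \<in> A}"
    using coin_split[OF s] by simp
qed (use q_pos less_imp_le in auto)


lemma K_vimage_rect:
  "K -` (G \<times> B) \<inter> space Lam = G \<times> (T -` B \<inter> J \<inter> Eq) \<union>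
     ({\<omega>. shd \<omega> = True \<and> stl \<omega> \<in> G} \<times> (T -` B \<inter> J - Eq) \<union>
      {\<omega>. shd \<omega> = False \<and> stl \<omega> \<in> G} \<times> (L -` B \<inter> J - Eq))"
  by (auto simp: K_J split: if_splits)

lemma sets_T_vimage: "B \<in> sets lam \<Longrightarrow> T -` B \<inter> J \<in> sets lam"
  and sets_L_vimage: "B \<in> sets lam \<Longrightarrow> L -` B \<inter> J \<in> sets lam"
  using measurable_sets[OF T_measurable] measurable_sets[OF L_measurable] by simp_all

text \<open>Links the two notions of invariance: on rectangles, invariance of the product under the
  random map is the equation that defines \<open>mu\<close>. On \<open>Eq\<close> both maps agree,
  so the weights \<open>p\<close> and \<open>1 - p\<close> add up to \<open>1\<close> there.\<close>

lemma measure_K_vimage_rect: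
  assumes "prob_space \<nu>" and sets: "sets \<nu> = sets lam" and G: "G \<in> sets m" and B: "B \<in> sets lam"
  shows "measure (m \<Otimes>\<^sub>M \<nu>) (K -` (G \<times> B) \<inter> space Lam) =
    measure m G * (p * measure \<nu> (T -` B \<inter> J) + (1 - p) * measure \<nu> (L -` B \<inter> J))"
proof -
  interpret \<nu>: prob_space \<nu> by fact
  interpret P: pair_prob_space m \<nu> ..
  have rect: "measure (m \<Otimes>\<^sub>M \<nu>) (X \<times> Y) = measure m X * measure \<nu> Y" if "X \<in> sets m" "Y \<in> sets lam" for X Y
    using that sets by (simp add: measure_def \<nu>.emeasure_pair_measure_Times enn2real_mult)
  have rs: "X \<times> Y \<in> sets (m \<Otimes>\<^sub>M \<nu>)" if "X \<in> sets m" "Y \<in> sets lam" for X Y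
    using that sets by simp
  note ms = measurable_split[OF G] sets_T_vimage[OF B] sets_L_vimage[OF B] Eq_sets G
  have s1: "T -` B \<inter> J \<inter> Eq \<in> sets lam" "T -` B \<inter> J - Eq \<in> sets lam" "L -` B \<inter> J - Eq \<in> sets lam"
    using ms by auto
  have "measure (m \<Otimes>\<^sub>M \<nu>) (K -` (G \<times> B) \<inter> space Lam) =
    measure (m \<Otimes>\<^sub>M \<nu>) (G \<times> (T -` B \<inter> J \<inter> Eq)) +
     (measure (m \<Otimes>\<^sub>M \<nu>) ({\<omega>. shd \<omega> = True \<and> stl \<omega> \<in> G} \<times> (T -` B \<inter> J - Eq)) +
      measure (m \<Otimes>\<^sub>M \<nu>) ({\<omega>. shd \<omega> = False \<and> stl \<omega> \<in> G} \<times> (L -` B \<inter> J - Eq)))"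
    unfolding K_vimage_rect
    by (subst P.finite_measure_Union, (intro sets.Un rs s1 G measurable_split[OF G])+, force,
        subst P.finite_measure_Union, (intro rs s1 measurable_split[OF G])+, force, rule refl)
  also have "\<dots> = measure m G * (measure \<nu> (T -` B \<inter> J \<inter> Eq) + p * measure \<nu> (T -` B \<inter> J - Eq)
      + (1 - p) * measure \<nu> (L -` B \<inter> J - Eq))"
    by (simp only: rect[OF G s1(1)] rect[OF measurable_split[OF G] s1(2)] rect[OF measurable_split[OF G] s1(3)]
      coin_split_measure[OF G]) (simp add: q_def algebra_simps)
  also have "measure \<nu> (T -` B \<inter> J) = measure \<nu> (T -` B \<inter> J \<inter> Eq) + measure \<nu> (T -` B \<inter> J - Eq)"
    using s1 sets ms by (subst \<nu>.finite_measure_Union[symmetric]) (auto intro!: arg_cong[of _ _ "measure \<nu>"])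
  moreover have "measure \<nu> (L -` B \<inter> J) = measure \<nu> (T -` B \<inter> J \<inter> Eq) + measure \<nu> (L -` B \<inter> J - Eq)"
    using s1 sets ms L_Eq by (subst \<nu>.finite_measure_Union[symmetric]) (auto intro!: arg_cong[of _ _ "measure \<nu>"])
  ultimately show ?thesis by (simp add: algebra_simps)
qed

lemma invariant_imp_distr_K:
  assumes \<nu>: "prob_space \<nu>" and sets: "sets \<nu> = sets lam"
    and inv: "\<And>B. B \<in> sets lam \<Longrightarrow>
      measure \<nu> B = p * measure \<nu> (T -` B \<inter> J) + (1 - p) * measure \<nu> (L -` B \<inter> J)"
  shows "distr (m \<Otimes>\<^sub>M \<nu>) (m \<Otimes>\<^sub>M \<nu>) K = m \<Otimes>\<^sub>M \<nu>"
proof -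
  interpret \<nu>: prob_space \<nu> by fact
  interpret P: pair_prob_space m \<nu> ..
  have sP: "sets (m \<Otimes>\<^sub>M \<nu>) = sets Lam" using sets by (intro sets_pair_measure_cong) auto
  have spP: "space (m \<Otimes>\<^sub>M \<nu>) = space Lam" using sP by (rule sets_eq_imp_space_eq)
  have K: "K \<in> measurable (m \<Otimes>\<^sub>M \<nu>) (m \<Otimes>\<^sub>M \<nu>)"
    using K_measurable by (simp only: measurable_cong_sets[OF sP sP])
  have "m \<Otimes>\<^sub>M \<nu> = distr (m \<Otimes>\<^sub>M \<nu>) (m \<Otimes>\<^sub>M \<nu>) K"
  proof (rule pair_measure_eqI)
    fix G B assume GB: "G \<in> sets m" "B \<in> sets \<nu>"
    then have "measure (m \<Otimes>\<^sub>M \<nu>) (K -` (G \<times> B) \<inter> space (m \<Otimes>\<^sub>M \<nu>)) = measure m G * measure \<nu> B"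
      using measure_K_vimage_rect[OF \<nu> sets, of G B] inv[of B] sets by (simp add: spP)
    then show "emeasure m G * emeasure \<nu> B = emeasure (distr (m \<Otimes>\<^sub>M \<nu>) (m \<Otimes>\<^sub>M \<nu>) K) (G \<times> B)"
      using K GB by (simp add: emeasure_distr P.emeasure_eq_measure m.emeasure_eq_measure
          \<nu>.emeasure_eq_measure ennreal_mult)
  qed (auto intro: m.sigma_finite_measure_axioms \<nu>.sigma_finite_measure_axioms)
  then show ?thesis by simp
qed

end

section \<open>The Markov chain of cells\<close>

locale greedy_coin = finite_greedy + coin

sublocale greedy_coin \<subseteq> small_overlap_coin \<beta> p ..

context greedy_coin
begin

abbreviation "P \<equiv> trans_prob \<beta> p n"
definition wt :: "nat \<Rightarrow> real" where "wt j = measure lam (C j)"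

lemma C_sets [measurable]: "j \<le> N \<Longrightarrow> C j \<in> sets lam"
proof -
  assume j: "j \<le> N"
  have "is_interval (C j)" unfolding is_interval_1 using C_ivl[OF j] by fastforce
  then show ?thesis using C_J[OF j] by (simp add: sets_lam real_interval_borel_measurable)
qed

lemma measure_rect:
  "G \<in> sets m \<Longrightarrow> I \<in> sets lam \<Longrightarrow> measure Lam (G \<times> I) = measure m G * measure lam I"
  by (simp add: measure_def lam.emeasure_pair_measure_Times enn2real_mult)

lemma measure_UNIV_m [simp]: "measure m UNIV = 1"
  using m.prob_space by simp

lemma UNIV_sets_m [simp]: "UNIV \<in> sets m"
  using sets.top[of m] by simp

lemma measure_cyl: "j \<le> N \<Longrightarrow> measure Lam (UNIV \<times> C j) = wt j"
  using measure_rect[of UNIV "C j"] C_sets by (simp add: wt_def)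

lemma emeasure_lam:
  assumes "A \<in> sets lam"
  shows "emeasure lam A = emeasure lborel A / \<tau>"
proof -
  have "emeasure lam A = (\<integral>\<^sup>+x. indicator A x \<partial>lam)" using assms by simp
  also have "\<dots> = (\<integral>\<^sup>+x. indicator A x * indicator J x \<partial>lborel) / \<tau>"
    using assms by (intro nn_integral_lam) simp
  also have "(\<integral>\<^sup>+x. indicator A x * indicator J x \<partial>lborel) = (\<integral>\<^sup>+x. indicator A x \<partial>lborel)"
    using assms by (intro nn_integral_cong) (auto simp: sets_lam split: split_indicator)
  finally show ?thesis using assms by (simp add: sets_lam)
qed

lemma wt_pos: "j \<le> N \<Longrightarrow> 0 < wt j"
proof -
  assume j: "j \<le> N"
  obtain u v where uv: "u < v" "u \<in> C j" "v \<in> C j" using C_nondegenerate[OF j] by blast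
  then have sub: "{u..v} \<subseteq> C j" using C_ivl j by blast
  have "{u..v} \<in> sets lam" using sub C_J[OF j] by (auto simp: sets_lam)
  then have "emeasure lam {u..v} = ennreal (v - u) / ennreal \<tau>" using uv by (simp add: emeasure_lam)
  also have "\<dots> = ennreal ((v - u) / \<tau>)" using uv tau_pos by (simp add: divide_ennreal)
  finally have "measure lam {u..v} = (v - u) / \<tau>" using uv tau_pos by (simp add: measure_def)
  moreover have "measure lam {u..v} \<le> wt j" unfolding wt_def
    using sub j by (intro lam.finite_measure_mono) auto
  moreover have "0 < (v - u) / \<tau>" using uv tau_pos by simp
  ultimately show ?thesis by linarith
qed

section \<open>Transition probabilities between cells\<close>

lemma union_cells_measure:
  assumes U: "\<And>l. l \<le> N \<Longrightarrow> C l \<subseteq> U \<or> C l \<inter> U = {}" and UJ: "U \<subseteq> J"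
    and G: "G \<in> sets m" and A: "A \<in> sets Lam"
  shows "measure Lam ((G \<times> U) \<inter> A) = (\<Sum>l\<le>N. of_bool (C l \<subseteq> U) * measure Lam ((G \<times> C l) \<inter> A))"
proof -
  define B where "B l = (if C l \<subseteq> U then (G \<times> C l) \<inter> A else {})" for l
  have UC: "U = (\<Union>l\<in>{l. l \<le> N \<and> C l \<subseteq> U}. C l)"
  proof
    show "U \<subseteq> (\<Union>l\<in>{l. l \<le> N \<and> C l \<subseteq> U}. C l)"
    proof
      fix x assume "x \<in> U"
      then obtain l where "l \<le> N" "x \<in> C l" using UJ C_cover by blast
      then show "x \<in> (\<Union>l\<in>{l. l \<le> N \<and> C l \<subseteq> U}. C l)" using U[of l] \<open>x \<in> U\<close> by blast
    qed
  qed auto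
  have un: "(G \<times> U) \<inter> A = (\<Union>l\<in>{..N}. B l)"
    by (subst UC) (auto simp: B_def split: if_splits)
  have "measure Lam (\<Union>l\<in>{..N}. B l) = (\<Sum>l\<in>{..N}. measure Lam (B l))"
  proof (rule Lam.finite_measure_finite_Union)
    show "B ` {..N} \<subseteq> sets Lam" using G A by (auto simp: B_def)
    show "disjoint_family_on B {..N}" using C_disjoint
      by (fastforce simp: disjoint_family_on_def B_def split: if_splits)
  qed auto
  also have "\<dots> = (\<Sum>l\<le>N. of_bool (C l \<subseteq> U) * measure Lam ((G \<times> C l) \<inter> A))"
    by (intro sum.cong) (auto simp: B_def)
  finally show ?thesis by (simp add: un)
qed

text \<open>For \<open>C j \<subseteq> E k\<close> this is the image of the cell under
  \<open>\<beta> * x - k\<close>, in the form in which \<open>push_E\<close> produces it.\<close>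

definition img :: "nat \<Rightarrow> nat \<Rightarrow> real set" where
  "img j k = {z\<in>J. (z + real k) / \<beta> \<in> C j}"

lemma img_union:
  assumes j: "j \<le> N" "k \<le> D" "C j \<subseteq> E k" and l: "l \<le> N"
  shows "C l \<subseteq> img j k \<or> C l \<inter> img j k = {}"
proof (cases "C l \<inter> img j k = {}")
  case False
  then obtain z where z: "z \<in> C l" "z \<in> J" "(z + real k) / \<beta> \<in> C j" by (auto simp: img_def)
  define x where "x = (z + real k) / \<beta>"
  have x: "x \<in> C j" "\<beta> * x - k = z" using z beta_pos by (auto simp: x_def)
  have "C l \<subseteq> img j k"
  proof
    fix y assume "y \<in> C l"
    then have "y \<in> cl (\<beta> * x - k)" "y \<in> J" using C_cl[OF l z(1)] x C_J[OF l] by auto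
    then have "(y + k) / \<beta> \<in> cl x" using cl_markov[of x k y] x j by auto
    then show "y \<in> img j k" using C_cl[OF j(1) x(1)] \<open>y \<in> J\<close> by (simp add: img_def)
  qed
  then show ?thesis ..
qed auto

text \<open>By the Markov property the part of \<open>C j\<close> that is mapped into
  \<open>C l\<close> is either empty or a copy of all of \<open>C l\<close>, shrunk by
  \<open>\<beta>\<close>.\<close>

lemma P_eq:
  assumes j: "j \<le> N" "k \<le> D" "C j \<subseteq> E k" and l: "l \<le> N"
  shows "P j l = of_bool (C l \<subseteq> img j k) * wt l / (\<beta> * wt j)"
proof -
  have "j \<in> (\<Union>k\<in>{0..D}. equality_indices \<beta> n k)" unfolding eq_index_iff using j by blast
  then have "P j l = measure lam (C j \<inter> (T -` C l \<inter> J)) / wt j"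
    by (simp only: trans_prob_def if_True wt_def)
  also have "measure lam (C j \<inter> (T -` C l \<inter> J)) = measure Lam (UNIV \<times> (C j \<inter> (T -` C l \<inter> J)))"
    using measure_rect[of UNIV "C j \<inter> (T -` C l \<inter> J)"] sets_T_vimage C_sets j l by auto
  also have "UNIV \<times> (C j \<inter> (T -` C l \<inter> J)) = (UNIV \<times> C j) \<inter> K -` (UNIV \<times> C l)"
    using j C_J[OF j(1)] K_E[of k] T_E[of k] by (auto simp: subset_iff)
  also have "measure Lam \<dots> = 1 / \<beta> * measure Lam ((UNIV \<times> img j k) \<inter> (UNIV \<times> C l))"
    unfolding img_def using j l C_sets by (intro push_E) auto
  also have "measure Lam ((UNIV \<times> img j k) \<inter> (UNIV \<times> C l)) = of_bool (C l \<subseteq> img j k) * wt l"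
  proof (cases "C l \<subseteq> img j k")
    case True
    then have eq: "(UNIV \<times> img j k) \<inter> (UNIV \<times> C l) = UNIV \<times> C l" by auto
    show ?thesis unfolding eq using True measure_cyl l by simp
  next
    case False
    then have "C l \<inter> img j k = {}" using img_union assms by blast
    then have eq: "(UNIV \<times> img j k) \<inter> (UNIV \<times> C l) = {}" by auto
    show ?thesis unfolding eq using False by simp
  qed
  finally show ?thesis by simp
qed

text \<open>After division by the weights of the cells the scaling by \<open>1 / \<beta>\<close>
  becomes the transition probability. \<open>G\<close> is arbitrary, because \<open>\<omega>\<close>
  is untouched on equality regions.\<close>

lemma chain_E:
  assumes j: "j \<le> N" "k \<le> D" "C j \<subseteq> E k" and G: "G \<in> sets m" and A: "A \<in> sets Lam"
  shows "measure Lam ((G \<times> C j) \<inter> K -` A) = wt j * (\<Sum>l\<le>N. P j l * (measure Lam ((G \<times> C l) \<inter> A) / wt l))"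
proof -
  have "measure Lam ((G \<times> C j) \<inter> K -` A) = 1 / \<beta> * measure Lam ((G \<times> img j k) \<inter> A)"
    unfolding img_def using j G A C_sets by (intro push_E) auto
  also have "measure Lam ((G \<times> img j k) \<inter> A) = (\<Sum>l\<le>N. of_bool (C l \<subseteq> img j k) * measure Lam ((G \<times> C l) \<inter> A))"
    using img_union[OF j] G A by (intro union_cells_measure) (auto simp: img_def)
  also have "1 / \<beta> * \<dots> = (\<Sum>l\<le>N. wt j * (P j l * (measure Lam ((G \<times> C l) \<inter> A) / wt l)))"
    unfolding sum_distrib_left
  proof (rule sum.cong)
    fix l assume "l \<in> {..N}"
    then have l: "l \<le> N" by simp
    show "1 / \<beta> * (of_bool (C l \<subseteq> img j k) * measure Lam ((G \<times> C l) \<inter> A)) =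
      wt j * (P j l * (measure Lam ((G \<times> C l) \<inter> A) / wt l))"
      using wt_pos[OF l] wt_pos[OF j(1)] by (simp add: P_eq[OF j l] field_simps)
  qed simp
  finally show ?thesis by (simp add: sum_distrib_left)
qed

abbreviation "goal i \<equiv> if i then 0 else N"

lemma chain_S:
  assumes j: "j \<le> N" "1 \<le> k" "k \<le> D" "C j = S k" and G: "G \<in> sets m" and A: "A \<in> sets Lam"
  shows "measure Lam (({\<omega>. shd \<omega> = i \<and> stl \<omega> \<in> G} \<times> C j) \<inter> K -` A) =
    q i / \<beta> * measure Lam ((G \<times> C (goal i)) \<inter> A)"
proof -
  have eq: "{z\<in>J. (z + (real k - of_bool (\<not> i))) / \<beta> \<in> C j} = C (goal i)"
    using beta_pos r_pos unfolding j mem_S by (auto simp: C_first C_last J_eq)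
  have "C j \<subseteq> S k" using j by simp
  from push_S[OF j(2,3) this C_sets[OF j(1)] G A, of i] show ?thesis unfolding eq .
qed

text \<open>Conservation of mass: \<open>chain_S\<close> is evaluated on the whole space, so no
  lengths are computed.\<close>

lemma wt_switch:
  assumes j: "j \<le> N" "1 \<le> k" "k \<le> D" "C j = S k"
  shows "wt (goal i) = \<beta> * wt j"
proof -
  have A: "UNIV \<times> J \<in> sets Lam" using sets.top[of Lam] by simp
  have "({\<omega>. shd \<omega> = i \<and> stl \<omega> \<in> UNIV} \<times> C j) \<inter> K -` (UNIV \<times> J) = {\<omega>. shd \<omega> = i \<and> stl \<omega> \<in> UNIV} \<times> C j"
    using measurable_space[OF K_measurable] C_J[OF j(1)] by auto
  moreover have "((UNIV :: bool stream set) \<times> C (goal i)) \<inter> (UNIV \<times> J) = UNIV \<times> C (goal i)"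
    using C_J[of "goal i"] by auto
  ultimately have "measure Lam ({\<omega>. shd \<omega> = i \<and> stl \<omega> \<in> UNIV} \<times> C j) = q i / \<beta> * wt (goal i)"
    using chain_S[OF j UNIV_sets_m A, of i] measure_cyl[of "goal i"] by simp
  moreover have "measure Lam ({\<omega>. shd \<omega> = i \<and> stl \<omega> \<in> UNIV} \<times> C j) = q i * wt j"
    using measure_rect[OF measurable_split[OF UNIV_sets_m] C_sets[OF j(1)], of i] coin_split_measure[OF UNIV_sets_m, of i]
    by (simp add: wt_def)
  ultimately show ?thesis using q_pos[of i] beta_pos by (simp add: field_simps)
qed

lemma P_switch:
  assumes j: "j \<le> N" "1 \<le> k" "k \<le> D" "C j = S k"
  shows "P j l = (if l = 0 then p else if l = N then 1 - p else 0)"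
proof -
  have "j \<notin> (\<Union>k\<in>{0..D}. equality_indices \<beta> n k)"
    unfolding eq_index_iff using switch_not_eq j by blast
  moreover have "j = switch_index \<beta> n k" using switch_index j C_inj by metis
  ultimately show ?thesis using j unfolding trans_prob_def by (simp only: if_False) auto
qed

lemma sum_P_switch:
  assumes j: "j \<le> N" "1 \<le> k" "k \<le> D" "C j = S k"
  shows "(\<Sum>l\<le>N. P j l * f l) = p * f 0 + (1 - p) * f N"
proof -
  have "(\<Sum>l\<le>N. P j l * f l) = (\<Sum>l\<in>{0,N}. P j l * f l)"
    by (rule sum.mono_neutral_right) (auto simp: P_switch[OF j])
  then show ?thesis using N_pos by (simp add: P_switch[OF j])
qed

text \<open>The first factor has to be the full sequence space: at a switch cell the two first
  letters are summed, and \<open>P\<close> records their probabilities.\<close>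

lemma chain:
  assumes j: "j \<le> N" and A: "A \<in> sets Lam"
  shows "measure Lam ((UNIV \<times> C j) \<inter> K -` A) =
    wt j * (\<Sum>l\<le>N. P j l * (measure Lam ((UNIV \<times> C l) \<inter> A) / wt l))"
  using j
proof (cases rule: C_cases)
  case (1 k)
  then show ?thesis using chain_E j A by simp
next
  case (2 k)
  have sK: "K -` A \<inter> space Lam \<in> sets Lam" using K_measurable A by (rule measurable_sets)
  have eqs: "(X \<times> C j) \<inter> K -` A = (X \<times> C j) \<inter> (K -` A \<inter> space Lam)" for X
    using C_J[OF j] by auto
  let ?B = "\<lambda>i. ({\<omega>. shd \<omega> = i \<and> stl \<omega> \<in> UNIV} \<times> C j) \<inter> K -` A"
  have B: "?B i \<in> sets Lam" for i
    unfolding eqs by (rule sets.Int[OF pair_measureI[OF measurable_split[OF UNIV_sets_m] C_sets[OF j]] sK])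
  have eq: "(UNIV \<times> C j) \<inter> K -` A = ?B True \<union> ?B False" by auto
  have "measure Lam ((UNIV \<times> C j) \<inter> K -` A) = measure Lam (?B True) + measure Lam (?B False)"
    unfolding eq by (rule Lam.finite_measure_Union[OF B B], auto)
  also have "\<dots> = p / \<beta> * measure Lam ((UNIV \<times> C 0) \<inter> A) + (1 - p) / \<beta> * measure Lam ((UNIV \<times> C N) \<inter> A)"
    using chain_S[OF j 2 UNIV_sets_m A, of True] chain_S[OF j 2 UNIV_sets_m A, of False] by (simp add: q_def)
  also have "\<dots> = wt j * (p * (measure Lam ((UNIV \<times> C 0) \<inter> A) / wt 0) + (1 - p) * (measure Lam ((UNIV \<times> C N) \<inter> A) / wt N))"
    using wt_switch[OF j 2, of True] wt_switch[OF j 2, of False] wt_pos[OF j] beta_pos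
    by (simp add: field_simps)
  finally show ?thesis unfolding sum_P_switch[OF j 2] .
qed

lemma P_ge0:
  assumes "j \<le> N" "l \<le> N"
  shows "0 \<le> P j l"
  using assms(1)
proof (cases rule: C_cases)
  case (1 k)
  then show ?thesis using P_eq[of j k l] wt_pos[of j] wt_pos[of l] beta_pos assms by simp
next
  case (2 k)
  then show ?thesis using P_switch[OF assms(1) 2] p by simp
qed

text \<open>Conservation of mass again: \<open>chain\<close> evaluated on the whole space.\<close>

lemma P_row: "j \<le> N \<Longrightarrow> (\<Sum>l\<le>N. P j l) = 1"
proof -
  assume j: "j \<le> N"
  have A: "UNIV \<times> J \<in> sets Lam" using sets.top[of Lam] by simp
  have c: "((UNIV :: bool stream set) \<times> C l) \<inter> (UNIV \<times> J) = UNIV \<times> C l" if "l \<le> N" for l using C_J[OF that] by auto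
  have "(UNIV \<times> C j) \<inter> K -` (UNIV \<times> J) = UNIV \<times> C j"
    using measurable_space[OF K_measurable] C_J[OF j] by auto
  then have "wt j = wt j * (\<Sum>l\<le>N. P j l * (measure Lam ((UNIV \<times> C l) \<inter> (UNIV \<times> J)) / wt l))"
    using chain[OF j A] measure_cyl[OF j] by simp
  also have "(\<Sum>l\<le>N. P j l * (measure Lam ((UNIV \<times> C l) \<inter> (UNIV \<times> J)) / wt l)) = (\<Sum>l\<le>N. P j l)"
    using wt_pos measure_cyl c by (intro sum.cong) (simp_all add: less_imp_neq[symmetric])
  finally show ?thesis using wt_pos[OF j] by simp
qed

text \<open>From \<open>\<beta> * r < 1\<close> the first cell lies in \<open>E 0\<close>, and the
  fixed point \<open>0\<close> makes its image meet, hence contain, the cell itself.\<close>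

lemma P_00: "0 < P 0 0"
proof -
  have z: "0 \<in> C 0" using r_pos by (simp add: C_first)
  have E0: "C 0 \<subseteq> E 0"
  proof
    fix x assume "x \<in> C 0"
    then have x: "0 \<le> x" "x \<le> r" by (auto simp: C_first)
    then have "\<beta> * x \<le> \<beta> * r" using beta_pos by simp
    then show "x \<in> E 0" using x beta_r by (simp add: mem_E)
  qed
  have "0 \<in> img 0 0" using z tau_pos by (simp add: img_def J_eq)
  then have "C 0 \<subseteq> img 0 0" using img_union[of 0 0 0] E0 z by auto
  then show ?thesis using P_eq[of 0 0 0] E0 wt_pos[of 0] beta_pos by simp
qed

section \<open>Reachability of the switch regions and of the first cell\<close>

abbreviation "edges \<equiv> {(i, j). i \<le> N \<and> j \<le> N \<and> 0 < P i j}"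
definition "switches = {j. j \<le> N \<and> (\<exists>k. 1 \<le> k \<and> k \<le> D \<and> C j = S k)}"

text \<open>Otherwise the iterated images of a cell would stay inside the equality regions, where intervals
  are stretched by the factor \<open>\<beta>\<close>.\<close>

lemma reach_switch:
  assumes j: "j \<le> N"
  shows "\<exists>s\<in>switches. (j, s) \<in> edges\<^sup>*"
proof (rule ccontr)
  assume "\<not> (\<exists>s\<in>switches. (j, s) \<in> edges\<^sup>*)"
  then have no: "s \<notin> switches" if "(j, s) \<in> edges\<^sup>*" for s using that by blast
  have RN: "s \<le> N" if "(j, s) \<in> edges\<^sup>*" for s
    using that j by (induction rule: rtrancl_induct) auto
  \<comment> \<open>The union of all cells reachable from \<open>j\<close>; it is mapped into itself
    by the branches and misses every switch region.\<close>
  define V where "V = (\<Union>s\<in>{s. (j, s) \<in> edges\<^sup>*}. C s)"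
  have VE: "\<exists>k\<le>D. x \<in> E k \<and> \<beta> * x - k \<in> V" if x: "x \<in> V" for x
  proof -
    obtain s where s: "(j, s) \<in> edges\<^sup>*" "x \<in> C s" using x by (auto simp: V_def)
    have sN: "s \<le> N" using RN s by blast
    from sN obtain k where k: "k \<le> D" "C s \<subseteq> E k"
    proof (cases rule: C_cases)
      case (1 k)
      then show ?thesis using that by blast
    next
      case (2 k)
      then have "s \<in> switches" using sN unfolding switches_def by blast
      then show ?thesis using no[OF s(1)] by blast
    qed
    have xE: "x \<in> E k" using s k by blast
    then have zJ: "\<beta> * x - k \<in> J" using E_image k by blast
    then obtain l where l: "l \<le> N" "\<beta> * x - k \<in> C l" using C_cover by blast
    have "(\<beta> * x - k + k) / \<beta> = x" using beta_pos by simp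
    then have "\<beta> * x - k \<in> img s k" using s zJ by (simp add: img_def)
    then have "C l \<subseteq> img s k" using img_union[OF sN k l(1)] l by blast
    then have "0 < P s l" using P_eq[OF sN k l(1)] wt_pos l(1) sN beta_pos by simp
    then have "(j, l) \<in> edges\<^sup>*" using s sN l by (auto intro: rtrancl_into_rtrancl)
    then have "\<beta> * x - k \<in> V" using l by (auto simp: V_def)
    then show ?thesis using k xE by blast
  qed
  have V_Eq: "V \<subseteq> Eq" using VE by (auto simp: Eq_def)
  have grow: "\<exists>a' b'. b' - a' = \<beta> * (b - a) \<and> {a'..b'} \<subseteq> V" if ab: "a \<le> b" "{a..b} \<subseteq> V" for a b
  proof -
    have "a \<in> V" "b \<in> V" using ab by auto
    then obtain k l where k: "k \<le> D" "a \<in> E k" and l: "l \<le> D" "b \<in> E l" using VE by meson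
    \<comment> \<open>If the ends were in different equality regions, the left end of a switch
      region would lie between them and therefore in \<open>V\<close>; the reverse order of the
      regions contradicts \<open>a \<le> b\<close>.\<close>
    have "k = l"
    proof (rule ccontr)
      assume "k \<noteq> l"
      then consider "k < l" | "l < k" by linarith
      then show False
      proof cases
        case 1
        have "\<beta> * a < k + 1" "r + l < \<beta> * b" using k l 1 by (auto simp: mem_E)
        moreover have "real k + 1 \<le> l" using 1 by linarith
        ultimately have "\<beta> * a \<le> l" "l \<le> \<beta> * b" using r_pos by linarith+
        then have "a \<le> l / \<beta>" "l / \<beta> \<le> b" using beta_pos by (auto simp: field_simps)
        then have "l / \<beta> \<in> Eq" using ab V_Eq by auto
        moreover have "l / \<beta> \<in> S l" using beta_pos r_pos by (simp add: mem_S)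
        ultimately show False using S_not_Eq[of "l / \<beta>" l] 1 l by auto
      next
        case 2
        have "\<beta> * b < l + 1" "r + k < \<beta> * a" using k l 2 by (auto simp: mem_E)
        moreover have "real l + 1 \<le> k" using 2 by linarith
        moreover have "\<beta> * a \<le> \<beta> * b" using ab beta_pos by simp
        ultimately show False using r_pos by linarith
      qed
    qed
    have "{\<beta> * a - k..\<beta> * b - k} \<subseteq> V"
    proof
      fix z assume z: "z \<in> {\<beta> * a - k..\<beta> * b - k}"
      define x where "x = (z + k) / \<beta>"
      have x: "\<beta> * x = z + k" using beta_pos by (simp add: x_def)
      have "\<beta> * a \<le> \<beta> * x" "\<beta> * x \<le> \<beta> * b" using z x by auto
      then have xab: "x \<in> {a..b}" using beta_pos by simp
      then obtain k' where k': "k' \<le> D" "x \<in> E k'" "\<beta> * x - k' \<in> V" using VE ab by blast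
      have "x \<in> E k"
        using \<open>\<beta> * a \<le> \<beta> * x\<close> \<open>\<beta> * x \<le> \<beta> * b\<close> k l \<open>k = l\<close> xab by (auto simp: mem_E)
      then have "k' = k" using k' k EE_unique by blast
      then show "z \<in> V" using k' x by simp
    qed
    then show ?thesis by (intro exI[of _ "\<beta> * a - k"] exI[of _ "\<beta> * b - k"]) (simp add: right_diff_distrib)
  qed
  obtain u v where uv: "u < v" "u \<in> C j" "v \<in> C j" using C_nondegenerate[OF j] by blast
  have "{u..v} \<subseteq> V" using C_ivl[OF j uv(2,3)] by (auto simp: V_def)
  have it: "\<exists>a b. b - a = \<beta> ^ i * (v - u) \<and> {a..b} \<subseteq> V" for i
  proof (induction i)
    case 0
    then show ?case using \<open>{u..v} \<subseteq> V\<close> by auto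
  next
    case (Suc i)
    then obtain a b where ab: "b - a = \<beta> ^ i * (v - u)" "{a..b} \<subseteq> V" by blast
    have "0 \<le> \<beta> ^ i * (v - u)" using uv beta_pos by simp
    then have "a \<le> b" using ab by linarith
    then obtain a' b' where "b' - a' = \<beta> * (b - a)" "{a'..b'} \<subseteq> V" using grow ab by blast
    then show ?case using ab by (intro exI[of _ a'] exI[of _ b']) (simp add: mult.assoc)
  qed
  \<comment> \<open>After \<open>i\<close> steps the stretched interval would be longer than
    \<open>J\<close>, whose length is \<open>\<tau>\<close>.\<close>
  obtain i where i: "\<tau> / (v - u) < \<beta> ^ i" using real_arch_pow[OF beta_gt1] by blast
  obtain a b where ab: "b - a = \<beta> ^ i * (v - u)" "{a..b} \<subseteq> V" using it by blast
  have "0 \<le> \<beta> ^ i * (v - u)" using uv beta_pos by simp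
  then have "a \<in> V" "b \<in> V" using ab by auto
  then have "0 \<le> a" "b \<le> \<tau>" using V_Eq Eq_sub_J by (auto simp: J_eq)
  then have "\<beta> ^ i * (v - u) \<le> \<tau>" using ab by linarith
  then show False using i uv by (simp add: field_simps)
qed

lemma reach_0: "j \<le> N \<Longrightarrow> (j, 0) \<in> edges\<^sup>*"
proof -
  assume "j \<le> N"
  then obtain s where s: "s \<in> switches" "(j, s) \<in> edges\<^sup>*" using reach_switch by blast
  then obtain k where k: "s \<le> N" "1 \<le> k" "k \<le> D" "C s = S k" by (auto simp: switches_def)
  then have "(s, 0) \<in> edges" using P_switch[OF k, of 0] p by simp
  then show ?thesis using s by (auto intro: rtrancl_into_rtrancl)
qed

sublocale chain: stochastic_matrix P N
  by standard (use P_ge0 P_row P_00 reach_0 in auto)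

section \<open>The stationary distribution as a probability mass function\<close>

definition \<pi> :: "nat \<Rightarrow> real" where "\<pi> = pmf (stationary_dist \<beta> p n)"

lemma stationary_pi: "chain.stationary \<pi>"
proof -
  let ?Q = "\<lambda>q. set_pmf q \<subseteq> {0..N} \<and> (\<forall>j\<in>{0..N}. pmf q j = (\<Sum>i=0..N. pmf q i * P i j))"
  have Q: "?Q q \<longleftrightarrow> set_pmf q \<subseteq> {..N} \<and> chain.stationary (pmf q)" for q
  proof -
    have "sum (pmf q) {..N} = 1" if "set_pmf q \<subseteq> {..N}"
      using that by (simp add: sum_pmf_eq_1)
    then show ?thesis by (auto simp: chain.stationary_def atLeast0AtMost)
  qed
  obtain \<rho> where \<rho>: "chain.stationary \<rho>" using chain.stationary_exists by blast
  \<comment> \<open>A mass function lives on all natural numbers, so the stationary vector is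
    extended by \<open>0\<close> beyond \<open>N\<close>.\<close>
  define f where "f j = (if j \<le> N then \<rho> j else 0)" for j
  have f0: "0 \<le> f j" for j using \<rho> by (auto simp: f_def chain.stationary_def)
  have "(\<integral>\<^sup>+x. ennreal (f x) \<partial>count_space UNIV) = (\<Sum>x\<le>N. ennreal (f x))"
    by (rule nn_integral_count_space'[of "{..N}"]) (auto simp: f_def)
  also have "\<dots> = 1" using \<rho> f0 by (subst sum_ennreal) (auto simp: f_def chain.stationary_def)
  finally have pf: "pmf (embed_pmf f) j = f j" for j using pmf_embed_pmf[of f j] f0 by simp
  have "?Q (embed_pmf f)" unfolding Q
  proof
    show "set_pmf (embed_pmf f) \<subseteq> {..N}" by (auto simp: set_pmf_eq pf f_def split: if_splits)
    have e: "pmf (embed_pmf f) j = \<rho> j" if "j \<le> N" for j using that by (simp add: pf f_def)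
    have "sum (pmf (embed_pmf f)) {..N} = sum \<rho> {..N}" by (intro sum.cong) (auto simp: e)
    moreover have "(\<Sum>i\<le>N. pmf (embed_pmf f) i * P i j) = (\<Sum>i\<le>N. \<rho> i * P i j)" for j
      by (intro sum.cong) (auto simp: e)
    ultimately show "chain.stationary (pmf (embed_pmf f))" using \<rho> e
      unfolding chain.stationary_def by metis
  qed
  moreover have "q = q'" if "?Q q" "?Q q'" for q q'
  proof (rule pmf_eqI)
    fix j
    show "pmf q j = pmf q' j"
    proof (cases "j \<le> N")
      case True
      then show ?thesis using that unfolding Q by (auto intro: chain.stationary_unique)
    next
      case False
      then have "j \<notin> set_pmf q" "j \<notin> set_pmf q'" using that by auto
      then show ?thesis by (simp add: set_pmf_iff)
    qed
  qed
  ultimately have "\<exists>!q. ?Q q" by blast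
  then have "?Q (stationary_dist \<beta> p n)" unfolding stationary_dist_def by (rule theI')
  then show ?thesis unfolding Q by (simp add: \<pi>_def)
qed

end

section \<open>The defect from uniform mixing\<close>

text \<open>Used over \<open>lam\<close> for the measure of the theorem and over \<open>Lam\<close>
  for its product with the coin measure; both densities are constant on cells.\<close>

lemma (in prob_space) emeasure_density_step:
  assumes I: "finite I" "\<And>i. i \<in> I \<Longrightarrow> B i \<in> sets M" and c: "\<And>i. i \<in> I \<Longrightarrow> 0 \<le> c i"
    and A: "A \<in> sets M"
  shows "emeasure (density M (\<lambda>x. ennreal (\<Sum>i\<in>I. c i * indicator (B i) x))) A =
    ennreal (\<Sum>i\<in>I. c i * prob (B i \<inter> A))"
proof -
  have "emeasure (density M (\<lambda>x. ennreal (\<Sum>i\<in>I. c i * indicator (B i) x))) A =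
    (\<integral>\<^sup>+x. ennreal (\<Sum>i\<in>I. c i * indicator (B i) x) * indicator A x \<partial>M)"
    using I A by (intro emeasure_density measurable_compose[OF _ measurable_ennreal] borel_measurable_sum) auto
  also have "\<dots> = (\<integral>\<^sup>+x. (\<Sum>i\<in>I. ennreal (c i) * indicator (B i \<inter> A) x) \<partial>M)"
  proof (intro nn_integral_cong)
    fix x
    have "ennreal (\<Sum>i\<in>I. c i * indicator (B i) x) = (\<Sum>i\<in>I. ennreal (c i * indicator (B i) x))"
      using c by (intro sum_ennreal[symmetric]) auto
    also have "\<dots> = (\<Sum>i\<in>I. ennreal (c i) * indicator (B i) x)"
      by (intro sum.cong) (auto split: split_indicator)
    finally show "ennreal (\<Sum>i\<in>I. c i * indicator (B i) x) * indicator A x =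
      (\<Sum>i\<in>I. ennreal (c i) * indicator (B i \<inter> A) x)"
      by (simp add: sum_distrib_right indicator_inter_arith mult.assoc)
  qed
  also have "\<dots> = (\<Sum>i\<in>I. ennreal (c i) * emeasure M (B i \<inter> A))"
    using I A by (subst nn_integral_sum) (auto simp: nn_integral_cmult_indicator)
  also have "\<dots> = ennreal (\<Sum>i\<in>I. c i * prob (B i \<inter> A))"
    using c by (subst sum_ennreal[symmetric]) (auto simp: emeasure_eq_measure ennreal_mult intro!: sum.cong)
  finally show ?thesis .
qed

context greedy_coin
begin

section \<open>The invariant measure with density constant on cells\<close>

definition h :: "real \<Rightarrow> real" where "h x = (\<Sum>j\<le>N. \<pi> j / wt j * indicator (C j) x)"
definition nu :: "real measure" where "nu = density lam (\<lambda>x. ennreal (h x))"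
abbreviation "M \<equiv> m \<Otimes>\<^sub>M nu"
abbreviation "cyl j \<equiv> (UNIV :: bool stream set) \<times> C j"
text \<open>The conditional probability of \<open>A\<close> given that \<open>x\<close> is in
  \<open>C j\<close>. By \<open>cond_K\<close>, passing to the preimage of \<open>A\<close> is one
  application of the matrix.\<close>

definition cond :: "(bool stream \<times> real) set \<Rightarrow> nat \<Rightarrow> real" where
  "cond A j = measure Lam (cyl j \<inter> A) / wt j"

lemma pi_nonneg: "j \<le> N \<Longrightarrow> 0 \<le> \<pi> j" and pi_sum: "(\<Sum>j\<le>N. \<pi> j) = 1"
  using stationary_pi by (auto simp: chain.stationary_def)

lemma pi_wt_nonneg: "j \<le> N \<Longrightarrow> 0 \<le> \<pi> j / wt j"
  using pi_nonneg[of j] wt_pos[of j] by simp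

lemma h_measurable: "(\<lambda>x. ennreal (h x)) \<in> borel_measurable lam"
  unfolding h_def by measurable

lemma sets_nu: "sets nu = sets lam" and space_nu [simp]: "space nu = J"
  by (simp_all add: nu_def)

lemma emeasure_nu:
  assumes "B \<in> sets lam"
  shows "emeasure nu B = ennreal (\<Sum>j\<le>N. measure lam (B \<inter> C j) / wt j * \<pi> j)"
proof -
  have "emeasure nu B = ennreal (\<Sum>j\<le>N. \<pi> j / wt j * measure lam (C j \<inter> B))"
    unfolding nu_def h_def using assms
    by (intro lam.emeasure_density_step) (auto intro: pi_wt_nonneg)
  then show ?thesis by (simp add: Int_commute mult.commute)
qed

lemma nu_prob: "prob_space nu"
proof
  have "emeasure nu J = ennreal (\<Sum>j\<le>N. measure lam (J \<inter> C j) / wt j * \<pi> j)"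
    using sets.top[of lam] by (intro emeasure_nu) simp
  also have "(\<Sum>j\<le>N. measure lam (J \<inter> C j) / wt j * \<pi> j) = (\<Sum>j\<le>N. \<pi> j)"
  proof (rule sum.cong)
    fix j assume "j \<in> {..N}"
    then have j: "j \<le> N" by simp
    then have "J \<inter> C j = C j" using C_J by blast
    then show "measure lam (J \<inter> C j) / wt j * \<pi> j = \<pi> j" using wt_pos[OF j] by (simp add: wt_def)
  qed simp
  finally show "emeasure nu (space nu) = 1" by (simp add: pi_sum)
qed

sublocale nu: prob_space nu by (rule nu_prob)
sublocale M: pair_prob_space m nu ..

lemma sets_M: "sets M = sets Lam" and space_M [simp]: "space M = UNIV \<times> J"
  by (auto simp: space_pair_measure sets_nu intro: sets_pair_measure_cong)

lemma measure_M:
  assumes "A \<in> sets Lam"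
  shows "measure M A = (\<Sum>j\<le>N. \<pi> j * cond A j)"
proof -
  have "M = density m (\<lambda>_. 1) \<Otimes>\<^sub>M density lam (\<lambda>x. ennreal (h x))"
    by (simp add: nu_def density_1)
  also have "\<dots> = density Lam (\<lambda>(\<omega>, x). 1 * ennreal (h x))"
    using nu.sigma_finite_measure_axioms lam.sigma_finite_measure_axioms h_measurable
    by (intro pair_measure_density) (auto simp: nu_def)
  also have "(\<lambda>(\<omega> :: bool stream, x). 1 * ennreal (h x)) = (\<lambda>z. ennreal (\<Sum>j\<le>N. \<pi> j / wt j * indicator (cyl j) z))"
    by (auto simp: h_def indicator_def intro!: sum.cong)
  also have "emeasure (density Lam \<dots>) A = ennreal (\<Sum>j\<le>N. \<pi> j / wt j * measure Lam (cyl j \<inter> A))"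
    using assms
    by (intro Lam.emeasure_density_step) (auto intro: pi_wt_nonneg)
  finally have "emeasure M A = ennreal (\<Sum>j\<le>N. \<pi> j * cond A j)" by (simp add: cond_def)
  moreover have "0 \<le> (\<Sum>j\<le>N. \<pi> j * cond A j)"
    unfolding cond_def using pi_nonneg wt_pos
    by (intro sum_nonneg mult_nonneg_nonneg divide_nonneg_pos) auto
  ultimately show ?thesis by (simp add: measure_def)
qed

lemma cond_K: "A \<in> sets Lam \<Longrightarrow> j \<le> N \<Longrightarrow> cond (K -` A) j = chain.step (cond A) j"
  using chain[of j A] wt_pos[of j] by (simp add: cond_def chain.step_def)

lemma cond_space: "j \<le> N \<Longrightarrow> cond (A \<inter> space Lam) j = cond A j"
proof -
  assume "j \<le> N"
  then have "cyl j \<inter> (A \<inter> space Lam) = cyl j \<inter> A" using C_J by auto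
  then show ?thesis by (simp only: cond_def)
qed

lemma vimage_sets: "A \<in> sets Lam \<Longrightarrow> (K ^^ k) -` A \<inter> space Lam \<in> sets Lam"
  using Kpow_measurable by (rule measurable_sets)

lemma Kpow_space: "x \<in> space Lam \<Longrightarrow> (K ^^ k) x \<in> space Lam"
  using measurable_space[OF Kpow_measurable] .

lemma K_space: "x \<in> space Lam \<Longrightarrow> K x \<in> space Lam"
  using measurable_space[OF K_measurable] .

lemma cond_Kpow:
  assumes A: "A \<in> sets Lam"
  shows "j \<le> N \<Longrightarrow> cond ((K ^^ k) -` A) j = (chain.step ^^ k) (cond A) j"
proof (induction k arbitrary: j)
  case (Suc k)
  have "cond ((K ^^ Suc k) -` A) j = cond (K -` ((K ^^ k) -` A \<inter> space Lam) \<inter> space Lam) j"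
  proof -
    have "(K ^^ Suc k) -` A \<inter> space Lam = K -` ((K ^^ k) -` A \<inter> space Lam) \<inter> space Lam"
      using K_space unfolding funpow_Suc_right by auto
    then show ?thesis using cond_space[OF Suc.prems] by metis
  qed
  also have "\<dots> = chain.step (cond ((K ^^ k) -` A \<inter> space Lam)) j"
    using cond_K[OF vimage_sets[OF A] Suc.prems] cond_space[OF Suc.prems] by metis
  also have "\<dots> = chain.step ((chain.step ^^ k) (cond A)) j"
    using cond_space Suc.IH by (intro chain.step_cong) auto
  finally show ?case unfolding funpow.simps(2)[of k chain.step] comp_apply[of chain.step] .
qed simp

lemma measure_M_Kpow:
  assumes A: "A \<in> sets Lam"
  shows "measure M ((K ^^ k) -` A \<inter> space Lam) = measure M A"
proof -
  have "measure M ((K ^^ k) -` A \<inter> space Lam) = (\<Sum>j\<le>N. \<pi> j * (chain.step ^^ k) (cond A) j)"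
    unfolding measure_M[OF vimage_sets[OF A]]
    using cond_space cond_Kpow[OF A] by (intro sum.cong) auto
  then show ?thesis using chain.stationary_iter[OF stationary_pi] measure_M[OF A] by simp
qed

text \<open>Stationarity of \<open>\<pi>\<close> makes \<open>M\<close> invariant; on sets
  \<open>UNIV \<times> B\<close> this is the equation for the two maps by
  \<open>measure_K_vimage_rect\<close>.\<close>

lemma nu_invariant: "invariant_ac_measure \<beta> p nu"
  unfolding invariant_ac_measure_def
proof (intro conjI ballI)
  show "prob_space nu" by (rule nu_prob)
  show "sets nu = sets lam" by (rule sets_nu)
  show "absolutely_continuous lam nu"
    unfolding nu_def by (rule absolutely_continuousI_density[OF h_measurable])
  fix B assume B: "B \<in> sets lam"
  have UB: "UNIV \<times> B \<in> sets Lam" using B by simp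
  have "measure nu B = measure M (UNIV \<times> B)"
    using B by (simp add: measure_def nu.emeasure_pair_measure_Times enn2real_mult sets_nu)
      (use measure_UNIV_m in \<open>simp add: measure_def\<close>)
  also have "\<dots> = measure M ((K ^^ 1) -` (UNIV \<times> B) \<inter> space Lam)" using measure_M_Kpow[OF UB, of 1] by simp
  also have "\<dots> = p * measure nu (T -` B \<inter> J) + (1 - p) * measure nu (L -` B \<inter> J)"
    using measure_K_vimage_rect[OF nu_prob sets_nu UNIV_sets_m B] by simp
  finally show "measure nu B = p * measure nu (T -` B \<inter> J) + (1 - p) * measure nu (L -` B \<inter> J)" .
qed

lemma distr_M: "distr M M K = M"
  using nu_invariant unfolding invariant_ac_measure_def
  by (intro invariant_imp_distr_K) auto

lemma null_Lam_M:
  assumes "A \<in> sets Lam" "measure Lam A = 0"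
  shows "measure M A = 0"
proof -
  have "cond A j = 0" if "j \<le> N" for j
    using Lam.finite_measure_mono[of "cyl j \<inter> A" A] assms measure_nonneg[of Lam "cyl j \<inter> A"]
    by (simp add: cond_def)
  then show ?thesis using measure_M[OF assms(1)] by simp
qed

text \<open>The starting set is weighed by \<open>Lam\<close>, which each branch scales exactly, and
  the target by \<open>M\<close>, the measure to which the iterates converge.\<close>

definition err :: "nat \<Rightarrow> (bool stream \<times> real) set \<Rightarrow> (bool stream \<times> real) set \<Rightarrow> real" where
  "err k A B = \<bar>measure Lam (A \<inter> (K ^^ k) -` B) - measure Lam A * measure M B\<bar>"

definition bnd :: "(bool stream \<times> real) set \<Rightarrow> real \<Rightarrow> bool" where
  "bnd A c \<longleftrightarrow> (\<forall>\<epsilon>>0. \<exists>k0. \<forall>k\<ge>k0. \<forall>B\<in>sets Lam. err k A B \<le> c + \<epsilon>)"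

text \<open>The asymptotic defect from uniform mixing: the limit superior over \<open>k\<close> of the supremum over \<open>B\<close>
  of \<open>err k A B\<close>.\<close>

definition defect :: "(bool stream \<times> real) set \<Rightarrow> real" where
  "defect A = Inf {c. 0 \<le> c \<and> bnd A c}"

section \<open>Rules for the defect\<close>

lemma Int_vimage_sets:
  assumes "A \<in> sets Lam" "B \<in> sets Lam"
  shows "A \<inter> (K ^^ k) -` B \<in> sets Lam"
proof -
  have "A \<inter> (K ^^ k) -` B = A \<inter> ((K ^^ k) -` B \<inter> space Lam)"
    using sets.sets_into_space[OF assms(1)] by auto
  then show ?thesis using assms vimage_sets by auto
qed

lemma err_le_measure:
  assumes "A \<in> sets Lam" "B \<in> sets Lam"
  shows "err k A B \<le> measure Lam A"
proof -
  have "measure Lam (A \<inter> (K ^^ k) -` B) \<le> measure Lam A"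
    using assms by (intro Lam.finite_measure_mono) auto
  moreover have "measure Lam A * measure M B \<le> measure Lam A"
    using M.prob_le_1[of B] by (intro mult_left_le) auto
  ultimately show ?thesis unfolding err_def
    using measure_nonneg[of Lam "A \<inter> (K ^^ k) -` B"] mult_nonneg_nonneg[OF measure_nonneg[of Lam A] measure_nonneg[of M B]]
    by linarith
qed

lemma bnd_measure: "A \<in> sets Lam \<Longrightarrow> bnd A (measure Lam A)"
  unfolding bnd_def
proof (intro allI impI exI[of _ 0] ballI)
  fix \<epsilon> :: real and k B assume "A \<in> sets Lam" "0 < \<epsilon>" "B \<in> sets Lam"
  then show "err k A B \<le> measure Lam A + \<epsilon>" using err_le_measure[of A B k] by linarith
qed

lemma defect_le: "0 \<le> c \<Longrightarrow> bnd A c \<Longrightarrow> defect A \<le> c"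
  unfolding defect_def by (intro cInf_lower bdd_belowI[of _ 0]) auto

lemma defect_le_measure: "A \<in> sets Lam \<Longrightarrow> defect A \<le> measure Lam A"
  by (intro defect_le bnd_measure) auto

lemma defect_nonneg: "A \<in> sets Lam \<Longrightarrow> 0 \<le> defect A"
  unfolding defect_def using bnd_measure measure_nonneg by (intro cInf_greatest) blast+

lemma bnd_defect:
  assumes "A \<in> sets Lam"
  shows "bnd A (defect A)"
  unfolding bnd_def
proof (intro allI impI)
  fix \<epsilon> :: real assume "0 < \<epsilon>"
  then have "Inf {c. 0 \<le> c \<and> bnd A c} < defect A + \<epsilon> / 2" by (simp add: defect_def)
  moreover have "{c. 0 \<le> c \<and> bnd A c} \<noteq> {}" using bnd_measure[OF assms] measure_nonneg by blast
  ultimately have "\<exists>c\<in>{c. 0 \<le> c \<and> bnd A c}. c < defect A + \<epsilon> / 2"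
    by (intro cInf_lessD) auto
  then obtain c where c: "bnd A c" "c < defect A + \<epsilon> / 2" by blast
  from c(1) \<open>0 < \<epsilon>\<close> have "\<exists>k0. \<forall>k\<ge>k0. \<forall>B\<in>sets Lam. err k A B \<le> c + \<epsilon> / 2"
    unfolding bnd_def by (elim allE[of _ "\<epsilon> / 2"] impE) simp_all
  then obtain k0 where "\<forall>k\<ge>k0. \<forall>B\<in>sets Lam. err k A B \<le> c + \<epsilon> / 2" by blast
  then show "\<exists>k0. \<forall>k\<ge>k0. \<forall>B\<in>sets Lam. err k A B \<le> defect A + \<epsilon>"
    using c(2) by (intro exI[of _ k0]) force
qed

text \<open>The common source of the rules below: a linear relation between correlations, valid for
  all \<open>B\<close> and with a time shift \<open>d\<close>, passes to defects with coefficients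
  in absolute value. Shifts \<open>0\<close> and \<open>1\<close> yield set operations and the
  push-forward.\<close>

lemma defect_comb:
  assumes F: "finite F" and A: "A \<in> sets Lam" and A': "\<And>l. l \<in> F \<Longrightarrow> A' l \<in> sets Lam"
    and eq: "\<And>k B. B \<in> sets Lam \<Longrightarrow>
      measure Lam (A \<inter> (K ^^ (k + d)) -` B) = (\<Sum>l\<in>F. c l * measure Lam (A' l \<inter> (K ^^ k) -` B))"
  shows "defect A \<le> (\<Sum>l\<in>F. \<bar>c l\<bar> * defect (A' l))"
proof (rule defect_le)
  show "0 \<le> (\<Sum>l\<in>F. \<bar>c l\<bar> * defect (A' l))"
    using A' defect_nonneg by (intro sum_nonneg mult_nonneg_nonneg) auto
  have full: "X \<inter> (K ^^ k) -` space Lam = X" if "X \<in> sets Lam" for X k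
    using Kpow_space sets.sets_into_space[OF that] by blast
  \<comment> \<open>With the whole space for \<open>B\<close> the relation becomes one between
    masses, so the error terms satisfy it too.\<close>
  have mA: "measure Lam A = (\<Sum>l\<in>F. c l * measure Lam (A' l))"
  proof -
    have "measure Lam A = measure Lam (A \<inter> (K ^^ (0 + d)) -` space Lam)" by (simp only: full[OF A])
    also have "\<dots> = (\<Sum>l\<in>F. c l * measure Lam (A' l \<inter> (K ^^ 0) -` space Lam))" by (rule eq) (rule sets.top)
    also have "\<dots> = (\<Sum>l\<in>F. c l * measure Lam (A' l))" by (intro sum.cong) (simp_all only: full A')
    finally show ?thesis .
  qed
  have err: "err (k + d) A B \<le> (\<Sum>l\<in>F. \<bar>c l\<bar> * err k (A' l) B)" if B: "B \<in> sets Lam" for k B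
  proof -
    have "measure Lam (A \<inter> (K ^^ (k + d)) -` B) - measure Lam A * measure M B =
      (\<Sum>l\<in>F. c l * (measure Lam (A' l \<inter> (K ^^ k) -` B) - measure Lam (A' l) * measure M B))"
      unfolding eq[OF B] mA by (simp add: sum_distrib_right sum_subtractf right_diff_distrib mult.assoc)
    then show ?thesis unfolding err_def
      by (simp only:) (rule order_trans[OF sum_abs], simp add: abs_mult)
  qed
  show "bnd A (\<Sum>l\<in>F. \<bar>c l\<bar> * defect (A' l))"
    unfolding bnd_def
  proof (intro allI impI)
    fix \<epsilon> :: real assume "0 < \<epsilon>"
    define s where "s = (\<Sum>l\<in>F. \<bar>c l\<bar>)"
    have s: "0 \<le> s" by (auto simp: s_def intro: sum_nonneg)
    \<comment> \<open>The summand \<open>1\<close> keeps the quotient meaningful when all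
      coefficients vanish.\<close>
    define \<delta> where "\<delta> = \<epsilon> / (s + 1)"
    have \<delta>: "0 < \<delta>" "s * \<delta> \<le> \<epsilon>" using s \<open>0 < \<epsilon>\<close> by (auto simp: \<delta>_def field_simps)
    have "\<forall>l\<in>F. \<exists>k0. \<forall>k\<ge>k0. \<forall>B\<in>sets Lam. err k (A' l) B \<le> defect (A' l) + \<delta>"
      using bnd_defect[OF A'] \<delta> unfolding bnd_def by blast
    then obtain k0 where k0: "\<And>l k B. l \<in> F \<Longrightarrow> k0 l \<le> k \<Longrightarrow> B \<in> sets Lam \<Longrightarrow> err k (A' l) B \<le> defect (A' l) + \<delta>"
      by metis
    define k1 where "k1 = Max (insert 0 (k0 ` F))"
    have k1: "k0 l \<le> k1" if "l \<in> F" for l using F that by (auto simp: k1_def)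
    show "\<exists>k0. \<forall>k\<ge>k0. \<forall>B\<in>sets Lam. err k A B \<le> (\<Sum>l\<in>F. \<bar>c l\<bar> * defect (A' l)) + \<epsilon>"
    proof (intro exI[of _ "k1 + d"] allI impI ballI)
      fix k B assume k: "k1 + d \<le> k" and B: "B \<in> sets Lam"
      have "err k A B = err ((k - d) + d) A B" using k by simp
      also have "\<dots> \<le> (\<Sum>l\<in>F. \<bar>c l\<bar> * err (k - d) (A' l) B)" by (rule err[OF B])
      also have "\<dots> \<le> (\<Sum>l\<in>F. \<bar>c l\<bar> * (defect (A' l) + \<delta>))"
      proof (intro sum_mono mult_left_mono)
        fix l assume l: "l \<in> F"
        show "err (k - d) (A' l) B \<le> defect (A' l) + \<delta>"
          using k0[OF l _ B, of "k - d"] k1[OF l] k by linarith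
      qed auto
      also have "\<dots> = (\<Sum>l\<in>F. \<bar>c l\<bar> * defect (A' l)) + s * \<delta>"
        by (simp add: distrib_left sum.distrib s_def sum_distrib_right)
      finally show "err k A B \<le> (\<Sum>l\<in>F. \<bar>c l\<bar> * defect (A' l)) + \<epsilon>" using \<delta> by linarith
    qed
  qed
qed

lemma defect_push:
  assumes "finite F" "A \<in> sets Lam" "\<And>l. l \<in> F \<Longrightarrow> A' l \<in> sets Lam"
    and "\<And>l. l \<in> F \<Longrightarrow> 0 \<le> c l"
    and eq: "\<And>B. B \<in> sets Lam \<Longrightarrow> measure Lam (A \<inter> K -` B) = (\<Sum>l\<in>F. c l * measure Lam (A' l \<inter> B))"
  shows "defect A \<le> (\<Sum>l\<in>F. c l * defect (A' l))"
proof -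
  have "defect A \<le> (\<Sum>l\<in>F. \<bar>c l\<bar> * defect (A' l))"
  proof (rule defect_comb[where d=1])
    fix k B assume B: "B \<in> sets Lam"
    have sp: "X \<inter> ((K ^^ k) -` B \<inter> space Lam) = X \<inter> (K ^^ k) -` B" if "X \<in> sets Lam" for X
      using sets.sets_into_space[OF that] by auto
    have "A \<inter> (K ^^ (k + 1)) -` B = A \<inter> K -` ((K ^^ k) -` B \<inter> space Lam)"
      using sets.sets_into_space[OF assms(2)] K_space by (auto simp: funpow_swap1)
    then show "measure Lam (A \<inter> (K ^^ (k + 1)) -` B) = (\<Sum>l\<in>F. c l * measure Lam (A' l \<inter> (K ^^ k) -` B))"
      using eq[OF vimage_sets[OF B]] sp assms(3) by simp
  qed (use assms in auto)
  also have "\<dots> = (\<Sum>l\<in>F. c l * defect (A' l))" using assms(4) by (intro sum.cong) auto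
  finally show ?thesis .
qed

lemma defect_UN:
  assumes F: "finite F" and A': "\<And>l. l \<in> F \<Longrightarrow> A' l \<in> sets Lam" and disj: "disjoint_family_on A' F"
  shows "defect (\<Union>l\<in>F. A' l) \<le> (\<Sum>l\<in>F. defect (A' l))"
proof -
  have "defect (\<Union>l\<in>F. A' l) \<le> (\<Sum>l\<in>F. \<bar>1\<bar> * defect (A' l))"
  proof (rule defect_comb[where d=0, OF F _ A'])
    fix k B assume B: "B \<in> sets Lam"
    have "(\<Union>l\<in>F. A' l) \<inter> (K ^^ (k + 0)) -` B = (\<Union>l\<in>F. A' l \<inter> (K ^^ k) -` B)" by auto
    also have "measure Lam \<dots> = (\<Sum>l\<in>F. measure Lam (A' l \<inter> (K ^^ k) -` B))"
    proof (rule Lam.finite_measure_finite_Union[OF F])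
      show "(\<lambda>l. A' l \<inter> (K ^^ k) -` B) ` F \<subseteq> sets Lam" using A' B Int_vimage_sets by blast
      show "disjoint_family_on (\<lambda>l. A' l \<inter> (K ^^ k) -` B) F"
        using disj unfolding disjoint_family_on_def by blast
    qed
    finally show "measure Lam ((\<Union>l\<in>F. A' l) \<inter> (K ^^ (k + 0)) -` B) =
      (\<Sum>l\<in>F. 1 * measure Lam (A' l \<inter> (K ^^ k) -` B))" by simp
  qed (use F A' in auto)
  then show ?thesis by simp
qed

lemma defect_Un:
  assumes "A \<in> sets Lam" "B \<in> sets Lam" "A \<inter> B = {}"
  shows "defect (A \<union> B) \<le> defect A + defect B"
proof -
  have "disjoint_family_on (\<lambda>l. if l then A else B) UNIV"
    using assms(3) by (auto simp: disjoint_family_on_def)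
  moreover have "(if l then A else B) \<in> sets Lam" for l using assms by simp
  ultimately have "defect (\<Union>l\<in>UNIV. if l then A else B) \<le> (\<Sum>l\<in>UNIV. defect (if l then A else B))"
    by (intro defect_UN) auto
  then show ?thesis by (simp add: UNIV_bool Un_commute add.commute)
qed

lemma defect_Diff:
  assumes A: "A \<in> sets Lam" and B: "B \<in> sets Lam" and sub: "B \<subseteq> A"
  shows "defect (A - B) \<le> defect A + defect B"
proof -
  have "defect (A - B) \<le> (\<Sum>l\<in>UNIV. \<bar>if l then 1 else -1\<bar> * defect (if l then A else B))"
  proof (rule defect_comb[where d=0])
    fix k X assume X: "X \<in> sets Lam"
    have "(A - B) \<inter> (K ^^ (k + 0)) -` X = A \<inter> (K ^^ k) -` X - B \<inter> (K ^^ k) -` X" by auto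
    also have "measure Lam \<dots> = measure Lam (A \<inter> (K ^^ k) -` X) - measure Lam (B \<inter> (K ^^ k) -` X)"
      using sub by (intro Lam.finite_measure_Diff Int_vimage_sets A B X) auto
    finally show "measure Lam ((A - B) \<inter> (K ^^ (k + 0)) -` X) =
      (\<Sum>l\<in>UNIV. (if l then 1 else -1) * measure Lam ((if l then A else B) \<inter> (K ^^ k) -` X))"
      by (simp add: UNIV_bool)
  qed (use A B in auto)
  then show ?thesis by (simp add: UNIV_bool)
qed

text \<open>\<open>B\<close> enters only through the vector \<open>cond B\<close> with entries
  between \<open>0\<close> and \<open>1\<close>, and the convergence of the chain is uniform over
  such vectors.\<close>

lemma defect_cell:
  assumes j: "j \<le> N"
  shows "defect (cyl j) = 0"
proof -
  have s: "cyl j \<in> sets Lam" using C_sets[OF j] by simp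
  have wt1: "wt j \<le> 1" unfolding wt_def by (rule lam.prob_le_1)
  have "bnd (cyl j) 0" unfolding bnd_def
  proof (intro allI impI)
    fix \<epsilon> :: real assume \<epsilon>: "0 < \<epsilon>"
    obtain k0 where k0: "\<And>k v i. k0 \<le> k \<Longrightarrow> (\<forall>j\<le>N. 0 \<le> v j \<and> v j \<le> 1) \<Longrightarrow> i \<le> N \<Longrightarrow>
      \<bar>(chain.step ^^ k) v i - (\<Sum>j\<le>N. \<pi> j * v j)\<bar> \<le> \<epsilon>"
      using chain.stationary_converges[OF stationary_pi \<epsilon>] by blast
    show "\<exists>k0. \<forall>k\<ge>k0. \<forall>B\<in>sets Lam. err k (cyl j) B \<le> 0 + \<epsilon>"
    proof (intro exI[of _ k0] allI impI ballI)
      fix k B assume k: "k0 \<le> k" and B: "B \<in> sets Lam"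
      have "\<forall>l\<le>N. 0 \<le> cond B l \<and> cond B l \<le> 1"
      proof (intro allI impI)
        fix l assume l: "l \<le> N"
        have "measure Lam (cyl l \<inter> B) \<le> measure Lam (cyl l)"
          using C_sets[OF l] by (intro Lam.finite_measure_mono) auto
        then have "measure Lam (cyl l \<inter> B) \<le> wt l" using measure_cyl[OF l] by simp
        then show "0 \<le> cond B l \<and> cond B l \<le> 1"
          using wt_pos[OF l] by (simp add: cond_def)
      qed
      then have "\<bar>cond ((K ^^ k) -` B) j - measure M B\<bar> \<le> \<epsilon>"
        using k0[OF k _ j, of "cond B"] cond_Kpow[OF B j] measure_M[OF B] by simp
      moreover have "err k (cyl j) B = wt j * \<bar>cond ((K ^^ k) -` B) j - measure M B\<bar>"
      proof -
        have "measure Lam (cyl j \<inter> (K ^^ k) -` B) - measure Lam (cyl j) * measure M B =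
          wt j * (cond ((K ^^ k) -` B) j - measure M B)"
          using wt_pos[OF j] measure_cyl[OF j] by (simp add: cond_def right_diff_distrib)
        then show ?thesis using wt_pos[OF j] unfolding err_def by (simp only: abs_mult)
      qed
      moreover have "wt j * \<bar>cond ((K ^^ k) -` B) j - measure M B\<bar> \<le> \<bar>cond ((K ^^ k) -` B) j - measure M B\<bar>"
        using wt1 wt_pos[OF j] by (intro mult_left_le_one_le) auto
      ultimately show "err k (cyl j) B \<le> 0 + \<epsilon>" by linarith
    qed
  qed
  then have "defect (cyl j) \<le> 0" by (intro defect_le) auto
  then show ?thesis using defect_nonneg[OF s] by simp
qed

section \<open>Cylinders over cells and over partial cells\<close>

lemma cells_disjoint: "i \<le> N \<Longrightarrow> j \<le> N \<Longrightarrow> i \<noteq> j \<Longrightarrow> C i \<inter> C j = {}"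
  using C_disjoint by blast

abbreviation "pre \<equiv> sstart (UNIV :: bool set)"

lemma pre_Cons: "pre (i # bs) = {\<omega>. shd \<omega> = i \<and> stl \<omega> \<in> pre bs}" by auto

lemma pre_sets: "pre bs \<in> sets m"
  unfolding sets_m by (rule sets_sstart)

lemma defect_switch:
  assumes j: "j \<le> N" "1 \<le> k" "k \<le> D" "C j = S k" and G: "G \<in> sets m" and I: "I \<in> sets lam" "I \<subseteq> S k"
  shows "defect ({\<omega>. shd \<omega> = i \<and> stl \<omega> \<in> G} \<times> I) \<le>
    q i / \<beta> * defect (G \<times> {z\<in>J. (z + (real k - of_bool (\<not> i))) / \<beta> \<in> I})"
proof -
  have "defect ({\<omega>. shd \<omega> = i \<and> stl \<omega> \<in> G} \<times> I) \<le>
    (\<Sum>l\<in>{()}. q i / \<beta> * defect (G \<times> {z\<in>J. (z + (real k - of_bool (\<not> i))) / \<beta> \<in> I}))"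
    using push_S[OF j(2,3) I(2,1) G, of _ i] measurable_split[OF G, of i] I G affine_vimage_sets[OF I(1)] q_pos[of i] beta_pos
    by (intro defect_push) auto
  then show ?thesis by simp
qed

lemma goal_image:
  assumes "C j = S k"
  shows "{z\<in>J. (z + (real k - of_bool (\<not> i))) / \<beta> \<in> C j} = C (goal i)"
  using beta_pos r_pos unfolding assms mem_S by (auto simp: C_first C_last J_eq)

text \<open>Induction on the prefix. At a switch cell the first letter is consumed and the induction
  hypothesis gives defect \<open>0\<close>; elsewhere the prefix survives, and the defect divided by
  the weight of the cell is at most its average along \<open>P\<close>. As every cell reaches a
  switch, the maximum principle applies.\<close>

lemma defect_prefix_cell: "j \<le> N \<Longrightarrow> defect (pre bs \<times> C j) = 0"
proof (induction bs arbitrary: j)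
  case Nil
  then show ?case using defect_cell by simp
next
  case (Cons i bs)
  have s: "pre bs' \<times> C j \<in> sets Lam" if "j \<le> N" for j bs' using pre_sets C_sets[OF that] by simp
  have "defect (pre (i # bs) \<times> C j) / wt j = 0"
  proof (rule chain.subharmonic_zero[where A=switches and f="\<lambda>j. defect (pre (i # bs) \<times> C j) / wt j"])
    fix a assume "a \<in> switches" and a: "a \<le> N"
    then obtain k where k: "1 \<le> k" "k \<le> D" "C a = S k" by (auto simp: switches_def)
    have "defect (pre (i # bs) \<times> C a) \<le> q i / \<beta> * defect (pre bs \<times> C (goal i))"
      using defect_switch[OF a k pre_sets C_sets[OF a], of i bs] k(3)
      unfolding pre_Cons goal_image[OF k(3), of i] by simp
    also have "\<dots> = 0" using Cons.IH[of "goal i"] by simp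
    finally show "defect (pre (i # bs) \<times> C a) / wt a = 0"
      using defect_nonneg[OF s[OF a, of "i # bs"]] by simp
  next
    fix j assume j: "j \<le> N" "j \<notin> switches"
    show "defect (pre (i # bs) \<times> C j) / wt j \<le> (\<Sum>l\<le>N. P j l * (defect (pre (i # bs) \<times> C l) / wt l))"
      using j(1)
    proof (cases rule: C_cases)
      case (1 k)
      have "defect (pre (i # bs) \<times> C j) \<le> (\<Sum>l\<in>{..N}. (wt j * P j l / wt l) * defect (pre (i # bs) \<times> C l))"
      proof (rule defect_push)
        fix l assume "l \<in> {..N}"
        then show "0 \<le> wt j * P j l / wt l" using P_ge0[OF j(1)] wt_pos[OF j(1)] wt_pos[of l] by simp
      next
        fix B assume B: "B \<in> sets Lam"
        show "measure Lam ((pre (i # bs) \<times> C j) \<inter> K -` B) =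
          (\<Sum>l\<in>{..N}. (wt j * P j l / wt l) * measure Lam ((pre (i # bs) \<times> C l) \<inter> B))"
          unfolding chain_E[OF j(1) 1 pre_sets B] sum_distrib_left by (intro sum.cong) auto
      qed (use s j in auto)
      also have "\<dots> = wt j * (\<Sum>l\<le>N. P j l * (defect (pre (i # bs) \<times> C l) / wt l))"
        unfolding sum_distrib_left by (intro sum.cong) auto
      finally show ?thesis using wt_pos[OF j(1)] by (simp add: field_simps)
    next
      case (2 k)
      then show ?thesis using j by (auto simp: switches_def)
    qed
  next
    fix j assume "j \<le> N"
    then show "0 \<le> defect (pre (i # bs) \<times> C j) / wt j" using defect_nonneg[OF s] wt_pos[of j] by simp
  qed (use reach_switch Cons.prems in auto)
  then show ?case using wt_pos[OF Cons.prems] by simp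
qed

text \<open>Only the cell containing \<open>a\<close> is cut by \<open>{..a}\<close>.\<close>

lemma defect_cut:
  assumes U: "\<And>l. l \<le> N \<Longrightarrow> C l \<subseteq> U \<or> C l \<inter> U = {}" and UJ: "U \<subseteq> J" and a: "a \<in> J"
  shows "defect (pre bs \<times> (U \<inter> {..a})) \<le> defect (pre bs \<times> (cl a \<inter> {..a}))"
proof -
  obtain j where j: "j \<le> N" "a \<in> C j" using C_cover a by blast
  have Cj: "C j = cl a" using C_cl j by blast
  have side: "C l \<subseteq> {..a} \<or> C l \<inter> {..a} = {}" if l: "l \<le> N" "l \<noteq> j" for l
  proof (rule ccontr)
    assume "\<not> ?thesis"
    then obtain y z where "y \<in> C l" "z \<in> C l" "y \<le> a" "\<not> z \<le> a" by auto
    then have "a \<in> C l" using C_ivl[OF l(1), of y z] by auto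
    then show False using C_disjoint j l by blast
  qed
  define F where "F = {l. l \<le> N \<and> C l \<subseteq> U \<and> (l = j \<or> C l \<subseteq> {..a})}"
  define A' where "A' l = pre bs \<times> (C l \<inter> {..a})" for l
  have F: "finite F" "F \<subseteq> {..N}" by (auto simp: F_def)
  have A's: "A' l \<in> sets Lam" if "l \<in> F" for l
  proof -
    have "l \<le> N" using F that by auto
    then have "C l \<inter> {..a} \<in> sets lam" using C_sets[of l] by (auto simp: sets_lam)
    then show ?thesis using pre_sets by (simp add: A'_def)
  qed
  have "U \<inter> {..a} = (\<Union>l\<in>F. C l \<inter> {..a})"
  proof
    show "U \<inter> {..a} \<subseteq> (\<Union>l\<in>F. C l \<inter> {..a})"
    proof
      fix x assume x: "x \<in> U \<inter> {..a}"
      then obtain l where l: "l \<le> N" "x \<in> C l" using UJ C_cover by blast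
      then have "C l \<subseteq> U" using U x by blast
      moreover have "l = j \<or> C l \<subseteq> {..a}" using side l x by blast
      ultimately show "x \<in> (\<Union>l\<in>F. C l \<inter> {..a})" using l x by (auto simp: F_def)
    qed
  qed (auto simp: F_def)
  then have "pre bs \<times> (U \<inter> {..a}) = (\<Union>l\<in>F. A' l)" by (auto simp: A'_def)
  moreover have "disjoint_family_on A' F" unfolding disjoint_family_on_def
  proof (intro ballI impI)
    fix i l assume "i \<in> F" "l \<in> F" "i \<noteq> l"
    then have "C i \<inter> C l = {}" using F by (intro cells_disjoint) auto
    then show "A' i \<inter> A' l = {}" by (auto simp: A'_def)
  qed
  ultimately have "defect (pre bs \<times> (U \<inter> {..a})) \<le> (\<Sum>l\<in>F. defect (A' l))"
    using defect_UN[OF F(1) A's] by simp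
  \<comment> \<open>Cells entirely below \<open>a\<close> have defect \<open>0\<close> by
    \<open>defect_prefix_cell\<close>; only the one containing \<open>a\<close> remains.\<close>
  also have "\<dots> \<le> (\<Sum>l\<in>F. if l = j then defect (A' j) else 0)"
  proof (intro sum_mono)
    fix l assume l: "l \<in> F"
    show "defect (A' l) \<le> (if l = j then defect (A' j) else 0)"
    proof (cases "l = j")
      case False
      then have "C l \<inter> {..a} = C l" using l by (auto simp: F_def)
      then show ?thesis using False defect_prefix_cell[of l bs] l F by (auto simp: A'_def)
    qed simp
  qed
  also have "\<dots> \<le> defect (A' j)"
  proof -
    have "C j \<inter> {..a} \<in> sets lam" using C_sets[of j] j by (auto simp: sets_lam)
    then have "A' j \<in> sets Lam" using pre_sets by (simp add: A'_def)
    then show ?thesis using F defect_nonneg by (simp add: sum.delta)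
  qed
  finally show ?thesis by (simp add: A'_def Cj)
qed

text \<open>The prefix varies along with \<open>a\<close>: at a switch a nonempty prefix loses its
  first letter, while the empty one is split by that letter into two sets whose factors
  \<open>q True\<close> and \<open>q False\<close> add up to \<open>1\<close>. Either way one step
  gains at least the factor \<open>1 / \<beta>\<close>.\<close>

lemma defect_partial_cell:
  "a \<in> J \<Longrightarrow> defect (pre bs \<times> (cl a \<inter> {..a})) \<le> (1 / \<beta>) ^ k"
proof (induction k arbitrary: a bs)
  case 0
  have "cl a \<inter> {..a} \<in> sets lam"
    using C_cover[OF 0] C_cl C_sets by (fastforce simp: sets_lam)
  then have "pre bs \<times> (cl a \<inter> {..a}) \<in> sets Lam" using pre_sets by simp
  then have "defect (pre bs \<times> (cl a \<inter> {..a})) \<le> measure Lam (pre bs \<times> (cl a \<inter> {..a}))"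
    by (rule defect_le_measure)
  also have "\<dots> \<le> 1" by (rule Lam.prob_le_1)
  finally show ?case by simp
next
  case (Suc k)
  obtain j where j: "j \<le> N" "a \<in> C j" using C_cover[OF Suc.prems] by blast
  have Cj: "cl a = C j" using C_cl[OF j] by simp
  define I where "I = C j \<inter> {..a}"
  have I: "I \<in> sets lam" using C_sets[OF j(1)] by (auto simp: I_def sets_lam)
  have scale: "(z + c) / \<beta> \<le> a \<longleftrightarrow> z \<le> \<beta> * a - c" for z c
    using beta_pos by (auto simp: field_simps)
  show ?case using j(1)
  proof (cases rule: C_cases)
    case (1 d)
    define a' where "a' = \<beta> * a - d"
    have "a \<in> E d" using 1 j by blast
    then have a': "a' \<in> J" using E_image 1 by (auto simp: a'_def)
    have img: "{z\<in>J. (z + real d) / \<beta> \<in> I} = img j d \<inter> {..a'}"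
      by (auto simp: I_def img_def a'_def scale)
    have ms: "pre bs \<times> (img j d \<inter> {..a'}) \<in> sets Lam"
      using pre_sets affine_vimage_sets[OF I, of d] unfolding img by simp
    have "defect (pre bs \<times> I) \<le> (\<Sum>l\<in>{()}. 1 / \<beta> * defect (pre bs \<times> (img j d \<inter> {..a'})))"
      using push_E[OF 1(1) _ I pre_sets, of _ bs] 1 I pre_sets ms beta_pos unfolding img
      by (intro defect_push) (auto simp: I_def)
    also have "\<dots> = 1 / \<beta> * defect (pre bs \<times> (img j d \<inter> {..a'}))" by simp
    also have "\<dots> \<le> 1 / \<beta> * defect (pre bs \<times> (cl a' \<inter> {..a'}))"
      using img_union[OF j(1) 1] beta_pos a' by (intro mult_left_mono defect_cut) (auto simp: img_def)
    also have "\<dots> \<le> 1 / \<beta> * (1 / \<beta>) ^ k"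
      using Suc.IH[OF a'] beta_pos by (intro mult_left_mono) auto
    finally show ?thesis by (simp add: I_def Cj)
  next
    case (2 d)
    have step: "defect ({\<omega>. shd \<omega> = i \<and> stl \<omega> \<in> pre bs} \<times> I) \<le> q i / \<beta> * (1 / \<beta>) ^ k" for i bs
    proof -
      define c where "c = real d - of_bool (\<not> i)"
      define a' where "a' = \<beta> * a - c"
      have aS: "a \<in> S d" using 2 j by simp
      have "a' = \<beta> * a - d + of_bool (\<not> i)" by (simp add: a'_def c_def)
      then have a': "a' \<in> J"
        using S_image0[OF aS] S_image1[OF aS] r_pos by (cases i) (simp_all add: J_eq)
      have "{z\<in>J. (z + c) / \<beta> \<in> I} = {z\<in>J. (z + c) / \<beta> \<in> C j} \<inter> {..a'}"
        unfolding I_def a'_def by (auto simp: scale)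
      then have img: "{z\<in>J. (z + c) / \<beta> \<in> I} = C (goal i) \<inter> {..a'}"
        unfolding c_def goal_image[OF 2(3)] .
      have "defect ({\<omega>. shd \<omega> = i \<and> stl \<omega> \<in> pre bs} \<times> I) \<le> q i / \<beta> * defect (pre bs \<times> (C (goal i) \<inter> {..a'}))"
        using defect_switch[OF j(1) 2 pre_sets I, of i bs] 2 unfolding c_def[symmetric] img by (simp add: I_def)
      also have "\<dots> \<le> q i / \<beta> * defect (pre bs \<times> (cl a' \<inter> {..a'}))"
      proof (intro mult_left_mono defect_cut)
        show "C l \<subseteq> C (goal i) \<or> C l \<inter> C (goal i) = {}" if "l \<le> N" for l
          using cells_disjoint[of l "goal i"] that by (cases "l = goal i") simp_all
        show "C (goal i) \<subseteq> J" using C_J[of "goal i"] by simp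
        show "0 \<le> q i / \<beta>" using q_pos[of i] beta_pos by simp
      qed (rule a')
      also have "\<dots> \<le> q i / \<beta> * (1 / \<beta>) ^ k"
        using Suc.IH[OF a'] q_pos[of i] beta_pos by (intro mult_left_mono) auto
      finally show ?thesis .
    qed
    have pw: "0 \<le> (1 / \<beta>) ^ k / \<beta>" using beta_pos by simp
    show ?thesis
    proof (cases bs)
      case (Cons i bs')
      have "defect (pre bs \<times> (cl a \<inter> {..a})) \<le> q i / \<beta> * (1 / \<beta>) ^ k"
        using step[of i bs'] unfolding Cons pre_Cons by (simp add: I_def Cj)
      also have "\<dots> \<le> 1 / \<beta> * (1 / \<beta>) ^ k"
        using mult_right_mono[OF q_le1[of i] pw] by (simp add: mult.commute)
      finally show ?thesis by simp
    next
      case Nil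
      let ?B = "\<lambda>i. {\<omega>. shd \<omega> = i \<and> stl \<omega> \<in> pre []} \<times> I"
      have B: "?B i \<in> sets Lam" for i by (intro pair_measureI measurable_split pre_sets I)
      have disj: "?B True \<inter> ?B False = {}" by auto
      have eq: "pre bs \<times> (cl a \<inter> {..a}) = ?B True \<union> ?B False" by (auto simp: Nil I_def Cj)
      have "defect (pre bs \<times> (cl a \<inter> {..a})) \<le> defect (?B True) + defect (?B False)"
        unfolding eq by (rule defect_Un[OF B B disj])
      also have "\<dots> \<le> q True / \<beta> * (1 / \<beta>) ^ k + q False / \<beta> * (1 / \<beta>) ^ k"
        by (intro add_mono step)
      also have "\<dots> = (1 / \<beta>) ^ Suc k" using beta_pos by (simp add: q_def field_simps)
      finally show ?thesis .
    qed
  qed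
qed

section \<open>From rectangles to all measurable sets\<close>

definition mixing :: "(bool stream \<times> real) set \<Rightarrow> bool" where
  "mixing A \<longleftrightarrow> A \<in> sets Lam \<and> defect A = 0"

lemma mixing_Diff: "mixing A \<Longrightarrow> mixing B \<Longrightarrow> B \<subseteq> A \<Longrightarrow> mixing (A - B)"
  unfolding mixing_def using defect_Diff[of A B] defect_nonneg[of "A - B"] by auto

lemma mixing_UN_finite:
  assumes "finite F" "\<And>l. l \<in> F \<Longrightarrow> mixing (A l)" "disjoint_family_on A F"
  shows "mixing (\<Union>l\<in>F. A l)"
proof -
  have "(\<Union>l\<in>F. A l) \<in> sets Lam" using assms by (auto simp: mixing_def)
  moreover have "defect (\<Union>l\<in>F. A l) \<le> (\<Sum>l\<in>F. defect (A l))"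
    using assms by (intro defect_UN) (auto simp: mixing_def)
  moreover have "(\<Sum>l\<in>F. defect (A l)) = 0" using assms by (intro sum.neutral) (auto simp: mixing_def)
  ultimately show ?thesis using defect_nonneg[of "\<Union>l\<in>F. A l"] by (simp add: mixing_def)
qed

text \<open>Finite partial unions have defect \<open>0\<close>, and the defect of the tail is at
  most its measure, which tends to \<open>0\<close>.\<close>

lemma mixing_UN:
  assumes A: "\<And>i :: nat. mixing (A i)" and disj: "disjoint_family A"
  shows "mixing (\<Union>i. A i)"
proof -
  have As: "A i \<in> sets Lam" for i using A by (simp add: mixing_def)
  have s: "(\<Union>i. A i) \<in> sets Lam" using As by auto
  have fin: "mixing (\<Union>i<k. A i)" for k
    using A disj by (intro mixing_UN_finite) (auto simp: disjoint_family_on_def)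
  have le: "defect (\<Union>i. A i) \<le> measure Lam (\<Union>i. A i) - measure Lam (\<Union>i<k. A i)" for k
  proof -
    define V W where "V = (\<Union>i<k. A i)" and "W = (\<Union>i. A i)"
    have V: "V \<in> sets Lam" "defect V = 0" and W: "W \<in> sets Lam" and VW: "V \<subseteq> W"
      using fin[of k] s by (auto simp: V_def W_def mixing_def)
    have t: "W - V \<in> sets Lam" using V W by auto
    have "V \<union> (W - V) = W" using VW by auto
    then have "defect W \<le> defect V + defect (W - V)" using defect_Un[OF V(1) t] by simp
    also have "\<dots> \<le> measure Lam (W - V)" using V defect_le_measure[OF t] by simp
    also have "\<dots> = measure Lam W - measure Lam V" by (rule Lam.finite_measure_Diff[OF W V(1) VW])
    finally show ?thesis by (simp add: V_def W_def)
  qed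
  have sums: "measure Lam (\<Union>i<k. A i) = (\<Sum>i<k. measure Lam (A i))" for k
    using As disj by (intro Lam.finite_measure_finite_Union) (auto simp: disjoint_family_on_def)
  have "(\<lambda>k. measure Lam (\<Union>i. A i) - measure Lam (\<Union>i<k. A i)) \<longlonglongrightarrow> measure Lam (\<Union>i. A i) - measure Lam (\<Union>i. A i)"
    unfolding sums using Lam.finite_measure_UNION[of A] As disj
    by (intro tendsto_diff tendsto_const) (auto simp: sums_def)
  then have "defect (\<Union>i. A i) \<le> 0"
    using le by (intro LIMSEQ_le_const) auto
  then show ?thesis using defect_nonneg[OF s] s by (simp add: mixing_def)
qed

lemma mixing_empty: "mixing {}"
  using defect_le_measure[of "{}"] defect_nonneg[of "{}"] by (simp add: mixing_def)

lemma mixing_prefix_J: "mixing (pre bs \<times> J)"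
proof -
  have "pre bs \<times> J = (\<Union>l\<in>{..N}. pre bs \<times> C l)" using C_cover C_J by fast
  moreover have "mixing (\<Union>l\<in>{..N}. pre bs \<times> C l)"
  proof (rule mixing_UN_finite)
    show "mixing (pre bs \<times> C l)" if "l \<in> {..N}" for l
      using that defect_prefix_cell[of l bs] pre_sets C_sets[of l] by (simp add: mixing_def)
    show "disjoint_family_on (\<lambda>l. pre bs \<times> C l) {..N}"
      using cells_disjoint unfolding disjoint_family_on_def by (simp add: Times_Int_Times)
  qed simp
  ultimately show ?thesis by simp
qed

lemma mixing_prefix_atMost: "mixing (pre bs \<times> (J \<inter> {..a}))"
proof -
  consider "a < 0" | "\<tau> < a" | "a \<in> J" by (force simp: J_eq)
  then show ?thesis
  proof cases
    case 1
    then have "J \<inter> {..a} = {}" by (auto simp: J_eq)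
    then show ?thesis using mixing_empty by simp
  next
    case 2
    then have "J \<inter> {..a} = J" by (auto simp: J_eq)
    then show ?thesis using mixing_prefix_J by simp
  next
    case 3
    have "defect (pre bs \<times> (J \<inter> {..a})) \<le> (1 / \<beta>) ^ k" for k
      using defect_cut[of J a bs] defect_partial_cell[OF 3, of bs k] 3 C_J by fastforce
    moreover have "(\<lambda>k. (1 / \<beta>) ^ k) \<longlonglongrightarrow> 0" using beta_gt1 by (intro LIMSEQ_power_zero) auto
    ultimately have "defect (pre bs \<times> (J \<inter> {..a})) \<le> 0" by (intro LIMSEQ_le_const) auto
    moreover have "pre bs \<times> (J \<inter> {..a}) \<in> sets Lam"
      using pre_sets by (intro pair_measureI) (auto simp: sets_lam)
    ultimately show ?thesis using defect_nonneg by (simp add: mixing_def order_antisym)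
  qed
qed

lemma mixing_prefix:
  assumes "B \<in> sets borel"
  shows "mixing (pre bs \<times> (J \<inter> B))"
proof -
  have B: "B \<in> sigma_sets UNIV (range (\<lambda>a. {..a::real}))"
    using assms unfolding borel_eq_atMost by (simp add: sets_measure_of)
  have stable: "Int_stable (range (\<lambda>a. {..a::real}))"
    unfolding Int_stable_def by (auto simp: min_def)
  have "range (\<lambda>a. {..a::real}) \<subseteq> Pow UNIV" by simp
  from stable this B show ?thesis
  proof (induction rule: sigma_sets_induct_disjoint)
    case (basic A)
    then show ?case using mixing_prefix_atMost by auto
  next
    case empty
    then show ?case using mixing_empty by simp
  next
    case (compl A)
    have "pre bs \<times> (J \<inter> (UNIV - A)) = pre bs \<times> J - pre bs \<times> (J \<inter> A)" by auto
    then show ?case using mixing_Diff[OF mixing_prefix_J compl(2)] by auto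
  next
    case (union A)
    have "pre bs \<times> (J \<inter> (\<Union>(range A))) = (\<Union>i. pre bs \<times> (J \<inter> A i))" by auto
      moreover have "disjoint_family (\<lambda>i. pre bs \<times> (J \<inter> A i))"
      using union(1) unfolding disjoint_family_on_def by blast
    ultimately show ?case using mixing_UN[of "\<lambda>i. pre bs \<times> (J \<inter> A i)"] union(3) by simp
  qed
qed

lemma mixing_rect:
  assumes G: "G \<in> sets m" and I: "I \<in> sets lam"
  shows "mixing (G \<times> I)"
proof -
  have JI: "J \<inter> I = I" and Ib: "I \<in> sets borel" using I by (auto simp: sets_lam)
  have top: "mixing (UNIV \<times> I)" using mixing_prefix[OF Ib, of "[]"] JI by simp
  have G': "G \<in> sigma_sets UNIV (sstart UNIV ` lists UNIV \<union> {{}})"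
    using G sets_stream_space_sstart[of "UNIV :: bool set"] unfolding sets_m by simp
  have "sstart (UNIV :: bool set) ` lists UNIV \<union> {{}} \<subseteq> Pow UNIV" by simp
  from Int_stable_sstart this G' show ?thesis
  proof (induction rule: sigma_sets_induct_disjoint)
    case (basic A)
    then show ?case using mixing_prefix[OF Ib] mixing_empty by (auto simp: JI)
  next
    case empty
    then show ?case using mixing_empty by simp
  next
    case (compl A)
    have "(UNIV - A) \<times> I = UNIV \<times> I - A \<times> I" by auto
    then show ?case using mixing_Diff[OF top compl(2)] by auto
  next
    case (union A)
    have "(\<Union>(range A)) \<times> I = (\<Union>i. A i \<times> I)" by auto
      moreover have "disjoint_family (\<lambda>i. A i \<times> I)"
      using union(1) unfolding disjoint_family_on_def by blast
    ultimately show ?case using mixing_UN[of "\<lambda>i. A i \<times> I"] union(3) by simp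
  qed
qed

lemma mixing_all:
  assumes "A \<in> sets Lam"
  shows "mixing A"
proof -
  have top: "mixing (space m \<times> space lam)" using mixing_rect[of UNIV J] sets.top[of lam] by simp
  from Int_stable_pair_measure_generator[of m lam] pair_measure_closed[of m lam] assms show ?thesis
    unfolding sets_pair_measure
  proof (induction rule: sigma_sets_induct_disjoint)
    case (basic A)
    then show ?case using mixing_rect by auto
  next
    case empty
    then show ?case by (rule mixing_empty)
  next
    case (compl A)
    have "A \<subseteq> space m \<times> space lam"
      using compl(2) sets.sets_into_space[of A Lam] by (auto simp: mixing_def)
    then show ?case using mixing_Diff[OF top compl(2)] by blast
  next
    case (union A)
    then show ?case using mixing_UN by blast
  qed
qed

lemma uniform_mixing:
  assumes "A \<in> sets Lam" "0 < \<epsilon>"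
  shows "\<exists>k0. \<forall>k\<ge>k0. \<forall>B\<in>sets Lam. err k A B \<le> \<epsilon>"
  using bnd_defect[OF assms(1)] mixing_all[OF assms(1)] assms(2) by (simp add: mixing_def bnd_def)

section \<open>Exactness and uniqueness\<close>

lemma exact_M: "exact_map M K"
  unfolding exact_map_def
proof (intro conjI ballI)
  show "prob_space M" by (rule M.prob_space_axioms)
  show "K \<in> measurable M M" using K_measurable by (simp only: measurable_cong_sets[OF sets_M sets_M])
  show "distr M M K = M" by (rule distr_M)
  fix A assume "A \<in> (\<Inter>k. (\<lambda>B. (K ^^ k) -` B \<inter> space M) ` sets M)"
  then have "\<forall>k. \<exists>B. B \<in> sets Lam \<and> A = (K ^^ k) -` B \<inter> space Lam"
    unfolding sets_M space_M space_Lam by blast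
  then obtain B where B: "\<And>k. B k \<in> sets Lam" "\<And>k. A = (K ^^ k) -` B k \<inter> space Lam"
    by metis
  have A: "A \<in> sets Lam" unfolding B(2)[of 0] by (rule vimage_sets[OF B(1)])
  have "\<bar>measure Lam A - measure Lam A * measure M A\<bar> \<le> \<epsilon>" if \<epsilon>: "0 < \<epsilon>" for \<epsilon>
  proof -
    \<comment> \<open>Here uniformity is indispensable: the bound at time \<open>k\<close> is
      applied to \<open>B k\<close>, a set that itself depends on \<open>k\<close>.\<close>
    obtain k where k: "\<forall>B\<in>sets Lam. err k A B \<le> \<epsilon>" using uniform_mixing[OF A \<epsilon>] by blast
    have "A \<inter> (K ^^ k) -` B k = A" using B(2)[of k] by auto
    moreover have "measure M (B k) = measure M A"
      using measure_M_Kpow[OF B(1), of k k] B(2)[of k] by simp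
    ultimately have "err k A (B k) = \<bar>measure Lam A - measure Lam A * measure M A\<bar>"
      by (simp add: err_def)
    then show ?thesis using k B(1)[of k] by auto
  qed
  then have "\<bar>measure Lam A - measure Lam A * measure M A\<bar> \<le> 0" by (rule field_le_epsilon) simp
  \<comment> \<open>In the first case \<open>A\<close> is also null for \<open>M\<close> by absolute
    continuity.\<close>
  then have "measure Lam A = 0 \<or> measure M A = 1" by auto
  then show "measure M A = 0 \<or> measure M A = 1" using null_Lam_M[OF A] by blast
qed

text \<open>Extends mixing from starting sets to starting densities, by linearity and approximation
  in the mean, so that it can be applied to the density of any absolutely continuous
  measure.\<close>

lemma mixing_integrable:
  assumes f: "integrable Lam f" and B: "B \<in> sets Lam"
  shows "(\<lambda>k. \<integral>z. f z * indicator ((K ^^ k) -` B \<inter> space Lam) z \<partial>Lam) \<longlonglongrightarrow>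
    (\<integral>z. f z \<partial>Lam) * measure M B"
  using f
proof (induct rule: integrable_induct)
  case (base A c)
  have "(\<lambda>k. measure Lam (A \<inter> (K ^^ k) -` B)) \<longlonglongrightarrow> measure Lam A * measure M B"
  proof (rule LIMSEQ_I)
    fix e :: real assume "0 < e"
    then obtain k0 where k0: "\<forall>k\<ge>k0. \<forall>B\<in>sets Lam. err k A B \<le> e / 2"
      using uniform_mixing[OF base(1), of "e / 2"] by auto
    have "norm (measure Lam (A \<inter> (K ^^ k) -` B) - measure Lam A * measure M B) < e" if "k0 \<le> k" for k
    proof -
      have "err k A B \<le> e / 2" using k0 that B by blast
      then show ?thesis using \<open>0 < e\<close> by (simp add: err_def)
    qed
    then show "\<exists>k0. \<forall>k\<ge>k0. norm (measure Lam (A \<inter> (K ^^ k) -` B) - measure Lam A * measure M B) < e"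
      by blast
  qed
  then have "(\<lambda>k. measure Lam (A \<inter> (K ^^ k) -` B) * c) \<longlonglongrightarrow> (measure Lam A * measure M B) * c"
    by (intro tendsto_mult tendsto_const)
  moreover have "(\<integral>z. (indicator A z *\<^sub>R c) * indicator ((K ^^ k) -` B \<inter> space Lam) z \<partial>Lam) =
    measure Lam (A \<inter> (K ^^ k) -` B) * c" for k
  proof -
    have "(\<integral>z. (indicator A z *\<^sub>R c) * indicator ((K ^^ k) -` B \<inter> space Lam) z \<partial>Lam) =
      (\<integral>z. indicator (A \<inter> (K ^^ k) -` B) z * c \<partial>Lam)"
      by (intro Bochner_Integration.integral_cong) (auto split: split_indicator)
    moreover have "A \<inter> (K ^^ k) -` B \<inter> UNIV \<times> J = A \<inter> (K ^^ k) -` B"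
      using sets.sets_into_space[OF base(1)] by auto
    ultimately show ?thesis using Int_vimage_sets[OF base(1) B, of k] by simp
  qed
  moreover have "(\<integral>z. indicator A z *\<^sub>R c \<partial>Lam) = measure Lam A * c"
    using base(1) sets.sets_into_space[OF base(1)] by (simp add: Int_absorb2)
  ultimately show ?case by (simp only: mult_ac)
next
  case (add f g)
  have s: "(K ^^ k) -` B \<inter> space Lam \<in> sets Lam" for k by (rule vimage_sets[OF B])
  have i: "integrable Lam (\<lambda>z. f z * indicator ((K ^^ k) -` B \<inter> space Lam) z)"
    "integrable Lam (\<lambda>z. g z * indicator ((K ^^ k) -` B \<inter> space Lam) z)" for k
    by (rule integrable_real_mult_indicator[OF s add(1)], rule integrable_real_mult_indicator[OF s add(3)])
  show ?case
    using tendsto_add[OF add(2,4)] add(1,3) i by (simp add: distrib_right)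
next
  case (lim f u)
  let ?I = "\<lambda>k z. indicator ((K ^^ k) -` B \<inter> space Lam) z :: real"
  have s: "(K ^^ k) -` B \<inter> space Lam \<in> sets Lam" for k by (rule vimage_sets[OF B])
  have int: "integrable Lam (\<lambda>z. \<bar>f z - u i z\<bar>)" for i using lim(1,5) by auto
  have "(\<lambda>i. \<integral>z. \<bar>f z - u i z\<bar> \<partial>Lam) \<longlonglongrightarrow> (\<integral>z. 0 \<partial>Lam)"
  \<comment> \<open>The approximants satisfy
    \<open>\<bar>u i z\<bar> \<le> 2 * \<bar>f z\<bar>\<close>, whence the factor \<open>3\<close>
    for the difference.\<close>
  proof (rule integral_dominated_convergence[where w="\<lambda>z. 3 * \<bar>f z\<bar>"])
    show "AE z in Lam. (\<lambda>i. \<bar>f z - u i z\<bar>) \<longlonglongrightarrow> 0"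
    proof (rule AE_I2)
      fix z assume "z \<in> space Lam"
      then have "(\<lambda>i. \<bar>f z - u i z\<bar>) \<longlonglongrightarrow> \<bar>f z - f z\<bar>" by (intro tendsto_intros lim(3))
      then show "(\<lambda>i. \<bar>f z - u i z\<bar>) \<longlonglongrightarrow> 0" by simp
    qed
    show "AE z in Lam. norm \<bar>f z - u i z\<bar> \<le> 3 * \<bar>f z\<bar>" for i
    proof (rule AE_I2)
      fix z assume "z \<in> space Lam"
      then show "norm \<bar>f z - u i z\<bar> \<le> 3 * \<bar>f z\<bar>" using lim(4)[of z i] by simp
    qed
  qed (use lim(1,5) int in auto)
  then have L1: "(\<lambda>i. \<integral>z. \<bar>f z - u i z\<bar> \<partial>Lam) \<longlonglongrightarrow> 0" by simp
  show ?case
  proof (rule LIMSEQ_I)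
    fix e :: real assume e: "0 < e"
    then obtain i where i: "(\<integral>z. \<bar>f z - u i z\<bar> \<partial>Lam) < e / 3"
      using LIMSEQ_D[OF L1, of "e / 3"] by (force simp: abs_less_iff)
    obtain k0 where k0: "\<And>k. k0 \<le> k \<Longrightarrow>
      \<bar>(\<integral>z. u i z * ?I k z \<partial>Lam) - (\<integral>z. u i z \<partial>Lam) * measure M B\<bar> < e / 3"
      using LIMSEQ_D[OF lim(2)[of i], of "e / 3"] e by auto
    have "norm ((\<integral>z. f z * ?I k z \<partial>Lam) - (\<integral>z. f z \<partial>Lam) * measure M B) < e" if k: "k0 \<le> k" for k
    proof -
      have fi: "integrable Lam (\<lambda>z. f z * ?I k z)" "integrable Lam (\<lambda>z. u i z * ?I k z)"
        by (rule integrable_real_mult_indicator[OF s lim(5)], rule integrable_real_mult_indicator[OF s lim(1)])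
      have "\<bar>(\<integral>z. f z * ?I k z \<partial>Lam) - (\<integral>z. u i z * ?I k z \<partial>Lam)\<bar> = \<bar>\<integral>z. f z * ?I k z - u i z * ?I k z \<partial>Lam\<bar>"
        using fi by simp
      also have "\<dots> \<le> (\<integral>z. \<bar>f z * ?I k z - u i z * ?I k z\<bar> \<partial>Lam)" by (rule integral_abs_bound)
      also have "\<dots> \<le> (\<integral>z. \<bar>f z - u i z\<bar> \<partial>Lam)"
        using fi int by (intro integral_mono) (auto split: split_indicator)
      finally have 1: "\<bar>(\<integral>z. f z * ?I k z \<partial>Lam) - (\<integral>z. u i z * ?I k z \<partial>Lam)\<bar> < e / 3" using i by linarith
      have "\<bar>(\<integral>z. f z \<partial>Lam) - (\<integral>z. u i z \<partial>Lam)\<bar> = \<bar>\<integral>z. f z - u i z \<partial>Lam\<bar>"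
        using lim(1,5) by simp
      also have "\<dots> \<le> (\<integral>z. \<bar>f z - u i z\<bar> \<partial>Lam)" by (rule integral_abs_bound)
      finally have "\<bar>(\<integral>z. f z \<partial>Lam) - (\<integral>z. u i z \<partial>Lam)\<bar> < e / 3" using i by linarith
      moreover have "\<bar>(\<integral>z. f z \<partial>Lam) - (\<integral>z. u i z \<partial>Lam)\<bar> * measure M B \<le> \<bar>(\<integral>z. f z \<partial>Lam) - (\<integral>z. u i z \<partial>Lam)\<bar>"
        using M.prob_le_1[of B] by (intro mult_left_le) auto
      ultimately have 2: "\<bar>(\<integral>z. f z \<partial>Lam) * measure M B - (\<integral>z. u i z \<partial>Lam) * measure M B\<bar> < e / 3"
        by (simp add: abs_mult flip: left_diff_distrib)
      show ?thesis using 1 2 k0[OF k] unfolding real_norm_def by linarith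
    qed
    then show "\<exists>k0. \<forall>k\<ge>k0. norm ((\<integral>z. f z * ?I k z \<partial>Lam) - (\<integral>z. f z \<partial>Lam) * measure M B) < e" by blast
  qed
qed

text \<open>An invariant density stays put under \<open>K\<close> while mixing carries it to that of \<open>nu\<close>.\<close>

lemma invariant_unique:
  assumes inv: "invariant_ac_measure \<beta> p \<nu>"
  shows "\<nu> = nu"
proof -
  have \<nu>: "prob_space \<nu>" and sets\<nu>: "sets \<nu> = sets lam" and ac: "absolutely_continuous lam \<nu>"
    using inv by (auto simp: invariant_ac_measure_def)
  interpret \<nu>: prob_space \<nu> by fact
  interpret Q: pair_prob_space m \<nu> ..
  have sQ: "sets (m \<Otimes>\<^sub>M \<nu>) = sets Lam" using sets\<nu> by (intro sets_pair_measure_cong) auto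
  have spQ: "space (m \<Otimes>\<^sub>M \<nu>) = space Lam" using sQ by (rule sets_eq_imp_space_eq)
  have KQ: "K \<in> measurable (m \<Otimes>\<^sub>M \<nu>) (m \<Otimes>\<^sub>M \<nu>)"
    using K_measurable by (simp only: measurable_cong_sets[OF sQ sQ])
  have dQ: "distr (m \<Otimes>\<^sub>M \<nu>) (m \<Otimes>\<^sub>M \<nu>) K = m \<Otimes>\<^sub>M \<nu>"
    using inv unfolding invariant_ac_measure_def by (intro invariant_imp_distr_K) auto
  have Q1: "measure (m \<Otimes>\<^sub>M \<nu>) (K -` B \<inter> space Lam) = measure (m \<Otimes>\<^sub>M \<nu>) B" if "B \<in> sets Lam" for B
    using arg_cong[OF dQ, of "\<lambda>Q. measure Q B"] that KQ by (simp add: measure_distr sQ spQ)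
  have Qk: "measure (m \<Otimes>\<^sub>M \<nu>) ((K ^^ k) -` B \<inter> space Lam) = measure (m \<Otimes>\<^sub>M \<nu>) B" if B: "B \<in> sets Lam" for k B
  proof (induction k)
    case 0
    then show ?case using sets.sets_into_space[OF B] by (simp add: Int_absorb2)
  next
    case (Suc k)
    have "(K ^^ Suc k) -` B \<inter> space Lam = K -` ((K ^^ k) -` B \<inter> space Lam) \<inter> space Lam"
      using K_space unfolding funpow_Suc_right by auto
    then show ?case using Q1[OF vimage_sets[OF B]] Suc by metis
  qed
  \<comment> \<open>A finite nonnegative version of the density, to which real-valued integration
    applies.\<close>
  obtain g where g: "g \<in> borel_measurable lam" "AE x in lam. RN_deriv lam \<nu> x = ennreal (g x)" "\<And>x. 0 \<le> g x"
    using lam.real_RN_deriv[OF \<nu>.finite_measure_axioms ac sets\<nu>] by metis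
  have "\<nu> = density lam (RN_deriv lam \<nu>)" using lam.density_RN_deriv[OF ac sets\<nu>] by simp
  also have "\<dots> = density lam (\<lambda>x. ennreal (g x))"
    using g by (intro density_cong) auto
  finally have \<nu>g: "\<nu> = density lam (\<lambda>x. ennreal (g x))" .
  have "m \<Otimes>\<^sub>M \<nu> = density m (\<lambda>_. 1) \<Otimes>\<^sub>M density lam (\<lambda>x. ennreal (g x))"
    by (simp add: \<nu>g[symmetric] density_1)
  also have "\<dots> = density Lam (\<lambda>(\<omega>, x). 1 * ennreal (g x))"
    using \<nu>.sigma_finite_measure_axioms lam.sigma_finite_measure_axioms g(1)
    by (intro pair_measure_density) (auto simp: \<nu>g[symmetric])
  also have "\<dots> = density Lam (\<lambda>z. ennreal (g (snd z)))" by (simp add: case_prod_unfold)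
  finally have Qg: "m \<Otimes>\<^sub>M \<nu> = density Lam (\<lambda>z. ennreal (g (snd z)))" .
  have gm: "(\<lambda>z. g (snd z)) \<in> borel_measurable Lam" using g(1) by measurable
  have "integrable (m \<Otimes>\<^sub>M \<nu>) (\<lambda>_. 1 :: real)" by simp
  then have gi: "integrable Lam (\<lambda>z. g (snd z))"
    unfolding Qg using gm g(3) by (subst (asm) integrable_density) auto
  have Qint: "measure (m \<Otimes>\<^sub>M \<nu>) A = (\<integral>z. g (snd z) * indicator A z \<partial>Lam)" if A: "A \<in> sets Lam" for A
  proof -
    have "measure (m \<Otimes>\<^sub>M \<nu>) A = (\<integral>z. indicator A z \<partial>(m \<Otimes>\<^sub>M \<nu>))"
      using sets.sets_into_space[OF A] by (simp add: spQ Int_absorb2)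
    also have "\<dots> = (\<integral>z. g (snd z) * indicator A z \<partial>Lam)"
      unfolding Qg using A gm g(3) by (subst integral_density) auto
    finally show ?thesis .
  qed
  have g1: "(\<integral>z. g (snd z) \<partial>Lam) = 1"
  proof -
    have "measure (m \<Otimes>\<^sub>M \<nu>) (space Lam) = 1" using Q.prob_space by (simp only: spQ)
    moreover have "(\<integral>z. g (snd z) * indicator (space Lam) z \<partial>Lam) = (\<integral>z. g (snd z) \<partial>Lam)"
      by (intro Bochner_Integration.integral_cong) auto
    ultimately show ?thesis using Qint[OF sets.top] by simp
  qed
  have eq: "measure (m \<Otimes>\<^sub>M \<nu>) A = measure M A" if A: "A \<in> sets Lam" for A
  proof -
    have "(\<lambda>k. measure (m \<Otimes>\<^sub>M \<nu>) ((K ^^ k) -` A \<inter> space Lam)) \<longlonglongrightarrow> 1 * measure M A"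
      using mixing_integrable[OF gi A] unfolding Qint[OF vimage_sets[OF A]] g1 .
    then show ?thesis unfolding Qk[OF A] by (simp add: LIMSEQ_const_iff)
  qed
  show ?thesis
  proof (rule measure_eqI)
    show "sets \<nu> = sets nu" by (simp add: sets\<nu> sets_nu)
    fix B assume "B \<in> sets \<nu>"
    then have B: "B \<in> sets lam" using sets\<nu> by simp
    have UB: "UNIV \<times> B \<in> sets Lam" using B by simp
    have "emeasure \<nu> B = emeasure (m \<Otimes>\<^sub>M \<nu>) (UNIV \<times> B)"
      using B sets\<nu> m.emeasure_space_1 by (simp add: \<nu>.emeasure_pair_measure_Times)
    also have "\<dots> = emeasure M (UNIV \<times> B)"
      using eq[OF UB] by (simp add: Q.emeasure_eq_measure M.emeasure_eq_measure)
    also have "\<dots> = emeasure nu B"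
      using B sets_nu m.emeasure_space_1 by (simp add: nu.emeasure_pair_measure_Times)
    finally show "emeasure \<nu> B = emeasure nu B" .
  qed
qed

lemma mu_eq_nu: "mu \<beta> p = nu"
  unfolding mu_def using nu_invariant invariant_unique by (intro the_equality)

end

text \<open>The clause on \<open>sets\<close> turns agreement on \<open>sets (leb \<beta>)\<close>
  into equality of the two measures.\<close>

theorem proposition2:
  fixes \<beta> p :: real and n :: nat and b :: "nat \<Rightarrow> nat"
  assumes "\<beta> > 1" and "\<beta> \<notin> \<int>"
    and "n \<ge> 2" and "\<And>i. 1 \<le> i \<Longrightarrow> i \<le> n \<Longrightarrow> b i \<ge> 1"
    and "finite_greedy_expansion \<beta> 1 n b"
    and "\<beta>\<^sup>2 \<noteq> b 1 * \<beta> + 1"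
    and "0 < p" and "p < 1"
  shows "exact_map (bernoulli_measure p \<Otimes>\<^sub>M mu \<beta> p) (K_beta \<beta>) \<and>
    sets (mu \<beta> p) = sets (leb \<beta>) \<and>
    (\<forall>B\<in>sets (leb \<beta>). emeasure (mu \<beta> p) B =
       ennreal (\<Sum>j=0..last_index \<beta> n. measure (leb \<beta>) (B \<inter> cell \<beta> n j) / measure (leb \<beta>) (cell \<beta> n j)
         * pmf (stationary_dist \<beta> p n) j))"
proof -
  interpret greedy_coin \<beta> n b p
    using assms by unfold_locales auto
  show ?thesis
    using exact_M sets_nu emeasure_nu
    by (simp add: mu_eq_nu wt_def \<pi>_def atLeast0AtMost)
qed

end
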